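(* Let $(L,d,\lambda)$ be a weak Lie 3-algebra and let the 3-term complex $(L',d')$ be a deformation retract of $(L,d)$, i.e. there are given chain maps $p\colon L\to L'$ and $i\colon L'\to L$ and a degree $1$ map $h\colon L\to L$ with $\mathrm{id}_L-i\circ p=d h+h d$ and $\mathrm{id}_{L'}-p\circ i=0$. Then $(L',d')$ can be equipped with a (transferred) weak Lie 3-algebra structure in such a way that the map $i$ admits an extension to a weak morphism of weak Lie 3-algebras $L'\to L$, i.e. there is a weak morphism $(i_1,i_2,i_{2;1},i_3)$ with $i_1=i$.
   Context: Conventions. $\Bbbk$ is an arbitrary unital commutative ring; complexes are complexes of $\Bbbk$-modules with differential of degree $-1$; the Koszul sign rule is used. A 3-term complex is $(L,d)=L_0\xleftarrow{d}L_1\xleftarrow{d}L_2$, concentrated in degrees $0,1,2$. A map $L^{\otimes n}\to L'[k]$ means a $\Bbbk$-linear map raising degree by $k$. For a multilinear map $\mu$: $\mu^\sigma(v_1,\dots,v_n)=\varepsilon\,\mu(v_{\sigma^{-1}(1)},\dots,v_{\sigma^{-1}(n)})$ with $\varepsilon$ the Koszul sign ($(123)$ means $1\mapsto2\mapsto3\mapsto1$); $\partial(\mu)=d\circ\mu-(-1)^{|\mu|}\mu\circ d_{L^{\otimes n}}$; $(\mu\circ_i\nu)(v_1,\dots,v_{n+k-1})=(-1)^{|\nu|(|v_1|+\dots+|v_{i-1}|)}\mu(v_1,\dots,v_{i-1},\nu(v_i,\dots,v_{i+k-1}),v_{i+k},\dots)$ for $\nu$ of arity $k$; $\mu\circ(\nu_1,\dots,\nu_m)=\mu\circ(\nu_1\otimes\dots\otimes\nu_m)$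 and $\mu\circ(\nu_1,\dots,\nu_m)^\sigma=(\mu\circ(\nu_1,\dots,\nu_m))^\sigma$. Leibniz 3-algebra. A 3-term complex $(L,d)$ with maps $\lambda_2\colon L^{\otimes2}\to L$, $\lambda_3\colon L^{\otimes3}\to L[1]$, $\lambda_4\colon L^{\otimes4}\to L[2]$ such that $\partial(\lambda_2)=0$; $\partial(\lambda_3)=\lambda_2\circ_2\lambda_2-\lambda_2\circ_1\lambda_2-(\lambda_2\circ_2\lambda_2)^{(12)}$; $\partial(\lambda_4)=\lambda_2\circ_1\lambda_3+\lambda_2\circ_2\lambda_3-(\lambda_2\circ_2\lambda_3)^{(12)}+(\lambda_2\circ_2\lambda_3)^{(123)}-\lambda_3\circ_1\lambda_2+\lambda_3\circ_2\lambda_2-(\lambda_3\circ_2\lambda_2)^{(12)}-\lambda_3\circ_3\lambda_2+(\lambda_3\circ_3\lambda_2)^{(23)}-(\lambda_3\circ_3\lambda_2)^{(132)}$; $0=\lambda_2\circ_1\lambda_4-\lambda_2\circ_2\lambda_4+(\lambda_2\circ_2\lambda_4)^{(12)}-(\lambda_2\circ_2\lambda_4)^{(123)}+(\lambda_2\circ_2\lambda_4)^{(1234)}+\lambda_3\circ_1\lambda_3+\lambda_3\circ_2\lambda_3-(\lambda_3\circ_2\lambda_3)^{(12)}+(\lambda_3\circ_2\lambda_3)^{(123)}+\lambda_3\circ_3\lambda_3-(\lambda_3\circ_3\lambda_3)^{(23)}+(\lambda_3\circ_3\lambda_3)^{(132)}+(\lambda_3\circ_3\lambda_3)^{(234)}-(\lambda_3\circ_3\lambda_3)^{(1342)}+(\lambda_3\circ_3\lambda_3)^{(13)(24)}+\lambda_4\circ_1\lambda_2-\lambda_4\circ_2\lambda_2+(\lambda_4\circ_2\lambda_2)^{(12)}+\lambda_4\circ_3\lambda_2-(\lambda_4\circ_3\lambda_2)^{(23)}+(\lambda_4\circ_3\lambda_2)^{(132)}-\lambda_4\circ_4\lambda_2+(\lambda_4\circ_4\lambda_2)^{(34)}-(\lambda_4\circ_4\lambda_2)^{(243)}+(\lambda_4\circ_4\lambda_2)^{(1432)}$.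 Weak Lie 3-algebra $(L,d,\lambda)$. A Leibniz 3-algebra together with maps $\lambda_{2;1}\colon L^{\otimes2}\to L[1]$, $\lambda_{2;1,1}\colon L^{\otimes2}\to L[2]$, $\lambda_{3;1},\lambda_{3;2}\colon L^{\otimes3}\to L[2]$ such that $\partial(\lambda_{2;1})=\lambda_2+\lambda_2^{(12)}$; $\partial(\lambda_{2;1,1})=\lambda_{2;1}-\lambda_{2;1}^{(12)}$; $\partial(\lambda_{3;1})=\lambda_3+\lambda_3^{(12)}+\lambda_2\circ_1\lambda_{2;1}$; $\partial(\lambda_{3;2})=\lambda_3+\lambda_3^{(23)}-\lambda_2\circ_2\lambda_{2;1}+\lambda_{2;1}\circ_1\lambda_2+(\lambda_{2;1}\circ_2\lambda_2)^{(12)}$; $\lambda_{2;1,1}+\lambda_{2;1,1}^{(12)}=0$; $\lambda_{3;1}-\lambda_{3;1}^{(12)}=\lambda_2\circ_1\lambda_{2;1,1}$; $\lambda_{3;1}-\lambda_{3;2}^{(12)}+\lambda_{3;1}^{(132)}-\lambda_{3;2}+\lambda_{3;1}^{(23)}-\lambda_{3;2}^{(123)}=\lambda_{2;1}\circ_2\lambda_{2;1}+\lambda_{2;1}\circ_1\lambda_{2;1}+(\lambda_{2;1}\circ_2\lambda_{2;1})^{(12)}+(\lambda_{2;1,1}\circ_2\lambda_2)^{(132)}$; $\lambda_{3;2}-\lambda_{3;2}^{(23)}=-\lambda_2\circ_2\lambda_{2;1,1}+\lambda_{2;1,1}\circ_1\lambda_2+(\lambda_{2;1,1}\circ_2\lambda_2)^{(12)}$;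 $\lambda_4+\lambda_4^{(12)}=\lambda_2\circ_1\lambda_{3;1}-\lambda_{3;1}\circ_3\lambda_2+(\lambda_2\circ_2\lambda_{3;1})^{(123)}+\lambda_3\circ_1\lambda_{2;1}$; $\lambda_4+\lambda_4^{(23)}=\lambda_2\circ_1\lambda_{3;2}-\lambda_3\circ_2\lambda_{2;1}+\lambda_2\circ_2\lambda_{3;1}-\lambda_{3;1}\circ_1\lambda_2-(\lambda_{3;1}\circ_2\lambda_2)^{(12)}-(\lambda_{3;1}\circ_3\lambda_2)^{(132)}$; $\lambda_4+\lambda_4^{(34)}=\lambda_{2;1}\circ_1\lambda_3-\lambda_{3;2}\circ_1\lambda_2+\lambda_{3;2}\circ_2\lambda_2-(\lambda_{3;2}\circ_2\lambda_2)^{(12)}+\lambda_3\circ_3\lambda_{2;1}+(\lambda_{3;2}\circ_3\lambda_2)^{(23)}-(\lambda_{3;2}\circ_3\lambda_2)^{(132)}+\lambda_2\circ_2\lambda_{3;2}-(\lambda_2\circ_2\lambda_{3;2})^{(12)}+(\lambda_{2;1}\circ_2\lambda_3)^{(123)}$. Weak morphism of weak Lie 3-algebras $f\colon(L,d,\lambda)\to(L',d',\lambda')$. Maps $f_1\colon L\to L'$, $f_2\colon L^{\otimes2}\to L'[1]$, $f_{2;1}\colon L^{\otimes2}\to L'[2]$, $f_3\colon L^{\otimes3}\to L'[2]$ such that $\partial(f_1)=0$; $\partial(f_2)=f_1\circ\lambda_2-\lambda_2'\circ(f_1,f_1)$; $\partial(f_3)=f_1\circ\lambda_3-f_2\circ_2\lambda_2+f_2\circ_1\lambda_2+(f_2\circ_2\lambda_2)^{(12)}-\lambda_3'\circ(f_1,f_1,f_1)-\lambda_2'\circ(f_1,f_2)+\lambda_2'\circ(f_2,f_1)+\lambda_2'\circ(f_1,f_2)^{(12)}$;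 $f_1\circ\lambda_4-\lambda_4'\circ(f_1,f_1,f_1,f_1)=f_2\circ_1\lambda_3+f_2\circ_2\lambda_3-(f_2\circ_2\lambda_3)^{(12)}+(f_2\circ_2\lambda_3)^{(123)}-f_3\circ_1\lambda_2+f_3\circ_2\lambda_2-(f_3\circ_2\lambda_2)^{(12)}-f_3\circ_3\lambda_2+(f_3\circ_3\lambda_2)^{(23)}-(f_3\circ_3\lambda_2)^{(132)}+\lambda_2'\circ(f_3,f_1)+\lambda_2'\circ(f_1,f_3)-\lambda_2'\circ(f_1,f_3)^{(12)}+\lambda_2'\circ(f_1,f_3)^{(123)}-\lambda_2'\circ(f_2,f_2)+\lambda_2'\circ(f_2,f_2)^{(23)}-\lambda_2'\circ(f_2,f_2)^{(132)}+\lambda_3'\circ(f_2,f_1,f_1)-\lambda_3'\circ(f_1,f_2,f_1)+\lambda_3'\circ(f_1,f_2,f_1)^{(12)}+\lambda_3'\circ(f_1,f_1,f_2)-\lambda_3'\circ(f_1,f_1,f_2)^{(23)}+\lambda_3'\circ(f_1,f_1,f_2)^{(132)}$; $\partial(f_{2;1})=-f_2-f_2^{(12)}+f_1\circ\lambda_{2;1}-\lambda_{2;1}'\circ(f_1,f_1)$; $f_1\circ\lambda_{2;1,1}-\lambda_{2;1,1}'\circ(f_1,f_1)=f_{2;1}-f_{2;1}^{(12)}$; $f_1\circ\lambda_{3;1}-\lambda_{3;1}'\circ(f_1,f_1,f_1)=f_3+f_3^{(12)}+f_2\circ_1\lambda_{2;1}+\lambda_2'\circ(f_{2;1},f_1)$;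 $f_1\circ\lambda_{3;2}-\lambda_{3;2}'\circ(f_1,f_1,f_1)=f_3+f_3^{(23)}-f_2\circ_2\lambda_{2;1}+f_{2;1}\circ_1\lambda_2+(f_{2;1}\circ_2\lambda_2)^{(12)}-\lambda_2'\circ(f_1,f_{2;1})-\lambda_{2;1}'\circ(f_2,f_1)-\lambda_{2;1}'\circ(f_1,f_2)^{(12)}$. *)

theory Defs
  imports Complex_Main "HOL-Combinatorics.Cycles"
begin

section \<open>Graded multilinear maps\<close>

text \<open>
  A graded module is a family \<open>L :: int \<Rightarrow> 'v set\<close> of modules whose underlying sets lie in one
  additive group, and a homogeneous element is a pair (degree, vector). The pieces \<open>L n\<close> need not be
  independent in \<open>'v\<close>, because the degree is recorded separately; every family of modules arises
  this way, inside its direct sum. A linear map out of \<open>L\<^sup>\<otimes>\<^sup>n\<close> is given by its multilinear components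
  on lists of homogeneous elements.

  The sort of \<open>'k\<close> describes the unital commutative rings; the class \<open>comm_ring_1\<close>
  would exclude the zero ring.
\<close>

locale graded_module =
  fixes s :: "'k::{comm_ring,comm_monoid_mult} \<Rightarrow> 'v::ab_group_add \<Rightarrow> 'v"
    and L :: "int \<Rightarrow> 'v set"
  assumes zero_mem: "0 \<in> L n"
    and add_mem: "x \<in> L n \<Longrightarrow> y \<in> L n \<Longrightarrow> x + y \<in> L n"
    and scale_mem: "x \<in> L n \<Longrightarrow> s a x \<in> L n"
    and scale_right: "x \<in> L n \<Longrightarrow> y \<in> L n \<Longrightarrow> s a (x + y) = s a x + s a y"
    and scale_left: "x \<in> L n \<Longrightarrow> s (a + b) x = s a x + s b x"
    and scale_scale: "x \<in> L n \<Longrightarrow> s a (s b x) = s (a * b) x"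
    and scale_one: "x \<in> L n \<Longrightarrow> s 1 x = x"

lemma (in module) graded_module:
  assumes "\<And>n. subspace (L n)"
  shows "graded_module scale L"
  using assms
  by unfold_locales
    (auto simp: subspace_0 subspace_add subspace_scale scale_right_distrib scale_left_distrib)

definition tdeg :: "(int \<times> 'v) list \<Rightarrow> int" where
  "tdeg vs = sum_list (map fst vs)"

definition homs :: "(int \<Rightarrow> 'v set) \<Rightarrow> nat \<Rightarrow> (int \<times> 'v) list set" where
  "homs L n = {vs. length vs = n \<and> (\<forall>(a, v) \<in> set vs. v \<in> L a)}"

definition sg :: "int \<Rightarrow> 'v::uminus \<Rightarrow> 'v" where
  "sg n x = (if even n then x else - x)"

datatype ('v, 'w) mmap = MMap (arity: nat) (deg: int) (app: "(int \<times> 'v) list \<Rightarrow> 'w")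

definition val :: "('v, 'w) mmap \<Rightarrow> (int \<times> 'v) list \<Rightarrow> int \<times> 'w" where
  "val \<mu> vs = (tdeg vs + deg \<mu>, app \<mu> vs)"

text \<open>\<open>mmap_on s L s' L' n k \<mu>\<close>: \<open>\<mu>\<close> is a linear map \<open>L\<^sup>\<otimes>\<^sup>n \<rightarrow> L'[k]\<close>.\<close>

definition mmap_on ::
  "('k \<Rightarrow> 'v::ab_group_add \<Rightarrow> 'v) \<Rightarrow> (int \<Rightarrow> 'v set) \<Rightarrow>
   ('k \<Rightarrow> 'w::ab_group_add \<Rightarrow> 'w) \<Rightarrow> (int \<Rightarrow> 'w set) \<Rightarrow> nat \<Rightarrow> int \<Rightarrow> ('v, 'w) mmap \<Rightarrow> bool"
where
  "mmap_on s L s' L' n k \<mu> \<longleftrightarrow>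
     arity \<mu> = n \<and> deg \<mu> = k \<and>
     (\<forall>vs \<in> homs L n. app \<mu> vs \<in> L' (tdeg vs + k)) \<and>
     (\<forall>us a x y vs. us @ (a, x) # vs \<in> homs L n \<and> y \<in> L a \<longrightarrow>
        app \<mu> (us @ (a, x + y) # vs) = app \<mu> (us @ (a, x) # vs) + app \<mu> (us @ (a, y) # vs)) \<and>
     (\<forall>us a x c vs. us @ (a, x) # vs \<in> homs L n \<longrightarrow>
        app \<mu> (us @ (a, s c x) # vs) = s' c (app \<mu> (us @ (a, x) # vs)))"

text \<open>Sums and differences are meant only for maps of equal arity and degree.\<close>

instantiation mmap :: (type, plus) plus
begin
definition "\<mu> + \<nu> = MMap (arity \<mu>) (deg \<mu>) (\<lambda>vs. app \<mu> vs + app \<nu> vs)"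
instance ..
end

instantiation mmap :: (type, minus) minus
begin
definition "\<mu> - \<nu> = MMap (arity \<mu>) (deg \<mu>) (\<lambda>vs. app \<mu> vs - app \<nu> vs)"
instance ..
end

instantiation mmap :: (type, uminus) uminus
begin
definition "- \<mu> = MMap (arity \<mu>) (deg \<mu>) (\<lambda>vs. - app \<mu> vs)"
instance ..
end

definition zero_mmap :: "nat \<Rightarrow> int \<Rightarrow> ('v, 'w::zero) mmap" where
  "zero_mmap n k = MMap n k (\<lambda>_. 0)"

definition idm :: "('v, 'v) mmap" where
  "idm = MMap 1 0 (\<lambda>vs. snd (hd vs))"

definition eq_on :: "('v, 'w) mmap \<Rightarrow> (int \<Rightarrow> 'v set) \<Rightarrow> ('v, 'w) mmap \<Rightarrow> bool"
    ("(_ \<doteq>\<^bsub>_\<^esub>/ _)" [51, 0, 51] 50) where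
  "\<mu> \<doteq>\<^bsub>L\<^esub> \<nu> \<longleftrightarrow>
     arity \<mu> = arity \<nu> \<and> deg \<mu> = deg \<nu> \<and> (\<forall>vs \<in> homs L (arity \<mu>). app \<mu> vs = app \<nu> vs)"

text \<open>Partial composition \<open>\<mu> \<circ>\<^sub>i \<nu>\<close>; inputs are numbered from 1.\<close>

definition pcomp :: "('v, 'w::uminus) mmap \<Rightarrow> nat \<Rightarrow> ('v, 'v) mmap \<Rightarrow> ('v, 'w) mmap"
    ("(_ \<circ>\<^bsub>_\<^esub>/ _)" [71, 0, 71] 70) where
  "\<mu> \<circ>\<^bsub>i\<^esub> \<nu> =
     MMap (arity \<mu> + arity \<nu> - 1) (deg \<mu> + deg \<nu>)
       (\<lambda>vs. let pre = take (i - 1) vs;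
                 mid = take (arity \<nu>) (drop (i - 1) vs);
                 post = drop (i - 1 + arity \<nu>) vs
             in sg (deg \<nu> * tdeg pre) (app \<mu> (pre @ [val \<nu> mid] @ post)))"

text \<open>
  Evaluation of \<open>\<nu>\<^sub>1 \<otimes> \<dots> \<otimes> \<nu>\<^sub>m\<close>: the list is split into consecutive blocks, and moving the
  maps \<open>\<nu>\<^sub>2, \<dots>, \<nu>\<^sub>m\<close> past the block of \<open>\<nu>\<^sub>1\<close> produces the Koszul sign, and so on.
\<close>

fun tens :: "('v, 'w) mmap list \<Rightarrow> (int \<times> 'v) list \<Rightarrow> (int \<times> 'w) list" where
  "tens [] vs = []"
| "tens (\<nu> # \<nu>s) vs = val \<nu> (take (arity \<nu>) vs) # tens \<nu>s (drop (arity \<nu>) vs)"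

fun tens_sign :: "('v, 'w) mmap list \<Rightarrow> (int \<times> 'v) list \<Rightarrow> int" where
  "tens_sign [] vs = 0"
| "tens_sign (\<nu> # \<nu>s) vs =
     sum_list (map deg \<nu>s) * tdeg (take (arity \<nu>) vs) + tens_sign \<nu>s (drop (arity \<nu>) vs)"

definition tcomp :: "('w, 'x::uminus) mmap \<Rightarrow> ('v, 'w) mmap list \<Rightarrow> ('v, 'x) mmap"
    (infixl "\<odot>" 70) where
  "\<mu> \<odot> \<nu>s =
     MMap (sum_list (map arity \<nu>s)) (deg \<mu> + sum_list (map deg \<nu>s))
       (\<lambda>vs. sg (tens_sign \<nu>s vs) (app \<mu> (tens \<nu>s vs)))"

text \<open>
  \<open>\<mu>\<^sup>\<sigma>(v\<^sub>1, \<dots>, v\<^sub>n) = \<epsilon> \<mu>(v\<^bsub>\<sigma>\<inverse>(1)\<^esub>, \<dots>, v\<^bsub>\<sigma>\<inverse>(n)\<^esub>)\<close>. The element \<open>v\<^sub>i\<close> moves to position \<open>\<sigma>(i)\<close>, so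
  the inversions of \<open>\<sigma>\<close> are the pairs of elements that pass each other.
\<close>

definition perm :: "('v, 'w::uminus) mmap \<Rightarrow> (nat \<Rightarrow> nat) \<Rightarrow> ('v, 'w) mmap"
    ("(_\<^bsup>_\<^esup>)" [1000, 0] 1000) where
  "\<mu>\<^bsup>\<sigma>\<^esup> =
     MMap (arity \<mu>) (deg \<mu>)
       (\<lambda>vs. sg (\<Sum>(i, j) \<in> {(i, j). 1 \<le> i \<and> i < j \<and> j \<le> arity \<mu> \<and> \<sigma> j < \<sigma> i}.
                   fst (vs ! (i - 1)) * fst (vs ! (j - 1)))
                (app \<mu> (map (\<lambda>j. vs ! (inv \<sigma> j - 1)) [1..<arity \<mu> + 1])))"

abbreviation cyc :: "nat list \<Rightarrow> nat \<Rightarrow> nat" where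
  "cyc \<equiv> cycle_of_list"

text \<open>\<open>bd d d' \<mu>\<close> is \<open>\<partial>(\<mu>)\<close> for \<open>\<mu>\<close> with source differential \<open>d\<close> and target differential \<open>d'\<close>.\<close>

definition bd :: "('v, 'v) mmap \<Rightarrow> ('w::ab_group_add, 'w) mmap \<Rightarrow> ('v, 'w) mmap \<Rightarrow> ('v, 'w) mmap" where
  "bd d d' \<mu> =
     MMap (arity \<mu>) (deg \<mu> - 1)
       (\<lambda>vs. app (d' \<odot> [\<mu>]) vs - sg (deg \<mu>) (\<Sum>i = 1..arity \<mu>. app (\<mu> \<circ>\<^bsub>i\<^esub> d) vs))"


section \<open>Complexes and deformation retracts\<close>

locale three_term_complex = graded_module s L
  for s :: "'k::{comm_ring,comm_monoid_mult} \<Rightarrow> 'v::ab_group_add \<Rightarrow> 'v"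
    and L :: "int \<Rightarrow> 'v set" +
  fixes d :: "('v, 'v) mmap"
  assumes concentrated: "n \<notin> {0, 1, 2} \<Longrightarrow> L n = {0}"
    and d_map: "mmap_on s L s L 1 (-1) d"
    and d_d: "d \<odot> [d] \<doteq>\<^bsub>L\<^esub> zero_mmap 1 (-2)"

text \<open>\<open>(L', d')\<close> is a deformation retract of \<open>(L, d)\<close>, with projection \<open>p\<close>, inclusion \<open>i\<close>, homotopy \<open>h\<close>.\<close>

locale deformation_retract =
  big: three_term_complex s L d + small: three_term_complex s' L' d'
  for s :: "'k::{comm_ring,comm_monoid_mult} \<Rightarrow> 'v::ab_group_add \<Rightarrow> 'v"
    and L :: "int \<Rightarrow> 'v set" and d :: "('v, 'v) mmap"
    and s' :: "'k \<Rightarrow> 'w::ab_group_add \<Rightarrow> 'w"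
    and L' :: "int \<Rightarrow> 'w set" and d' :: "('w, 'w) mmap" +
  fixes p :: "('v, 'w) mmap" and i :: "('w, 'v) mmap" and h :: "('v, 'v) mmap"
  assumes p_map: "mmap_on s L s' L' 1 0 p"
    and i_map: "mmap_on s' L' s L 1 0 i"
    and h_map: "mmap_on s L s L 1 1 h"
    and p_chain: "bd d d' p \<doteq>\<^bsub>L\<^esub> zero_mmap 1 (-1)"
    and i_chain: "bd d' d i \<doteq>\<^bsub>L'\<^esub> zero_mmap 1 (-1)"
    and homotopy: "idm - i \<odot> [p] \<doteq>\<^bsub>L\<^esub> d \<odot> [h] + h \<odot> [d]"
    and retraction: "idm - p \<odot> [i] \<doteq>\<^bsub>L'\<^esub> zero_mmap 1 0"


section \<open>Leibniz 3-algebras and weak Lie 3-algebras\<close>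

text \<open>Subscripts are run together: \<open>l211\<close> is \<open>\<lambda>\<^bsub>2;1,1\<^esub>\<close>, \<open>l31\<close> is \<open>\<lambda>\<^bsub>3;1\<^esub>\<close>, and so on.\<close>

locale leibniz3 = three_term_complex s L d
  for s :: "'k::{comm_ring,comm_monoid_mult} \<Rightarrow> 'v::ab_group_add \<Rightarrow> 'v"
    and L :: "int \<Rightarrow> 'v set" and d :: "('v, 'v) mmap" +
  fixes l2 l3 l4 :: "('v, 'v) mmap"
  assumes l2_map: "mmap_on s L s L 2 0 l2"
    and l3_map: "mmap_on s L s L 3 1 l3"
    and l4_map: "mmap_on s L s L 4 2 l4"
    and bd_l2:
      "bd d d l2 \<doteq>\<^bsub>L\<^esub> zero_mmap 2 (-1)"
    and bd_l3:
      "bd d d l3 \<doteq>\<^bsub>L\<^esub> l2 \<circ>\<^bsub>2\<^esub> l2 - l2 \<circ>\<^bsub>1\<^esub> l2 - (l2 \<circ>\<^bsub>2\<^esub> l2)\<^bsup>cyc [1, 2]\<^esup>"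
    and bd_l4:
      "bd d d l4 \<doteq>\<^bsub>L\<^esub>
         l2 \<circ>\<^bsub>1\<^esub> l3 + l2 \<circ>\<^bsub>2\<^esub> l3 - (l2 \<circ>\<^bsub>2\<^esub> l3)\<^bsup>cyc [1, 2]\<^esup> + (l2 \<circ>\<^bsub>2\<^esub> l3)\<^bsup>cyc [1, 2, 3]\<^esup>
         - l3 \<circ>\<^bsub>1\<^esub> l2 + l3 \<circ>\<^bsub>2\<^esub> l2 - (l3 \<circ>\<^bsub>2\<^esub> l2)\<^bsup>cyc [1, 2]\<^esup> - l3 \<circ>\<^bsub>3\<^esub> l2
         + (l3 \<circ>\<^bsub>3\<^esub> l2)\<^bsup>cyc [2, 3]\<^esup> - (l3 \<circ>\<^bsub>3\<^esub> l2)\<^bsup>cyc [1, 3, 2]\<^esup>"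
    and l_5:
      "zero_mmap 5 2 \<doteq>\<^bsub>L\<^esub>
         l2 \<circ>\<^bsub>1\<^esub> l4 - l2 \<circ>\<^bsub>2\<^esub> l4 + (l2 \<circ>\<^bsub>2\<^esub> l4)\<^bsup>cyc [1, 2]\<^esup> - (l2 \<circ>\<^bsub>2\<^esub> l4)\<^bsup>cyc [1, 2, 3]\<^esup>
         + (l2 \<circ>\<^bsub>2\<^esub> l4)\<^bsup>cyc [1, 2, 3, 4]\<^esup> + l3 \<circ>\<^bsub>1\<^esub> l3 + l3 \<circ>\<^bsub>2\<^esub> l3
         - (l3 \<circ>\<^bsub>2\<^esub> l3)\<^bsup>cyc [1, 2]\<^esup> + (l3 \<circ>\<^bsub>2\<^esub> l3)\<^bsup>cyc [1, 2, 3]\<^esup> + l3 \<circ>\<^bsub>3\<^esub> l3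
         - (l3 \<circ>\<^bsub>3\<^esub> l3)\<^bsup>cyc [2, 3]\<^esup> + (l3 \<circ>\<^bsub>3\<^esub> l3)\<^bsup>cyc [1, 3, 2]\<^esup>
         + (l3 \<circ>\<^bsub>3\<^esub> l3)\<^bsup>cyc [2, 3, 4]\<^esup> - (l3 \<circ>\<^bsub>3\<^esub> l3)\<^bsup>cyc [1, 3, 4, 2]\<^esup>
         + (l3 \<circ>\<^bsub>3\<^esub> l3)\<^bsup>cyc [1, 3] \<circ> cyc [2, 4]\<^esup> + l4 \<circ>\<^bsub>1\<^esub> l2 - l4 \<circ>\<^bsub>2\<^esub> l2
         + (l4 \<circ>\<^bsub>2\<^esub> l2)\<^bsup>cyc [1, 2]\<^esup> + l4 \<circ>\<^bsub>3\<^esub> l2 - (l4 \<circ>\<^bsub>3\<^esub> l2)\<^bsup>cyc [2, 3]\<^esup>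
         + (l4 \<circ>\<^bsub>3\<^esub> l2)\<^bsup>cyc [1, 3, 2]\<^esup> - l4 \<circ>\<^bsub>4\<^esub> l2 + (l4 \<circ>\<^bsub>4\<^esub> l2)\<^bsup>cyc [3, 4]\<^esup>
         - (l4 \<circ>\<^bsub>4\<^esub> l2)\<^bsup>cyc [2, 4, 3]\<^esup> + (l4 \<circ>\<^bsub>4\<^esub> l2)\<^bsup>cyc [1, 4, 3, 2]\<^esup>"

locale weak_lie3 = leibniz3 s L d l2 l3 l4
  for s :: "'k::{comm_ring,comm_monoid_mult} \<Rightarrow> 'v::ab_group_add \<Rightarrow> 'v"
    and L :: "int \<Rightarrow> 'v set" and d l2 l3 l4 :: "('v, 'v) mmap" +
  fixes l21 l211 l31 l32 :: "('v, 'v) mmap"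
  assumes l21_map: "mmap_on s L s L 2 1 l21"
    and l211_map: "mmap_on s L s L 2 2 l211"
    and l31_map: "mmap_on s L s L 3 2 l31"
    and l32_map: "mmap_on s L s L 3 2 l32"
    and bd_l21:
      "bd d d l21 \<doteq>\<^bsub>L\<^esub> l2 + l2\<^bsup>cyc [1, 2]\<^esup>"
    and bd_l211:
      "bd d d l211 \<doteq>\<^bsub>L\<^esub> l21 - l21\<^bsup>cyc [1, 2]\<^esup>"
    and bd_l31:
      "bd d d l31 \<doteq>\<^bsub>L\<^esub> l3 + l3\<^bsup>cyc [1, 2]\<^esup> + l2 \<circ>\<^bsub>1\<^esub> l21"
    and bd_l32:
      "bd d d l32 \<doteq>\<^bsub>L\<^esub>
         l3 + l3\<^bsup>cyc [2, 3]\<^esup> - l2 \<circ>\<^bsub>2\<^esub> l21 + l21 \<circ>\<^bsub>1\<^esub> l2 + (l21 \<circ>\<^bsub>2\<^esub> l2)\<^bsup>cyc [1, 2]\<^esup>"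
    and l211_skew:
      "l211 + l211\<^bsup>cyc [1, 2]\<^esup> \<doteq>\<^bsub>L\<^esub> zero_mmap 2 2"
    and l31_skew:
      "l31 - l31\<^bsup>cyc [1, 2]\<^esup> \<doteq>\<^bsub>L\<^esub> l2 \<circ>\<^bsub>1\<^esub> l211"
    and l31_l32:
      "l31 - l32\<^bsup>cyc [1, 2]\<^esup> + l31\<^bsup>cyc [1, 3, 2]\<^esup> - l32 + l31\<^bsup>cyc [2, 3]\<^esup>
       - l32\<^bsup>cyc [1, 2, 3]\<^esup> \<doteq>\<^bsub>L\<^esub>
         l21 \<circ>\<^bsub>2\<^esub> l21 + l21 \<circ>\<^bsub>1\<^esub> l21 + (l21 \<circ>\<^bsub>2\<^esub> l21)\<^bsup>cyc [1, 2]\<^esup>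
         + (l211 \<circ>\<^bsub>2\<^esub> l2)\<^bsup>cyc [1, 3, 2]\<^esup>"
    and l32_skew:
      "l32 - l32\<^bsup>cyc [2, 3]\<^esup> \<doteq>\<^bsub>L\<^esub>
         - (l2 \<circ>\<^bsub>2\<^esub> l211) + l211 \<circ>\<^bsub>1\<^esub> l2 + (l211 \<circ>\<^bsub>2\<^esub> l2)\<^bsup>cyc [1, 2]\<^esup>"
    and l4_12:
      "l4 + l4\<^bsup>cyc [1, 2]\<^esup> \<doteq>\<^bsub>L\<^esub>
         l2 \<circ>\<^bsub>1\<^esub> l31 - l31 \<circ>\<^bsub>3\<^esub> l2 + (l2 \<circ>\<^bsub>2\<^esub> l31)\<^bsup>cyc [1, 2, 3]\<^esup> + l3 \<circ>\<^bsub>1\<^esub> l21"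
    and l4_23:
      "l4 + l4\<^bsup>cyc [2, 3]\<^esup> \<doteq>\<^bsub>L\<^esub>
         l2 \<circ>\<^bsub>1\<^esub> l32 - l3 \<circ>\<^bsub>2\<^esub> l21 + l2 \<circ>\<^bsub>2\<^esub> l31 - l31 \<circ>\<^bsub>1\<^esub> l2 - (l31 \<circ>\<^bsub>2\<^esub> l2)\<^bsup>cyc [1, 2]\<^esup>
         - (l31 \<circ>\<^bsub>3\<^esub> l2)\<^bsup>cyc [1, 3, 2]\<^esup>"
    and l4_34:
      "l4 + l4\<^bsup>cyc [3, 4]\<^esup> \<doteq>\<^bsub>L\<^esub>
         l21 \<circ>\<^bsub>1\<^esub> l3 - l32 \<circ>\<^bsub>1\<^esub> l2 + l32 \<circ>\<^bsub>2\<^esub> l2 - (l32 \<circ>\<^bsub>2\<^esub> l2)\<^bsup>cyc [1, 2]\<^esup> + l3 \<circ>\<^bsub>3\<^esub> l21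
         + (l32 \<circ>\<^bsub>3\<^esub> l2)\<^bsup>cyc [2, 3]\<^esup> - (l32 \<circ>\<^bsub>3\<^esub> l2)\<^bsup>cyc [1, 3, 2]\<^esup> + l2 \<circ>\<^bsub>2\<^esub> l32
         - (l2 \<circ>\<^bsub>2\<^esub> l32)\<^bsup>cyc [1, 2]\<^esup> + (l21 \<circ>\<^bsub>2\<^esub> l3)\<^bsup>cyc [1, 2, 3]\<^esup>"


section \<open>Weak morphisms\<close>

locale weak_lie3_morphism =
  src: weak_lie3 s L d l2 l3 l4 l21 l211 l31 l32 +
  tgt: weak_lie3 s' L' d' l2' l3' l4' l21' l211' l31' l32'
  for s :: "'k::{comm_ring,comm_monoid_mult} \<Rightarrow> 'v::ab_group_add \<Rightarrow> 'v"
    and L :: "int \<Rightarrow> 'v set"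
    and d l2 l3 l4 l21 l211 l31 l32 :: "('v, 'v) mmap"
    and s' :: "'k \<Rightarrow> 'w::ab_group_add \<Rightarrow> 'w"
    and L' :: "int \<Rightarrow> 'w set"
    and d' l2' l3' l4' l21' l211' l31' l32' :: "('w, 'w) mmap" +
  fixes f1 f2 f21 f3 :: "('v, 'w) mmap"
  assumes f1_map: "mmap_on s L s' L' 1 0 f1"
    and f2_map: "mmap_on s L s' L' 2 1 f2"
    and f21_map: "mmap_on s L s' L' 2 2 f21"
    and f3_map: "mmap_on s L s' L' 3 2 f3"
    and bd_f1:
      "bd d d' f1 \<doteq>\<^bsub>L\<^esub> zero_mmap 1 (-1)"
    and bd_f2:
      "bd d d' f2 \<doteq>\<^bsub>L\<^esub> f1 \<odot> [l2] - l2' \<odot> [f1, f1]"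
    and bd_f3:
      "bd d d' f3 \<doteq>\<^bsub>L\<^esub>
         f1 \<odot> [l3] - f2 \<circ>\<^bsub>2\<^esub> l2 + f2 \<circ>\<^bsub>1\<^esub> l2 + (f2 \<circ>\<^bsub>2\<^esub> l2)\<^bsup>cyc [1, 2]\<^esup> - l3' \<odot> [f1, f1, f1]
         - l2' \<odot> [f1, f2] + l2' \<odot> [f2, f1] + (l2' \<odot> [f1, f2])\<^bsup>cyc [1, 2]\<^esup>"
    and f_l4:
      "f1 \<odot> [l4] - l4' \<odot> [f1, f1, f1, f1] \<doteq>\<^bsub>L\<^esub>
         f2 \<circ>\<^bsub>1\<^esub> l3 + f2 \<circ>\<^bsub>2\<^esub> l3 - (f2 \<circ>\<^bsub>2\<^esub> l3)\<^bsup>cyc [1, 2]\<^esup> + (f2 \<circ>\<^bsub>2\<^esub> l3)\<^bsup>cyc [1, 2, 3]\<^esup>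
         - f3 \<circ>\<^bsub>1\<^esub> l2 + f3 \<circ>\<^bsub>2\<^esub> l2 - (f3 \<circ>\<^bsub>2\<^esub> l2)\<^bsup>cyc [1, 2]\<^esup> - f3 \<circ>\<^bsub>3\<^esub> l2
         + (f3 \<circ>\<^bsub>3\<^esub> l2)\<^bsup>cyc [2, 3]\<^esup> - (f3 \<circ>\<^bsub>3\<^esub> l2)\<^bsup>cyc [1, 3, 2]\<^esup> + l2' \<odot> [f3, f1]
         + l2' \<odot> [f1, f3] - (l2' \<odot> [f1, f3])\<^bsup>cyc [1, 2]\<^esup>
         + (l2' \<odot> [f1, f3])\<^bsup>cyc [1, 2, 3]\<^esup> - l2' \<odot> [f2, f2]
         + (l2' \<odot> [f2, f2])\<^bsup>cyc [2, 3]\<^esup> - (l2' \<odot> [f2, f2])\<^bsup>cyc [1, 3, 2]\<^esup>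
         + l3' \<odot> [f2, f1, f1] - l3' \<odot> [f1, f2, f1] + (l3' \<odot> [f1, f2, f1])\<^bsup>cyc [1, 2]\<^esup>
         + l3' \<odot> [f1, f1, f2] - (l3' \<odot> [f1, f1, f2])\<^bsup>cyc [2, 3]\<^esup>
         + (l3' \<odot> [f1, f1, f2])\<^bsup>cyc [1, 3, 2]\<^esup>"
    and bd_f21:
      "bd d d' f21 \<doteq>\<^bsub>L\<^esub> - f2 - f2\<^bsup>cyc [1, 2]\<^esup> + f1 \<odot> [l21] - l21' \<odot> [f1, f1]"
    and f_l211:
      "f1 \<odot> [l211] - l211' \<odot> [f1, f1] \<doteq>\<^bsub>L\<^esub> f21 - f21\<^bsup>cyc [1, 2]\<^esup>"
    and f_l31:
      "f1 \<odot> [l31] - l31' \<odot> [f1, f1, f1] \<doteq>\<^bsub>L\<^esub>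
         f3 + f3\<^bsup>cyc [1, 2]\<^esup> + f2 \<circ>\<^bsub>1\<^esub> l21 + l2' \<odot> [f21, f1]"
    and f_l32:
      "f1 \<odot> [l32] - l32' \<odot> [f1, f1, f1] \<doteq>\<^bsub>L\<^esub>
         f3 + f3\<^bsup>cyc [2, 3]\<^esup> - f2 \<circ>\<^bsub>2\<^esub> l21 + f21 \<circ>\<^bsub>1\<^esub> l2 + (f21 \<circ>\<^bsub>2\<^esub> l2)\<^bsup>cyc [1, 2]\<^esup>
         - l2' \<odot> [f1, f21] - l21' \<odot> [f2, f1] - (l21' \<odot> [f1, f2])\<^bsup>cyc [1, 2]\<^esup>"

end

theory Submission
  imports Defs
begin

text \<open>
  After replacing the homotopy by \<open>h (1 - i p)\<close> we may assume \<open>h i = 0\<close>. Each transferred operation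
  is \<open>\<lambda>' = p r\<close> and the matching component of the morphism is \<open>- h r\<close>, where the morphism equation is
  read as \<open>\<partial>f = i \<lambda>' - r\<close>, with \<open>r\<close> made of operations already constructed. If \<open>\<partial>r = i \<omega>\<close>, where
  \<open>\<partial>\<lambda>' = \<omega>\<close> is the required axiom, then \<open>\<partial>(p r) = p i \<omega> = \<omega>\<close> and
  \<open>\<partial>(- h r) = - (1 - i p) r + h i \<omega> = i \<lambda>' - r\<close>. In degree 2 the map \<open>h r\<close> vanishes, so \<open>i \<lambda>' = r\<close>.

  Hence only the identities \<open>\<partial>r = i \<omega>\<close> and the axioms in degree 2 are left. The former are formal
  consequences of the earlier equations. The latter concern inputs of degree 0 and, after applying the
  injection \<open>i\<close>, differ from the axiom for \<open>L\<close> by the differential of an element of degree 3, which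
  is zero.
\<close>

section \<open>Multilinear maps\<close>

text \<open>The obstacle is size: the formulas are sums of up to dozens of trees with Koszul signs,
  which is why everything is evaluated on homogeneous elements. A three-term complex leaves finitely
  many degree tuples, and in each of them every sign is a constant. The boundary equations, read as
  rewrite rules, push differentials inward until they reach an input, where
  \<open>d i = i d'\<close> and \<open>d d = 0\<close> apply; then two sums in an abelian group are
  compared. The argument about \<open>h\<close> is made once, for an arbitrary \<open>R\<close>;
  afterwards \<open>l2'\<close>, \<open>i2\<close>, \<open>l3'\<close>, ... enter the calculations
  only through degrees, linearity and boundary equations.

  In degree 2 this rewriting alone does not suffice. Elements of degree 3 are zero, but their
  boundaries, expanded formally, are the missing relations. So each identity in degree 2 comes with
  an explicit element of degree 3, whose shape is read off from the operations of \<open>L'\<close>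
  that have to be traded for operations of \<open>L\<close>.\<close>

context graded_module
begin

lemma scale_zero_left: "x \<in> L n \<Longrightarrow> s 0 x = 0"
  using scale_left[of x n 0 0] by simp

lemma scale_zero_right: "s a 0 = 0"
  using scale_right[OF zero_mem zero_mem, of a] by simp

text \<open>The axioms give closure under sums and scalars only. Negation is recovered as scaling by
  \<open>- 1\<close>, and this is what keeps differences and Koszul signs inside
  \<open>L n\<close>.\<close>

lemma uminus_scale: "x \<in> L n \<Longrightarrow> - x = s (- 1) x"
  using scale_left[of x n "- 1" 1] scale_zero_left[of x n] scale_one[of x n]
  by (simp add: neg_eq_iff_add_eq_0 add.commute)

lemma minus_mem: "x \<in> L n \<Longrightarrow> - x \<in> L n"
  by (simp add: uminus_scale scale_mem)

lemma diff_mem: "x \<in> L n \<Longrightarrow> y \<in> L n \<Longrightarrow> x - y \<in> L n"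
  using add_mem[OF _ minus_mem] by fastforce

lemma scale_minus: "x \<in> L n \<Longrightarrow> s a (- x) = - s a x"
  using scale_right[of x n "- x" a]
      by (simp add: minus_mem scale_zero_right eq_neg_iff_add_eq_0 add.commute)

lemma sg_mem: "x \<in> L n \<Longrightarrow> sg k x \<in> L n"
  by (simp add: sg_def minus_mem)

lemma sum_mem: "(\<And>j. j \<in> J \<Longrightarrow> f j \<in> L n) \<Longrightarrow> sum f J \<in> L n"
  by (induction J rule: infinite_finite_induct) (auto simp: zero_mem add_mem)

end

lemma sg_zero [simp]: "sg k (0 :: 'v :: group_add) = 0"
  by (simp add: sg_def)

section \<open>Degrees and lists of homogeneous elements\<close>

lemma tdeg_simps [simp]:
  "tdeg [] = 0" "tdeg (v # vs) = fst v + tdeg vs" "tdeg (us @ vs) = tdeg us + tdeg vs"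
  by (auto simp: tdeg_def)

lemma tdeg_update [simp]: "j < length vs \<Longrightarrow> tdeg (vs[j := (fst (vs ! j), z)]) = tdeg vs"
  by (induction vs arbitrary: j) (auto split: nat.split)

lemma homs_Nil [simp]: "[] \<in> homs L n \<longleftrightarrow> n = 0"
  by (auto simp: homs_def)

lemma homs_Cons [simp]: "v # vs \<in> homs L n \<longleftrightarrow> n > 0 \<and> snd v \<in> L (fst v) \<and> vs \<in> homs L (n - 1)"
  by (cases v) (auto simp: homs_def)

lemma homs_0 [simp]: "vs \<in> homs L 0 \<longleftrightarrow> vs = []"
  by (auto simp: homs_def)

lemma length_homs: "vs \<in> homs L n \<Longrightarrow> length vs = n"
  by (simp add: homs_def)

lemma homs_append:
  "us \<in> homs L m \<Longrightarrow> vs \<in> homs L n \<Longrightarrow> us @ vs \<in> homs L (m + n)"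
  by (auto simp: homs_def)

lemma homs_take: "vs \<in> homs L n \<Longrightarrow> m \<le> n \<Longrightarrow> take m vs \<in> homs L m"
  by (auto simp: homs_def dest: in_set_takeD)

lemma homs_drop: "vs \<in> homs L n \<Longrightarrow> drop m vs \<in> homs L (n - m)"
  by (auto simp: homs_def dest: in_set_dropD)

lemma homs_nth: "vs \<in> homs L n \<Longrightarrow> j < n \<Longrightarrow> snd (vs ! j) \<in> L (fst (vs ! j))"
  by (metis (mono_tags, lifting) case_prod_beta homs_def mem_Collect_eq nth_mem)

lemma homs_update: "vs \<in> homs L n \<Longrightarrow> v \<in> L a \<Longrightarrow> vs[j := (a, v)] \<in> homs L n"
  by (force simp: homs_def dest!: set_update_subset_insert[THEN subsetD])

text \<open>Linearity is relative to a subset \<open>A\<close> because only the pieces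
  \<open>L n\<close> are modules; nothing is known about scalars on the rest of the ambient
  group.\<close>

definition lin :: "('k \<Rightarrow> 'v::plus \<Rightarrow> 'v) \<Rightarrow> 'v set \<Rightarrow> ('k \<Rightarrow> 'w::plus \<Rightarrow> 'w) \<Rightarrow> ('v \<Rightarrow> 'w) \<Rightarrow> bool" where
  "lin s A s' g \<longleftrightarrow>
     (\<forall>x \<in> A. \<forall>y \<in> A. g (x + y) = g x + g y) \<and> (\<forall>c. \<forall>x \<in> A. g (s c x) = s' c (g x))"

lemma lin_comp:
  assumes "lin s A s' g" "lin s' B s'' f" "\<And>x. x \<in> A \<Longrightarrow> g x \<in> B"
  shows "lin s A s'' (\<lambda>x. f (g x))"
  using assms by (simp add: lin_def)

text \<open>Multilinearity is given by splitting a list around one entry. Updating the entry at a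
  position is easier to follow through \<open>take\<close>, \<open>drop\<close> and permutations,
  which all act on positions.\<close>

lemma lin_update_iff:
  "(\<forall>us a x y vs. us @ (a, x) # vs \<in> homs L n \<and> y \<in> L a \<longrightarrow>
        F (us @ (a, x + y) # vs) = F (us @ (a, x) # vs) + F (us @ (a, y) # vs)) \<and>
   (\<forall>us a x c vs. us @ (a, x) # vs \<in> homs L n \<longrightarrow>
        F (us @ (a, s c x) # vs) = s' c (F (us @ (a, x) # vs))) \<longleftrightarrow>
   (\<forall>vs \<in> homs L n. \<forall>j < n. lin s (L (fst (vs ! j))) s' (\<lambda>z. F (vs[j := (fst (vs ! j), z)])))"
  (is "?add \<and> ?scale \<longleftrightarrow> ?lin")
proof safe
  fix vs j
  assume h: ?add ?scale "vs \<in> homs L n" "j < n"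
  define us ws where "us = take j vs" "ws = drop (Suc j) vs"
  have vs: "vs[j := z] = us @ z # ws" for z
    using h(3,4) by (simp add: us_ws_def upd_conv_take_nth_drop length_homs)
  have "us @ (fst (vs ! j), z) # ws \<in> homs L n" if "z \<in> L (fst (vs ! j))" for z
    using homs_update[OF h(3) that, of j] by (simp add: vs)
  then show "lin s (L (fst (vs ! j))) s' (\<lambda>z. F (vs[j := (fst (vs ! j), z)]))"
    using h(1,2) unfolding vs by (simp add: lin_def)
next
  fix us a x y vs
  assume h: ?lin "us @ (a, x) # vs \<in> homs L n" "y \<in> L a"
  then have "lin s (L a) s' (\<lambda>z. F (us @ (a, z) # vs))"
    using length_homs[OF h(2)]
        by (auto dest!: bspec[where x = "us @ (a, x) # vs"] spec[where x = "length us"])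
  moreover have "x \<in> L a" using homs_nth[OF h(2), of "length us"] length_homs[OF h(2)] by auto
  ultimately show "F (us @ (a, x + y) # vs) = F (us @ (a, x) # vs) + F (us @ (a, y) # vs)"
    using h(3) by (simp add: lin_def)
next
  fix us a x c vs
  assume h: ?lin "us @ (a, x) # vs \<in> homs L n"
  then have "lin s (L a) s' (\<lambda>z. F (us @ (a, z) # vs))"
    using length_homs[OF h(2)]
        by (auto dest!: bspec[where x = "us @ (a, x) # vs"] spec[where x = "length us"])
  moreover have "x \<in> L a" using homs_nth[OF h(2), of "length us"] length_homs[OF h(2)] by auto
  ultimately show "F (us @ (a, s c x) # vs) = s' c (F (us @ (a, x) # vs))"
    by (simp add: lin_def)
qed

lemma mmap_on_iff:
  "mmap_on s L s' L' n k \<mu> \<longleftrightarrow>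
     arity \<mu> = n \<and> deg \<mu> = k \<and> (\<forall>vs \<in> homs L n. app \<mu> vs \<in> L' (tdeg vs + k)) \<and>
     (\<forall>vs \<in> homs L n. \<forall>j < n.
        lin s (L (fst (vs ! j))) s' (\<lambda>z. app \<mu> (vs[j := (fst (vs ! j), z)])))"
  by (simp only: mmap_on_def lin_update_iff[of L n "app \<mu>" s s', symmetric])

lemma mmap_on_arity: "mmap_on s L s' L' n k \<mu> \<Longrightarrow> arity \<mu> = n"
  by (simp add: mmap_on_def)

lemma mmap_on_deg: "mmap_on s L s' L' n k \<mu> \<Longrightarrow> deg \<mu> = k"
  by (simp add: mmap_on_def)

lemma mmap_on_app: "mmap_on s L s' L' n k \<mu> \<Longrightarrow> vs \<in> homs L n \<Longrightarrow> app \<mu> vs \<in> L' (tdeg vs + k)"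
  by (simp add: mmap_on_def)

lemma mmap_on_lin:
  assumes "mmap_on s L s' L' n k \<mu>" "us @ (a, x) # vs \<in> homs L n"
  shows "lin s (L a) s' (\<lambda>z. app \<mu> (us @ (a, z) # vs))"
proof -
  have "length us < n" using length_homs[OF assms(2)] by auto
  with assms show ?thesis unfolding mmap_on_iff
    by (auto dest!: bspec[where x = "us @ (a, x) # vs"] spec[where x = "length us"])
qed

lemma mmap_on_update:
  assumes "mmap_on s L s' L' n k \<mu>" "vs \<in> homs L n" "j < n" "z \<in> L (fst (vs ! j))"
  shows "app \<mu> (vs[j := (fst (vs ! j), z)]) \<in> L' (tdeg vs + k)"
  using mmap_on_app[OF assms(1) homs_update[OF assms(2,4), of j]] assms(2,3)
  by (simp add: length_homs)

lemma mmap_on_slot: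
  assumes "mmap_on s L s' L' n k \<mu>" "vs \<in> homs L n" "j < n"
  shows "lin s (L (fst (vs ! j))) s' (\<lambda>z. app \<mu> (vs[j := (fst (vs ! j), z)]))"
  using assms by (simp add: mmap_on_iff)

section \<open>Closure of multilinear maps under sums and compositions\<close>

locale graded_module_pair = graded_module s L + tgt: graded_module s' L'
  for s :: "'k::{comm_ring,comm_monoid_mult} \<Rightarrow> 'v::ab_group_add \<Rightarrow> 'v" and L :: "int \<Rightarrow> 'v set"
    and s' :: "'k \<Rightarrow> 'w::ab_group_add \<Rightarrow> 'w" and L' :: "int \<Rightarrow> 'w set"
begin

text \<open>A scalar commutes with negation only on the pieces of the target, hence the second
  assumption.\<close>

lemma lin_sg:
  assumes "lin s A s' g" "\<And>x. x \<in> A \<Longrightarrow> g x \<in> L' n"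
  shows "lin s A s' (\<lambda>z. sg k (g z))"
  using assms by (auto simp: lin_def sg_def tgt.scale_minus[of _ n])

lemma mmap_on_zero: "mmap_on s L s' L' n k (zero_mmap n k)"
  by (simp add: mmap_on_def zero_mmap_def tgt.zero_mem tgt.scale_zero_right)

lemma mmap_on_plus:
  assumes "mmap_on s L s' L' n k \<mu>" "mmap_on s L s' L' n k \<nu>"
  shows "mmap_on s L s' L' n k (\<mu> + \<nu>)"
  using assms mmap_on_update[OF assms(1)] mmap_on_update[OF assms(2)]
  unfolding mmap_on_iff plus_mmap_def
  by (auto simp: tgt.add_mem lin_def add_ac intro!: tgt.scale_right[symmetric])

lemma mmap_on_uminus:
  assumes "mmap_on s L s' L' n k \<mu>"
  shows "mmap_on s L s' L' n k (- \<mu>)"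
  using assms mmap_on_update[OF assms]
  unfolding mmap_on_iff uminus_mmap_def
  by (auto simp: tgt.minus_mem lin_def intro!: tgt.scale_minus[symmetric])

lemma mmap_on_minus:
  assumes "mmap_on s L s' L' n k \<mu>" "mmap_on s L s' L' n k \<nu>"
  shows "mmap_on s L s' L' n k (\<mu> - \<nu>)"
  using assms mmap_on_plus[OF assms(1) mmap_on_uminus[OF assms(2)]]
  by (simp add: plus_mmap_def minus_mmap_def uminus_mmap_def)

lemma mmap_on_sum:
  assumes "\<And>j. j \<in> J \<Longrightarrow> mmap_on s L s' L' n k (\<mu> j)"
  shows "mmap_on s L s' L' n k (MMap n k (\<lambda>vs. \<Sum>j\<in>J. app (\<mu> j) vs))"
  using assms
proof (induction J rule: infinite_finite_induct)
  case (insert j J)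
  then show ?case
    using mmap_on_plus[of n k "\<mu> j" "MMap n k (\<lambda>vs. \<Sum>j\<in>J. app (\<mu> j) vs)"]
      mmap_on_arity[of s L s' L' n k "\<mu> j"] mmap_on_deg[of s L s' L' n k "\<mu> j"]
    by (simp add: plus_mmap_def)
qed (use mmap_on_zero in \<open>simp_all add: zero_mmap_def\<close>)

lemma mmap_on_sg:
  assumes "mmap_on s L s' L' n k \<mu>"
  shows "mmap_on s L s' L' n k (MMap n k (\<lambda>vs. sg m (app \<mu> vs)))"
  using assms mmap_on_uminus[OF assms]
  by (cases "even m") (simp_all add: sg_def uminus_mmap_def mmap_on_def)

text \<open>The sign depends on degrees alone, so it is constant in each slot and only the nested
  application matters. The equations for \<open>r\<close> and \<open>t\<close> let the rule apply to
  goals whose arity and degree are numerals.\<close>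

lemma mmap_on_pcomp:
  assumes \<mu>: "mmap_on s L s' L' n k \<mu>" and \<nu>: "mmap_on s L s L m l \<nu>"
    and i: "1 \<le> i" "i \<le> n" and r: "n + m - 1 = r" and t: "k + l = t"
  shows "mmap_on s L s' L' r t (\<mu> \<circ>\<^bsub>i\<^esub> \<nu>)"
proof -
  define q where "q = i - 1"
  have q: "q < n" "r = q + m + (n - q - 1)" using i r by (auto simp: q_def)
  define pre mid post where "pre vs = take q vs" "mid vs = take m (drop q vs)" "post vs = drop (q + m) vs"
    for vs :: "(int \<times> 'v) list"
  define args where "args vs = pre vs @ val \<nu> (mid vs) # post vs" for vs
  have ar: "arity \<mu> = n" "deg \<mu> = k" "arity \<nu> = m" "deg \<nu> = l"
    using \<mu> \<nu> by (auto simp: mmap_on_def)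
  have app: "app (\<mu> \<circ>\<^bsub>i\<^esub> \<nu>) vs = sg (l * tdeg (pre vs)) (app \<mu> (args vs))" for vs
    by (simp add: pcomp_def args_def pre_mid_post_def q_def ar Let_def)
  have split: "vs = pre vs @ mid vs @ post vs" for vs
    by (simp add: pre_mid_post_def add.commute flip: drop_drop)
  have parts: "pre vs \<in> homs L q" "mid vs \<in> homs L m" "post vs \<in> homs L (n - q - 1)"
    if "vs \<in> homs L r" for vs
    using homs_take[OF that, of q] homs_take[OF homs_drop[OF that, of q], of m]
      homs_drop[OF that, of "q + m"] q by (auto simp: pre_mid_post_def)
  have val: "snd (val \<nu> (mid vs)) \<in> L (fst (val \<nu> (mid vs)))" if "vs \<in> homs L r" for vs
    using mmap_on_app[OF \<nu> parts(2)[OF that]] by (simp add: val_def ar)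
  have args: "args vs \<in> homs L n" "tdeg (args vs) = tdeg vs + l" if "vs \<in> homs L r" for vs
  proof -
    have "val \<nu> (mid vs) # post vs \<in> homs L (Suc (n - q - 1))" using val parts that by simp
    from homs_append[OF parts(1)[OF that] this] show "args vs \<in> homs L n"
      using q by (simp add: args_def)
    show "tdeg (args vs) = tdeg vs + l"
      by (subst (2) split) (simp add: args_def val_def ar)
  qed
  show ?thesis unfolding mmap_on_iff
  proof (intro conjI ballI allI impI)
    show "arity (\<mu> \<circ>\<^bsub>i\<^esub> \<nu>) = r" "deg (\<mu> \<circ>\<^bsub>i\<^esub> \<nu>) = t" using r t by (auto simp: pcomp_def ar)
  next
    fix vs assume vs: "vs \<in> homs L r"
    show "app (\<mu> \<circ>\<^bsub>i\<^esub> \<nu>) vs \<in> L' (tdeg vs + t)"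
      unfolding app using mmap_on_app[OF \<mu> args(1)[OF vs]] args(2)[OF vs] t
      by (auto intro!: tgt.sg_mem simp: algebra_simps)
  next
    fix vs j assume vs: "vs \<in> homs L r" and j: "j < r"
    define a where "a = fst (vs ! j)"
    have V: "vs[j := (a, z)] \<in> homs L r" if "z \<in> L a" for z
      using homs_update[OF vs that] .
    have len: "length vs = r" "length (pre vs) = q" "length (mid vs) = m" "length (post vs) = n - q - 1"
      using vs parts[OF vs] by (auto simp: length_homs)
    have pre: "tdeg (pre (vs[j := (a, z)])) = tdeg (pre vs)" for z
    proof (cases "j < q")
      case True
      then show ?thesis
        using len(2) tdeg_update[of j "pre vs"]
        by (simp add: pre_mid_post_def a_def take_update_swap)
    qed (simp add: pre_mid_post_def)
    have "lin s (L a) s' (\<lambda>z. app \<mu> (args (vs[j := (a, z)])))"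
    proof -
      \<comment> \<open>The varied input stands before, inside or after the block consumed by
        \<open>\<nu>\<close>; only inside are two linear maps composed.\<close>
      consider "j < q" | "q \<le> j" "j < q + m" | "q + m \<le> j" by linarith
      then show ?thesis
      proof cases
        case 1
        then have "args (vs[j := (a, z)]) = (args vs)[j := (a, z)]" for z
          using len by (simp add: args_def pre_mid_post_def take_update_swap list_update_append)
        moreover have "a = fst (args vs ! j)"
          using 1 len by (simp add: args_def pre_mid_post_def a_def nth_append)
        ultimately show ?thesis
          using \<mu> args(1)[OF vs] 1 q unfolding mmap_on_iff by simp
      next
        case 2
        have mid: "mid (vs[j := (a, z)]) = (mid vs)[j - q := (a, z)]" for z
          using 2 by (simp add: pre_mid_post_def drop_update_swap take_update_swap)
        have a: "a = fst (mid vs ! (j - q))" using 2 len by (simp add: pre_mid_post_def a_def)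
        have l1: "lin s (L a) s (\<lambda>z. app \<nu> (mid (vs[j := (a, z)])))"
          unfolding mid using mmap_on_slot[OF \<nu> parts(2)[OF vs], of "j - q"] 2 by (simp flip: a)
        have tm: "tdeg (mid (vs[j := (a, z)])) = tdeg (mid vs)" for z
          unfolding mid using tdeg_update[of "j - q" "mid vs" z] 2 len by (simp flip: a)
        have eq: "args (vs[j := (a, z)]) =
            pre vs @ (tdeg (mid vs) + l, app \<nu> (mid (vs[j := (a, z)]))) # post vs" for z
          unfolding args_def val_def tm ar using 2 by (simp add: pre_mid_post_def)
        have l2: "lin s (L (tdeg (mid vs) + l)) s'
            (\<lambda>z. app \<mu> (pre vs @ (tdeg (mid vs) + l, z) # post vs))"
          using mmap_on_lin[OF \<mu>, of "pre vs" "tdeg (mid vs) + l" "app \<nu> (mid vs)" "post vs"]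
              args(1)[OF vs]
          by (simp add: args_def val_def ar)
        show ?thesis unfolding eq
          by (rule lin_comp[OF l1 l2]) (use mmap_on_app[OF \<nu> parts(2)[OF V]] tm in simp)
      next
        case 3
        \<comment> \<open>The \<open>m\<close> inputs of the block become one argument, so later
          positions move by \<open>m - 1\<close>; the form \<open>j + 1 - m\<close> is also right
          for \<open>m = 0\<close>.\<close>
        have "args (vs[j := (a, z)]) = (args vs)[j + 1 - m := (a, z)]" for z
          using 3 len by (auto simp: args_def pre_mid_post_def drop_update_swap list_update_append
              Suc_diff_le add.commute[of m q] split: nat.split)
        moreover have "a = fst (args vs ! (j + 1 - m))"
        proof -
          have "j + 1 - m - q = Suc (j - (q + m))" "\<not> j + 1 - m < q" using 3 by auto
          then show ?thesis using 3 len by (simp add: args_def pre_mid_post_def a_def nth_append)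
        qed
        ultimately show ?thesis
          using \<mu> args(1)[OF vs] 3 q j unfolding mmap_on_iff by simp
      qed
    qed
    then show "lin s (L (fst (vs ! j))) s' (\<lambda>z. app (\<mu> \<circ>\<^bsub>i\<^esub> \<nu>) (vs[j := (fst (vs ! j), z)]))"
      unfolding app a_def[symmetric] pre
      by (rule lin_sg)
          (use mmap_on_app[OF \<mu> args(1)[OF V]] args(2)[OF V] tdeg_update[of j vs] j len in \<open>simp add: a_def\<close>)
  qed
qed

text \<open>Reading arities and degrees off the maps leaves no unknowns when the rule is applied
  backwards.\<close>

lemmas mmap_on_pcomp' =
  mmap_on_pcomp[where n = "arity \<mu>" and k = "deg \<mu>" and m = "arity \<nu>" and l = "deg \<nu>" and \<mu> = \<mu>
    and \<nu> = \<nu>] for \<mu> \<nu>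

end

section \<open>Tensor products and permutations of inputs\<close>

lemma tens_mem:
  assumes "\<forall>\<nu> \<in> set \<nu>s. mmap_on s L s' L' (arity \<nu>) (deg \<nu>) \<nu>"
    and "vs \<in> homs L (sum_list (map arity \<nu>s))"
  shows "tens \<nu>s vs \<in> homs L' (length \<nu>s) \<and> tdeg (tens \<nu>s vs) = tdeg vs + sum_list (map deg \<nu>s)"
  using assms
proof (induction \<nu>s arbitrary: vs)
  case (Cons \<nu> \<nu>s)
  have "take (arity \<nu>) vs \<in> homs L (arity \<nu>)"
      and d: "drop (arity \<nu>) vs \<in> homs L (sum_list (map arity \<nu>s))"
    using homs_take[OF Cons.prems(2), of "arity \<nu>"] homs_drop[OF Cons.prems(2), of "arity \<nu>"] by auto
  moreover have "tdeg vs = tdeg (take (arity \<nu>) vs) + tdeg (drop (arity \<nu>) vs)"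
    by (metis append_take_drop_id tdeg_simps(3))
  ultimately show ?case using Cons.IH[OF _ d] Cons.prems(1) mmap_on_app by (fastforce simp: val_def)
qed auto

lemma tens_sign_cong: "map fst us = map fst vs \<Longrightarrow> tens_sign \<nu>s us = tens_sign \<nu>s vs"
proof (induction \<nu>s arbitrary: us vs)
  case (Cons \<nu> \<nu>s)
  then show ?case
    using Cons.IH[of "drop (arity \<nu>) us" "drop (arity \<nu>) vs"]
    by (simp add: tdeg_def flip: take_map drop_map)
qed simp

lemma map_fst_update: "j < length vs \<Longrightarrow> map fst (vs[j := (fst (vs ! j), z)]) = map fst vs"
  by (metis fst_conv list_update_id map_update nth_map)

text \<open>The varied input may lie in any block, so the induction peels off blocks and collects in
  \<open>ws\<close> the factors already evaluated, which \<open>\<mu>\<close> still needs as its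
  first arguments.\<close>

lemma tens_lin:
  assumes "mmap_on s' L' s'' L'' (length ws + length \<nu>s) k \<mu>" "ws \<in> homs L' (length ws)"
    and "\<forall>\<nu> \<in> set \<nu>s. mmap_on s L s' L' (arity \<nu>) (deg \<nu>) \<nu>"
    and "vs \<in> homs L (sum_list (map arity \<nu>s))" "j < length vs"
  shows "lin s (L (fst (vs ! j))) s'' (\<lambda>z. app \<mu> (ws @ tens \<nu>s (vs[j := (fst (vs ! j), z)])))"
  using assms
proof (induction \<nu>s arbitrary: vs ws j)
  case (Cons \<nu> \<nu>s)
  let ?t = "take (arity \<nu>)" and ?d = "drop (arity \<nu>)"
  note len = length_homs[OF Cons.prems(4)]
  have t: "?t vs \<in> homs L (arity \<nu>)" and d: "?d vs \<in> homs L (sum_list (map arity \<nu>s))"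
    using homs_take[OF Cons.prems(4), of "arity \<nu>"] homs_drop[OF Cons.prems(4), of "arity \<nu>"] by auto
  have \<nu>: "mmap_on s L s' L' (arity \<nu>) (deg \<nu>) \<nu>" using Cons.prems(3) by simp
  define e where "e = tdeg (?t vs) + deg \<nu>"
  have mem: "app \<nu> (?t vs) \<in> L' e" using mmap_on_app[OF \<nu> t] by (simp add: e_def)
  show ?case
  proof (cases "j < arity \<nu>")
    case True
    define a where "a = fst (?t vs ! j)"
    have a: "a = fst (vs ! j)" using True by (simp add: a_def)
    have tu: "?t (vs[j := (a, z)]) = (?t vs)[j := (a, z)]" for z by (simp add: take_update_swap)
    have "tdeg ((?t vs)[j := (a, z)]) = tdeg (?t vs)" for z
      unfolding a_def by (rule tdeg_update) (use True Cons.prems(5) in simp)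
    then have eq: "tens (\<nu> # \<nu>s) (vs[j := (a, z)]) =
        (e, app \<nu> ((?t vs)[j := (a, z)])) # tens \<nu>s (?d vs)" for z
      using True by (simp add: val_def e_def tu)
    have "ws @ (e, app \<nu> (?t vs)) # tens \<nu>s (?d vs) \<in> homs L' (length ws + length (\<nu> # \<nu>s))"
      using Cons.prems(2,3) tens_mem[OF _ d] mem by (intro homs_append) auto
    note l = mmap_on_lin[OF Cons.prems(1) this]
    show ?thesis
      unfolding a[symmetric] eq
      by (rule lin_comp[OF mmap_on_slot[OF \<nu> t True, folded a_def] l])
        (use mmap_on_update[OF \<nu> t True] in \<open>simp add: a_def e_def\<close>)
  next
    case False
    have eq: "ws @ tens (\<nu> # \<nu>s) (vs[j := z]) =
        (ws @ [(e, app \<nu> (?t vs))]) @ tens \<nu>s ((?d vs)[j - arity \<nu> := z])" for z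
      using False by (simp add: val_def e_def drop_update_swap)
    have "vs ! j = ?d vs ! (j - arity \<nu>)" using False Cons.prems(5) by simp
    then show ?thesis
      unfolding eq
      using Cons.IH[of "ws @ [(e, app \<nu> (?t vs))]" "?d vs" "j - arity \<nu>"] False Cons.prems d mem
        homs_append[OF Cons.prems(2), of "[(e, app \<nu> (?t vs))]" 1]
      by auto
  qed
qed simp

lemma mmap_on_tcomp:
  assumes "graded_module s'' L''"
    and \<mu>: "mmap_on s' L' s'' L'' n k \<mu>" and \<nu>s: "\<forall>\<nu> \<in> set \<nu>s. mmap_on s L s' L' (arity \<nu>) (deg \<nu>) \<nu>"
    and n: "length \<nu>s = n" "sum_list (map arity \<nu>s) = r" and t: "k + sum_list (map deg \<nu>s) = t"
  shows "mmap_on s L s'' L'' r t (\<mu> \<odot> \<nu>s)"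
proof -
  interpret tgt: graded_module s'' L'' by fact
  have \<mu>': "arity \<mu> = n" "deg \<mu> = k" using \<mu> by (auto simp: mmap_on_def)
  have mem: "app \<mu> (tens \<nu>s vs) \<in> L'' (tdeg vs + t)" if "vs \<in> homs L r" for vs
    using mmap_on_app[OF \<mu>, of "tens \<nu>s vs"] tens_mem[OF \<nu>s, of vs] that n
        by (simp add: ac_simps flip: t)
  show ?thesis unfolding mmap_on_iff
  proof (intro conjI ballI allI impI)
    fix vs j assume vs: "vs \<in> homs L r" and j: "j < r"
    have len: "length vs = r" using vs by (simp add: length_homs)
    define a where "a = fst (vs ! j)"
    have ts: "tens_sign \<nu>s (vs[j := (a, z)]) = tens_sign \<nu>s vs" for z
      by (rule tens_sign_cong) (use map_fst_update[of j vs z] j len in \<open>simp add: a_def\<close>)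
    have l: "lin s (L a) s'' (\<lambda>z. app \<mu> (tens \<nu>s (vs[j := (a, z)])))"
      using tens_lin[of s' L' s'' L'' "[]" \<nu>s k \<mu> s L vs j] \<mu> \<nu>s n vs j len by (simp add: a_def)
    have "app \<mu> (tens \<nu>s (vs[j := (a, z)])) \<in> L'' (tdeg vs + t)" if "z \<in> L a" for z
      using mem[OF homs_update[OF vs that, of j]] tdeg_update[of j vs z] j len by (simp add: a_def)
    with l show "lin s (L (fst (vs ! j))) s'' (\<lambda>z. app (\<mu> \<odot> \<nu>s) (vs[j := (fst (vs ! j), z)]))"
      by (auto simp: tcomp_def ts lin_def sg_def tgt.scale_minus[of _ "tdeg vs + t"] simp flip: a_def)
  qed (use mem n t \<mu>' in \<open>auto simp: tcomp_def intro: tgt.sg_mem\<close>)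
qed

lemmas mmap_on_tcomp' = mmap_on_tcomp[where n = "arity \<mu>" and k = "deg \<mu>" and \<mu> = \<mu>] for \<mu>

lemma (in graded_module_pair) mmap_on_perm:
  assumes \<mu>: "mmap_on s L s' L' n k \<mu>" and \<sigma>: "\<sigma> permutes {1..n}"
  shows "mmap_on s L s' L' n k (\<mu>\<^bsup>\<sigma>\<^esup>)"
proof -
  have ar: "arity \<mu> = n" "deg \<mu> = k" using \<mu> by (auto simp: mmap_on_def)
  define W where "W vs = map (\<lambda>j. vs ! (inv \<sigma> j - 1)) [1..<n + 1]" for vs :: "(int \<times> 'v) list"
  define sgn where "sgn vs = (\<Sum>(i, j) \<in> {(i, j). 1 \<le> i \<and> i < j \<and> j \<le> n \<and> \<sigma> j < \<sigma> i}.
                   fst (vs ! (i - 1)) * fst (vs ! (j - 1)))" for vs :: "(int \<times> 'v) list"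
  have app: "app (\<mu>\<^bsup>\<sigma>\<^esup>) vs = sg (sgn vs) (app \<mu> (W vs))" for vs
    by (simp add: perm_def ar sgn_def W_def)
  have inv: "inv \<sigma> j \<in> {1..n} \<longleftrightarrow> j \<in> {1..n}" for j
    using permutes_in_image[OF permutes_inv[OF \<sigma>]] .
  have W: "W vs \<in> homs L n" if vs: "vs \<in> homs L n" for vs
  proof -
    have "snd (vs ! (inv \<sigma> j - 1)) \<in> L (fst (vs ! (inv \<sigma> j - 1)))" if "j \<in> {1..n}" for j
      using inv[of j] that by (intro homs_nth[OF vs]) auto
    then show ?thesis by (auto simp: W_def homs_def split_beta)
  qed
  have tdegW: "tdeg (W vs) = tdeg vs" if vs: "vs \<in> homs L n" for vs
  proof -
    have "tdeg (W vs) = (\<Sum>j\<in>{1..n}. fst (vs ! (inv \<sigma> j - 1)))"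
      by (simp add: W_def tdeg_def comp_def interv_sum_list_conv_sum_set_nat
          atLeastLessThanSuc_atLeastAtMost del: upt_Suc)
    also have "\<dots> = (\<Sum>j\<in>{1..n}. fst (vs ! (j - 1)))"
      using sum.permute[OF permutes_inv[OF \<sigma>], of "\<lambda>j. fst (vs ! (j - 1))"] by (simp add: comp_def)
    also have "\<dots> = (\<Sum>j<n. fst (vs ! j))"
      by (rule sum.reindex_bij_witness[of _ Suc "\<lambda>j. j - 1"]) auto
    also have "\<dots> = tdeg vs"
      using length_homs[OF vs] by (simp add: tdeg_def sum_list_sum_nth atLeast0LessThan)
    finally show ?thesis .
  qed
  show ?thesis unfolding mmap_on_iff
  proof (intro conjI ballI allI impI)
    fix vs j assume vs: "vs \<in> homs L n" and j: "j < n"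
    have len: "length vs = n" using vs by (simp add: length_homs)
    \<comment> \<open>Entry \<open>j\<close> of the list becomes entry \<open>q\<close> of the
      permuted one. The shifts by one translate between list positions, counted from 0, and inputs,
      counted from 1.\<close>
    define a q where "a = fst (vs ! j)" and "q = \<sigma> (Suc j) - 1"
    have \<sigma>j: "\<sigma> (Suc j) \<in> {1..n}" using permutes_in_image[OF \<sigma>, of "Suc j"] j by auto
    then have q: "q < n" "Suc q = \<sigma> (Suc j)" by (auto simp: q_def)
    have Wq: "W vs ! q = vs ! j"
      using q permutes_inverses(2)[OF \<sigma>] by (simp add: W_def del: upt_Suc)
    have "W (vs[j := (a, z)]) = (W vs)[q := (a, z)]" for z
    proof (rule nth_equalityI)
      fix t assume "t < length (W (vs[j := (a, z)]))"
      then have t: "t < n" by (simp add: W_def del: upt_Suc)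
      then have i: "inv \<sigma> (Suc t) \<in> {1..n}" using inv[of "Suc t"] by auto
      have "inv \<sigma> (Suc t) - 1 = j \<longleftrightarrow> inv \<sigma> (Suc t) = Suc j" using i by auto
      also have "\<dots> \<longleftrightarrow> t = q" using q(2) permutes_inv_eq[OF \<sigma>] by auto
      finally have "inv \<sigma> (Suc t) - 1 = j \<longleftrightarrow> t = q" .
      then show "W (vs[j := (a, z)]) ! t = (W vs)[q := (a, z)] ! t"
        using t j len i by (cases "t = q") (auto simp: W_def nth_list_update simp del: upt_Suc)
    qed (simp add: W_def del: upt_Suc)
    moreover have sgn: "sgn (vs[j := (a, z)]) = sgn vs" for z
      unfolding sgn_def a_def using j len by (intro sum.cong) (auto simp: nth_list_update)
    ultimately show "lin s (L (fst (vs ! j))) s' (\<lambda>z. app (\<mu>\<^bsup>\<sigma>\<^esup>) (vs[j := (fst (vs ! j), z)]))"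
      using lin_sg[OF mmap_on_slot[OF \<mu> W[OF vs] q(1)], of "tdeg (W vs) + k"]
        mmap_on_update[OF \<mu> W[OF vs] q(1)]
      by (simp add: app Wq flip: a_def)
  next
    fix vs assume vs: "vs \<in> homs L n"
    then show "app (\<mu>\<^bsup>\<sigma>\<^esup>) vs \<in> L' (tdeg vs + k)"
      using mmap_on_app[OF \<mu> W[OF vs]] by (simp add: app tgt.sg_mem tdegW)
  qed (simp_all add: perm_def ar)
qed

lemma (in graded_module_pair) mmap_on_bd:
  assumes \<mu>: "mmap_on s L s' L' n k \<mu>"
      and d: "mmap_on s L s L 1 (- 1) d" and d': "mmap_on s' L' s' L' 1 (- 1) d'"
    and t: "k - 1 = t"
  shows "mmap_on s L s' L' n t (bd d d' \<mu>)"
proof -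
  have ar: "arity \<mu> = n" "deg \<mu> = k" using \<mu> by (auto simp: mmap_on_def)
  have "mmap_on s L s' L' n t (d' \<odot> [\<mu>])"
    using d' \<mu> t ar by (intro mmap_on_tcomp[OF tgt.graded_module_axioms]) auto
  moreover have "mmap_on s L s' L' n t (MMap n t (\<lambda>vs. \<Sum>i = 1..n. app (\<mu> \<circ>\<^bsub>i\<^esub> d) vs))"
    using t by (intro mmap_on_sum mmap_on_pcomp[OF \<mu> d]) auto
  note mmap_on_sg[OF this, of k]
  ultimately have "mmap_on s L s' L' n t (d' \<odot> [\<mu>] - MMap n t (\<lambda>vs. sg k (\<Sum>i = 1..n. app (\<mu> \<circ>\<^bsub>i\<^esub> d) vs)))"
    using mmap_on_minus by simp
  moreover have "bd d d' \<mu> = d' \<odot> [\<mu>] - MMap n t (\<lambda>vs. sg k (\<Sum>i = 1..n. app (\<mu> \<circ>\<^bsub>i\<^esub> d) vs))"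
    using d' t ar by (simp add: bd_def minus_mmap_def tcomp_def mmap_on_def)
  ultimately show ?thesis by simp
qed

section \<open>Evaluation on short lists\<close>

text \<open>The \<open>elementwise\<close> rules push differentials and \<open>i\<close> towards the inputs and expand multilinearly.\<close>

named_theorems maps
named_theorems elementwise

lemma sg_even [simp]: "even n \<Longrightarrow> sg n x = x"
  and sg_odd [simp]: "odd n \<Longrightarrow> sg n x = - x"
  by (simp_all add: sg_def)

section \<open>Arity, degree and value of composite operations\<close>

lemma arity_simps [simp]:
  "arity (\<mu> + \<nu>) = arity \<mu>" "arity (\<mu> - \<nu>) = arity \<mu>" "arity (- \<mu>) = arity \<mu>"
  "arity (zero_mmap n k) = n" "arity (\<mu> \<circ>\<^bsub>i\<^esub> \<rho>) = arity \<mu> + arity \<rho> - 1"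
  "arity (\<mu> \<odot> \<nu>s) = sum_list (map arity \<nu>s)" "arity (\<mu>\<^bsup>\<sigma>\<^esup>) = arity \<mu>" "arity (bd d d' \<mu>) = arity \<mu>"
  by (simp_all add: plus_mmap_def minus_mmap_def uminus_mmap_def zero_mmap_def pcomp_def tcomp_def
      perm_def bd_def)

lemma deg_simps [simp]:
  "deg (\<mu> + \<nu>) = deg \<mu>" "deg (\<mu> - \<nu>) = deg \<mu>" "deg (- \<mu>) = deg \<mu>"
  "deg (zero_mmap n k) = k" "deg (\<mu> \<circ>\<^bsub>i\<^esub> \<rho>) = deg \<mu> + deg \<rho>"
  "deg (\<mu> \<odot> \<nu>s) = deg \<mu> + sum_list (map deg \<nu>s)" "deg (\<mu>\<^bsup>\<sigma>\<^esup>) = deg \<mu>" "deg (bd d d' \<mu>) = deg \<mu> - 1"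
  by (simp_all add: plus_mmap_def minus_mmap_def uminus_mmap_def zero_mmap_def pcomp_def tcomp_def
      perm_def bd_def)

lemma app_simps [simp]:
  "app (\<mu> + \<nu>) vs = app \<mu> vs + app \<nu> vs" "app (\<mu> - \<nu>) vs = app \<mu> vs - app \<nu> vs"
  "app (- \<mu>) vs = - app \<mu> vs" "app (zero_mmap n k) vs = 0"
  by (simp_all add: plus_mmap_def minus_mmap_def uminus_mmap_def zero_mmap_def)

lemma app_pcomp [simp]:
  "app (\<mu> \<circ>\<^bsub>i\<^esub> \<nu>) vs =
     sg (deg \<nu> * tdeg (take (i - 1) vs))
       (app \<mu> (take (i - 1) vs @
          (tdeg (take (arity \<nu>) (drop (i - 1) vs)) + deg \<nu>, app \<nu> (take (arity \<nu>) (drop (i - 1) vs))) #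
          drop (i - 1 + arity \<nu>) vs))"
  by (simp add: pcomp_def val_def Let_def)

lemma app_tcomp [simp]: "app (\<mu> \<odot> \<nu>s) vs = sg (tens_sign \<nu>s vs) (app \<mu> (tens \<nu>s vs))"
  by (simp add: tcomp_def)

lemma app_bd:
  "app (bd d d' \<mu>) vs = app (d' \<odot> [\<mu>]) vs - sg (deg \<mu>) (\<Sum>i = 1..arity \<mu>. app (\<mu> \<circ>\<^bsub>i\<^esub> d) vs)"
  by (simp add: bd_def)

text \<open>For a concrete cycle everything on the right can be computed: the inverse is supplied as
  \<open>\<tau>\<close>, and the sum over the set of inversions becomes a double sum over
  lists.\<close>

lemma app_perm:
  assumes "arity \<mu> = n" "\<sigma> \<circ> \<tau> = id" "\<tau> \<circ> \<sigma> = id"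
  shows "app (\<mu>\<^bsup>\<sigma>\<^esup>) vs =
    sg (\<Sum>i\<leftarrow>[1..<n + 1]. \<Sum>j\<leftarrow>[1..<n + 1].
          if i < j \<and> \<sigma> j < \<sigma> i then fst (vs ! (i - 1)) * fst (vs ! (j - 1)) else 0)
      (app \<mu> (map (\<lambda>j. vs ! (\<tau> j - 1)) [1..<n + 1]))"
proof -
  have inv: "inv \<sigma> = \<tau>" using assms(2,3) by (rule inv_unique_comp)
  have "(\<Sum>(i, j) \<in> {(i, j). 1 \<le> i \<and> i < j \<and> j \<le> n \<and> \<sigma> j < \<sigma> i}. g i j) =
      (\<Sum>i\<in>{1..n}. \<Sum>j\<in>{1..n}. if i < j \<and> \<sigma> j < \<sigma> i then g i j else 0)" for g :: "nat \<Rightarrow> nat \<Rightarrow> int"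
    unfolding sum.cartesian_product by (rule sum.mono_neutral_cong_left) (auto split: if_splits)
  then show ?thesis
    by (simp add: perm_def assms(1) inv interv_sum_list_conv_sum_set_nat
        atLeastLessThanSuc_atLeastAtMost del: upt_Suc cong: if_cong)
qed

text \<open>Cycles must stay folded, so that the evaluation rules for each particular cycle can
  match them.\<close>

declare cycle_of_list.simps [simp del]

lemmas cyc_eval = cycle_of_list.simps transpose_def comp_def fun_eq_iff upt_conv_Cons

lemma app_perm2:
  assumes "arity \<mu> = 2"
  shows "app (\<mu>\<^bsup>cyc [1, 2]\<^esup>) [t, u] = sg (fst t * fst u) (app \<mu> [u, t])"
  apply (subst app_perm[where n = 2 and \<tau> = "cyc [2, 1]"]; (auto simp: assms cyc_eval)[])
  done

lemma app_perm3:
  assumes "arity \<mu> = 3"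
  shows "app (\<mu>\<^bsup>cyc [1, 2]\<^esup>) [t, u, v] = sg (fst t * fst u) (app \<mu> [u, t, v])"
    and "app (\<mu>\<^bsup>cyc [2, 3]\<^esup>) [t, u, v] = sg (fst u * fst v) (app \<mu> [t, v, u])"
    and "app (\<mu>\<^bsup>cyc [1, 2, 3]\<^esup>) [t, u, v] = sg (fst t * fst v + fst u * fst v) (app \<mu> [v, t, u])"
    and "app (\<mu>\<^bsup>cyc [1, 3, 2]\<^esup>) [t, u, v] = sg (fst t * fst u + fst t * fst v) (app \<mu> [u, v, t])"
  apply (subst app_perm[where n = 3 and \<tau> = "cyc [2, 1]"]; (auto simp: assms cyc_eval)[])
  apply (subst app_perm[where n = 3 and \<tau> = "cyc [3, 2]"]; (auto simp: assms cyc_eval)[])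
  apply (subst app_perm[where n = 3 and \<tau> = "cyc [3, 2, 1]"]; (auto simp: assms cyc_eval)[])
  apply (subst app_perm[where n = 3 and \<tau> = "cyc [2, 3, 1]"]; (auto simp: assms cyc_eval)[])
  done

lemma app_perm4:
  assumes "arity \<mu> = 4"
  shows "app (\<mu>\<^bsup>cyc [1, 2]\<^esup>) [t, u, v, w] = sg (fst t * fst u) (app \<mu> [u, t, v, w])"
    and "app (\<mu>\<^bsup>cyc [2, 3]\<^esup>) [t, u, v, w] = sg (fst u * fst v) (app \<mu> [t, v, u, w])"
    and "app (\<mu>\<^bsup>cyc [3, 4]\<^esup>) [t, u, v, w] = sg (fst v * fst w) (app \<mu> [t, u, w, v])"
    and "app (\<mu>\<^bsup>cyc [1, 2, 3]\<^esup>) [t, u, v, w] = sg (fst t * fst v + fst u * fst v) (app \<mu> [v, t, u, w])"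
    and "app (\<mu>\<^bsup>cyc [1, 3, 2]\<^esup>) [t, u, v, w] = sg (fst t * fst u + fst t * fst v) (app \<mu> [u, v, t, w])"
  apply (subst app_perm[where n = 4 and \<tau> = "cyc [2, 1]"]; (auto simp: assms cyc_eval)[])
  apply (subst app_perm[where n = 4 and \<tau> = "cyc [3, 2]"]; (auto simp: assms cyc_eval)[])
  apply (subst app_perm[where n = 4 and \<tau> = "cyc [4, 3]"]; (auto simp: assms cyc_eval)[])
  apply (subst app_perm[where n = 4 and \<tau> = "cyc [3, 2, 1]"]; (auto simp: assms cyc_eval)[])
  apply (subst app_perm[where n = 4 and \<tau> = "cyc [2, 3, 1]"]; (auto simp: assms cyc_eval)[])
  done

text \<open>Arity 5 occurs only in the identity \<open>l_5\<close>, whose terms have degree 2. All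
  inputs then have degree 0 and the Koszul signs disappear.\<close>

lemma app_perm5:
  assumes "arity \<mu> = 5"
  shows "app (\<mu>\<^bsup>cyc [1, 2]\<^esup>) [(0, t), (0, u), (0, v), (0, w), (0, x)]
      = app \<mu> [(0, u), (0, t), (0, v), (0, w), (0, x)]"
    and "app (\<mu>\<^bsup>cyc [2, 3]\<^esup>) [(0, t), (0, u), (0, v), (0, w), (0, x)]
      = app \<mu> [(0, t), (0, v), (0, u), (0, w), (0, x)]"
    and "app (\<mu>\<^bsup>cyc [3, 4]\<^esup>) [(0, t), (0, u), (0, v), (0, w), (0, x)]
      = app \<mu> [(0, t), (0, u), (0, w), (0, v), (0, x)]"
    and "app (\<mu>\<^bsup>cyc [1, 2, 3]\<^esup>) [(0, t), (0, u), (0, v), (0, w), (0, x)]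
      = app \<mu> [(0, v), (0, t), (0, u), (0, w), (0, x)]"
    and "app (\<mu>\<^bsup>cyc [1, 3, 2]\<^esup>) [(0, t), (0, u), (0, v), (0, w), (0, x)]
      = app \<mu> [(0, u), (0, v), (0, t), (0, w), (0, x)]"
    and "app (\<mu>\<^bsup>cyc [2, 3, 4]\<^esup>) [(0, t), (0, u), (0, v), (0, w), (0, x)]
      = app \<mu> [(0, t), (0, w), (0, u), (0, v), (0, x)]"
    and "app (\<mu>\<^bsup>cyc [2, 4, 3]\<^esup>) [(0, t), (0, u), (0, v), (0, w), (0, x)]
      = app \<mu> [(0, t), (0, v), (0, w), (0, u), (0, x)]"
    and "app (\<mu>\<^bsup>cyc [1, 2, 3, 4]\<^esup>) [(0, t), (0, u), (0, v), (0, w), (0, x)]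
      = app \<mu> [(0, w), (0, t), (0, u), (0, v), (0, x)]"
    and "app (\<mu>\<^bsup>cyc [1, 3, 4, 2]\<^esup>) [(0, t), (0, u), (0, v), (0, w), (0, x)]
      = app \<mu> [(0, u), (0, w), (0, t), (0, v), (0, x)]"
    and "app (\<mu>\<^bsup>cyc [1, 4, 3, 2]\<^esup>) [(0, t), (0, u), (0, v), (0, w), (0, x)]
      = app \<mu> [(0, u), (0, v), (0, w), (0, t), (0, x)]"
    and "app (\<mu>\<^bsup>cyc [1, 3] \<circ> cyc [2, 4]\<^esup>) [(0, t), (0, u), (0, v), (0, w), (0, x)]
      = app \<mu> [(0, v), (0, w), (0, t), (0, u), (0, x)]"
  apply (subst app_perm[where n = 5 and \<tau> = "cyc [2, 1]"]; (auto simp: assms cyc_eval)[])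
  apply (subst app_perm[where n = 5 and \<tau> = "cyc [3, 2]"]; (auto simp: assms cyc_eval)[])
  apply (subst app_perm[where n = 5 and \<tau> = "cyc [4, 3]"]; (auto simp: assms cyc_eval)[])
  apply (subst app_perm[where n = 5 and \<tau> = "cyc [3, 2, 1]"]; (auto simp: assms cyc_eval)[])
  apply (subst app_perm[where n = 5 and \<tau> = "cyc [2, 3, 1]"]; (auto simp: assms cyc_eval)[])
  apply (subst app_perm[where n = 5 and \<tau> = "cyc [4, 3, 2]"]; (auto simp: assms cyc_eval)[])
  apply (subst app_perm[where n = 5 and \<tau> = "cyc [3, 4, 2]"]; (auto simp: assms cyc_eval)[])
  apply (subst app_perm[where n = 5 and \<tau> = "cyc [4, 3, 2, 1]"]; (auto simp: assms cyc_eval)[])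
  apply (subst app_perm[where n = 5 and \<tau> = "cyc [2, 4, 3, 1]"]; (auto simp: assms cyc_eval)[])
  apply (subst app_perm[where n = 5 and \<tau> = "cyc [2, 3, 4, 1]"]; (auto simp: assms cyc_eval)[])
  apply (subst app_perm[where n = 5 and \<tau> = "cyc [4, 2] \<circ> cyc [3, 1]"]; (auto simp: assms cyc_eval)[])
  done

text \<open>The simplifier rewrites the natural number \<open>1\<close> inside a cycle to
  \<open>Suc 0\<close>, and the left sides have to agree with that.\<close>

lemmas app_perms = app_perm2[unfolded One_nat_def] app_perm3[unfolded One_nat_def]
  app_perm4[unfolded One_nat_def] app_perm5[unfolded One_nat_def]

lemma cyc_permutes: "set cs \<subseteq> {1..n} \<Longrightarrow> cyc cs permutes {1..n}"
  using permutes_subset[OF cycle_permutes] .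

lemma cyc_comp_permutes:
  "set cs \<subseteq> {1..n} \<Longrightarrow> set ds \<subseteq> {1..n} \<Longrightarrow> cyc cs \<circ> cyc ds permutes {1..n}"
  by (intro permutes_compose cyc_permutes)

text \<open>Solving \<open>\<partial> \<mu> = \<rho>\<close> for the outer differential gives a rule
  that moves it to the inputs. The degree \<open>n\<close> is a separate variable so that the rule
  matches any way in which it is written.\<close>

lemma bd_eqD:
  assumes "bd d d' \<mu> \<doteq>\<^bsub>L\<^esub> \<rho>" "vs \<in> homs L (arity \<mu>)" "n = tdeg vs + deg \<mu>"
  shows "app d' [(n, app \<mu> vs)] = app \<rho> vs + sg (deg \<mu>) (\<Sum>i = 1..arity \<mu>. app (\<mu> \<circ>\<^bsub>i\<^esub> d) vs)"
proof -
  have "app (bd d d' \<mu>) vs = app \<rho> vs" using assms(1,2) by (simp add: eq_on_def)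
  then show ?thesis using assms(2,3) by (simp add: app_bd val_def length_homs diff_eq_eq del: app_pcomp)
qed

section \<open>Multilinear expansion on lists of fixed length\<close>

context graded_module_pair
begin

lemma lin_minus:
  assumes "lin s (L n) s' g" "x \<in> L n" "y \<in> L n"
  shows "g 0 = 0" "g (- x) = - g x" "g (x - y) = g x - g y"
proof -
  have add: "g (u + v) = g u + g v" if "u \<in> L n" "v \<in> L n" for u v
    using assms(1) that by (simp add: lin_def)
  show 0: "g 0 = 0" using add[OF zero_mem zero_mem] by simp
  have m: "g (- u) = - g u" if "u \<in> L n" for u
    using add[OF that minus_mem[OF that]] 0 by (simp add: eq_neg_iff_add_eq_0 add.commute)
  show "g (- x) = - g x" by (rule m) fact
  show "g (x - y) = g x - g y"
    using add[OF assms(2) minus_mem[OF assms(3)]] m[OF assms(3)] by simp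
qed

lemma app_lin:
  assumes "mmap_on s L s' L' n k \<mu>" "us @ (a, x) # vs \<in> homs L n" "y \<in> L a"
  shows "app \<mu> (us @ (a, x + y) # vs) = app \<mu> (us @ (a, x) # vs) + app \<mu> (us @ (a, y) # vs)"
    and "app \<mu> (us @ (a, x - y) # vs) = app \<mu> (us @ (a, x) # vs) - app \<mu> (us @ (a, y) # vs)"
    and "app \<mu> (us @ (a, - x) # vs) = - app \<mu> (us @ (a, x) # vs)"
proof -
  have x: "x \<in> L a" using assms(2) by (auto simp: homs_def)
  note l = mmap_on_lin[OF assms(1,2)]
  show "app \<mu> (us @ (a, x + y) # vs) = app \<mu> (us @ (a, x) # vs) + app \<mu> (us @ (a, y) # vs)"
    using l x assms(3) by (simp add: lin_def)
qed (use lin_minus[OF mmap_on_lin[OF assms(1,2)] _ assms(3)] assms(2) in \<open>auto simp: homs_def\<close>)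

lemma app_zero:
  assumes "mmap_on s L s' L' n k \<mu>" "us @ (a, 0) # vs \<in> homs L n"
  shows "app \<mu> (us @ (a, 0) # vs) = 0"
  using lin_minus(1)[OF mmap_on_lin[OF assms] zero_mem zero_mem] .

text \<open>A pattern \<open>us @ (a, x) # vs\<close> does not match an explicit list, so for
  rewriting the rules are spelled out slot by slot, here and for the higher arities.\<close>

lemma app_lin1:
  assumes "mmap_on s L s' L' 1 k \<mu>"
  shows "x \<in> L a \<Longrightarrow> y \<in> L a \<Longrightarrow> app \<mu> [(a, x + y)] = app \<mu> [(a, x)] + app \<mu> [(a, y)]"
    and "x \<in> L a \<Longrightarrow> y \<in> L a \<Longrightarrow> app \<mu> [(a, x - y)] = app \<mu> [(a, x)] - app \<mu> [(a, y)]"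
    and "x \<in> L a \<Longrightarrow> app \<mu> [(a, - x)] = - app \<mu> [(a, x)]"
    and "app \<mu> [(a, 0)] = 0"
  using app_lin[OF assms, of "[]"] app_zero[OF assms, of "[]"] by (simp_all add: zero_mem)

lemma app_lin2:
  assumes "mmap_on s L s' L' 2 k \<mu>"
  shows "x \<in> L a \<Longrightarrow> y \<in> L a \<Longrightarrow> u \<in> L c \<Longrightarrow>
      app \<mu> [(a, x + y), (c, u)] = app \<mu> [(a, x), (c, u)] + app \<mu> [(a, y), (c, u)]"
    and "x \<in> L a \<Longrightarrow> y \<in> L a \<Longrightarrow> u \<in> L c
        \<Longrightarrow> app \<mu> [(a, x - y), (c, u)] = app \<mu> [(a, x), (c, u)] - app \<mu> [(a, y), (c, u)]"
    and "x \<in> L a \<Longrightarrow> u \<in> L c \<Longrightarrow> app \<mu> [(a, - x), (c, u)] = - app \<mu> [(a, x), (c, u)]"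
    and "u \<in> L c \<Longrightarrow> app \<mu> [(a, 0), (c, u)] = 0"
    and "x \<in> L a \<Longrightarrow> y \<in> L a \<Longrightarrow> t \<in> L b
        \<Longrightarrow> app \<mu> [(b, t), (a, x + y)] = app \<mu> [(b, t), (a, x)] + app \<mu> [(b, t), (a, y)]"
    and "x \<in> L a \<Longrightarrow> y \<in> L a \<Longrightarrow> t \<in> L b
        \<Longrightarrow> app \<mu> [(b, t), (a, x - y)] = app \<mu> [(b, t), (a, x)] - app \<mu> [(b, t), (a, y)]"
    and "x \<in> L a \<Longrightarrow> t \<in> L b \<Longrightarrow> app \<mu> [(b, t), (a, - x)] = - app \<mu> [(b, t), (a, x)]"
    and "t \<in> L b \<Longrightarrow> app \<mu> [(b, t), (a, 0)] = 0"
  using app_lin[OF assms, of "[]"] app_lin[OF assms, of "[(b, t)]"] app_zero[OF assms, of "[]"]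
    app_zero[OF assms, of "[(b, t)]"]
  by (simp_all add: zero_mem)

lemma app_lin3:
  assumes "mmap_on s L s' L' 3 k \<mu>"
  shows "x \<in> L a \<Longrightarrow> y \<in> L a \<Longrightarrow> u \<in> L c \<Longrightarrow> v \<in> L e \<Longrightarrow>
      app \<mu> [(a, x + y), (c, u), (e, v)] =
        app \<mu> [(a, x), (c, u), (e, v)] + app \<mu> [(a, y), (c, u), (e, v)]"
    and "x \<in> L a \<Longrightarrow> y \<in> L a \<Longrightarrow> u \<in> L c \<Longrightarrow> v \<in> L e
        \<Longrightarrow> app \<mu> [(a, x - y), (c, u), (e, v)] = app \<mu> [(a, x), (c, u), (e, v)] - app \<mu> [(a, y), (c, u), (e, v)]"
    and "x \<in> L a \<Longrightarrow> u \<in> L c \<Longrightarrow> v \<in> L e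
        \<Longrightarrow> app \<mu> [(a, - x), (c, u), (e, v)] = - app \<mu> [(a, x), (c, u), (e, v)]"
    and "u \<in> L c \<Longrightarrow> v \<in> L e \<Longrightarrow> app \<mu> [(a, 0), (c, u), (e, v)] = 0"
    and "x \<in> L a \<Longrightarrow> y \<in> L a \<Longrightarrow> t \<in> L b \<Longrightarrow> v \<in> L e
        \<Longrightarrow> app \<mu> [(b, t), (a, x + y), (e, v)] = app \<mu> [(b, t), (a, x), (e, v)] + app \<mu> [(b, t), (a, y), (e, v)]"
    and "x \<in> L a \<Longrightarrow> y \<in> L a \<Longrightarrow> t \<in> L b \<Longrightarrow> v \<in> L e
        \<Longrightarrow> app \<mu> [(b, t), (a, x - y), (e, v)] = app \<mu> [(b, t), (a, x), (e, v)] - app \<mu> [(b, t), (a, y), (e, v)]"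
    and "x \<in> L a \<Longrightarrow> t \<in> L b \<Longrightarrow> v \<in> L e
        \<Longrightarrow> app \<mu> [(b, t), (a, - x), (e, v)] = - app \<mu> [(b, t), (a, x), (e, v)]"
    and "t \<in> L b \<Longrightarrow> v \<in> L e \<Longrightarrow> app \<mu> [(b, t), (a, 0), (e, v)] = 0"
    and "x \<in> L a \<Longrightarrow> y \<in> L a \<Longrightarrow> t \<in> L b \<Longrightarrow> u \<in> L c
        \<Longrightarrow> app \<mu> [(b, t), (c, u), (a, x + y)] = app \<mu> [(b, t), (c, u), (a, x)] + app \<mu> [(b, t), (c, u), (a, y)]"
    and "x \<in> L a \<Longrightarrow> y \<in> L a \<Longrightarrow> t \<in> L b \<Longrightarrow> u \<in> L c
        \<Longrightarrow> app \<mu> [(b, t), (c, u), (a, x - y)] = app \<mu> [(b, t), (c, u), (a, x)] - app \<mu> [(b, t), (c, u), (a, y)]"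
    and "x \<in> L a \<Longrightarrow> t \<in> L b \<Longrightarrow> u \<in> L c
        \<Longrightarrow> app \<mu> [(b, t), (c, u), (a, - x)] = - app \<mu> [(b, t), (c, u), (a, x)]"
    and "t \<in> L b \<Longrightarrow> u \<in> L c \<Longrightarrow> app \<mu> [(b, t), (c, u), (a, 0)] = 0"
  using app_lin[OF assms, of "[]"] app_lin[OF assms, of "[(b, t)]"]
    app_lin[OF assms, of "[(b, t), (c, u)]"] app_zero[OF assms, of "[]"]
    app_zero[OF assms, of "[(b, t)]"] app_zero[OF assms, of "[(b, t), (c, u)]"]
  by (simp_all add: zero_mem)

lemma app_lin4:
  assumes "mmap_on s L s' L' 4 k \<mu>"
  shows "x \<in> L a \<Longrightarrow> y \<in> L a \<Longrightarrow> u \<in> L c \<Longrightarrow> v \<in> L e \<Longrightarrow> w \<in> L f \<Longrightarrow>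
      app \<mu> [(a, x + y), (c, u), (e, v), (f, w)] =
        app \<mu> [(a, x), (c, u), (e, v), (f, w)] + app \<mu> [(a, y), (c, u), (e, v), (f, w)]"
    and "x \<in> L a \<Longrightarrow> y \<in> L a \<Longrightarrow> u \<in> L c \<Longrightarrow> v \<in> L e \<Longrightarrow> w \<in> L f
        \<Longrightarrow> app \<mu> [(a, x - y), (c, u), (e, v), (f, w)] = app \<mu> [(a, x), (c, u), (e, v), (f, w)] - app \<mu> [(a, y), (c, u), (e, v), (f, w)]"
    and "x \<in> L a \<Longrightarrow> u \<in> L c \<Longrightarrow> v \<in> L e \<Longrightarrow> w \<in> L f
        \<Longrightarrow> app \<mu> [(a, - x), (c, u), (e, v), (f, w)] = - app \<mu> [(a, x), (c, u), (e, v), (f, w)]"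
    and "u \<in> L c \<Longrightarrow> v \<in> L e \<Longrightarrow> w \<in> L f \<Longrightarrow> app \<mu> [(a, 0), (c, u), (e, v), (f, w)] = 0"
    and "x \<in> L a \<Longrightarrow> y \<in> L a \<Longrightarrow> t \<in> L b \<Longrightarrow> v \<in> L e \<Longrightarrow> w \<in> L f
        \<Longrightarrow> app \<mu> [(b, t), (a, x + y), (e, v), (f, w)] = app \<mu> [(b, t), (a, x), (e, v), (f, w)] + app \<mu> [(b, t), (a, y), (e, v), (f, w)]"
    and "x \<in> L a \<Longrightarrow> y \<in> L a \<Longrightarrow> t \<in> L b \<Longrightarrow> v \<in> L e \<Longrightarrow> w \<in> L f
        \<Longrightarrow> app \<mu> [(b, t), (a, x - y), (e, v), (f, w)] = app \<mu> [(b, t), (a, x), (e, v), (f, w)] - app \<mu> [(b, t), (a, y), (e, v), (f, w)]"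
    and "x \<in> L a \<Longrightarrow> t \<in> L b \<Longrightarrow> v \<in> L e \<Longrightarrow> w \<in> L f
        \<Longrightarrow> app \<mu> [(b, t), (a, - x), (e, v), (f, w)] = - app \<mu> [(b, t), (a, x), (e, v), (f, w)]"
    and "t \<in> L b \<Longrightarrow> v \<in> L e \<Longrightarrow> w \<in> L f \<Longrightarrow> app \<mu> [(b, t), (a, 0), (e, v), (f, w)] = 0"
    and "x \<in> L a \<Longrightarrow> y \<in> L a \<Longrightarrow> t \<in> L b \<Longrightarrow> u \<in> L c \<Longrightarrow> w \<in> L f
        \<Longrightarrow> app \<mu> [(b, t), (c, u), (a, x + y), (f, w)] = app \<mu> [(b, t), (c, u), (a, x), (f, w)] + app \<mu> [(b, t), (c, u), (a, y), (f, w)]"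
    and "x \<in> L a \<Longrightarrow> y \<in> L a \<Longrightarrow> t \<in> L b \<Longrightarrow> u \<in> L c \<Longrightarrow> w \<in> L f
        \<Longrightarrow> app \<mu> [(b, t), (c, u), (a, x - y), (f, w)] = app \<mu> [(b, t), (c, u), (a, x), (f, w)] - app \<mu> [(b, t), (c, u), (a, y), (f, w)]"
    and "x \<in> L a \<Longrightarrow> t \<in> L b \<Longrightarrow> u \<in> L c \<Longrightarrow> w \<in> L f
        \<Longrightarrow> app \<mu> [(b, t), (c, u), (a, - x), (f, w)] = - app \<mu> [(b, t), (c, u), (a, x), (f, w)]"
    and "t \<in> L b \<Longrightarrow> u \<in> L c \<Longrightarrow> w \<in> L f \<Longrightarrow> app \<mu> [(b, t), (c, u), (a, 0), (f, w)] = 0"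
    and "x \<in> L a \<Longrightarrow> y \<in> L a \<Longrightarrow> t \<in> L b \<Longrightarrow> u \<in> L c \<Longrightarrow> v \<in> L e
        \<Longrightarrow> app \<mu> [(b, t), (c, u), (e, v), (a, x + y)] = app \<mu> [(b, t), (c, u), (e, v), (a, x)] + app \<mu> [(b, t), (c, u), (e, v), (a, y)]"
    and "x \<in> L a \<Longrightarrow> y \<in> L a \<Longrightarrow> t \<in> L b \<Longrightarrow> u \<in> L c \<Longrightarrow> v \<in> L e
        \<Longrightarrow> app \<mu> [(b, t), (c, u), (e, v), (a, x - y)] = app \<mu> [(b, t), (c, u), (e, v), (a, x)] - app \<mu> [(b, t), (c, u), (e, v), (a, y)]"
    and "x \<in> L a \<Longrightarrow> t \<in> L b \<Longrightarrow> u \<in> L c \<Longrightarrow> v \<in> L e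
        \<Longrightarrow> app \<mu> [(b, t), (c, u), (e, v), (a, - x)] = - app \<mu> [(b, t), (c, u), (e, v), (a, x)]"
    and "t \<in> L b \<Longrightarrow> u \<in> L c \<Longrightarrow> v \<in> L e \<Longrightarrow> app \<mu> [(b, t), (c, u), (e, v), (a, 0)] = 0"
  using app_lin[OF assms, of "[]"] app_lin[OF assms, of "[(b, t)]"]
    app_lin[OF assms, of "[(b, t), (c, u)]"] app_lin[OF assms, of "[(b, t), (c, u), (e, v)]"]
    app_zero[OF assms, of "[]"] app_zero[OF assms, of "[(b, t)]"]
    app_zero[OF assms, of "[(b, t), (c, u)]"] app_zero[OF assms, of "[(b, t), (c, u), (e, v)]"]
  by (simp_all add: zero_mem)

lemma app_mem:
  "mmap_on s L s' L' n k \<mu> \<Longrightarrow> vs \<in> homs L n \<Longrightarrow> m = tdeg vs + k \<Longrightarrow> app \<mu> vs \<in> L' m"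
  using mmap_on_app by blast

text \<open>Inputs of degree outside \<open>{0, 1, 2}\<close> vanish, and so do values of such degrees.\<close>

lemma eq_onI:
  assumes \<mu>: "mmap_on s L s' L' n k \<mu>" and \<nu>: "mmap_on s L s' L' n k \<nu>"
    and L: "\<And>n. n \<notin> {0, 1, 2} \<Longrightarrow> L n = {0}" and L': "\<And>n. n \<notin> {0, 1, 2} \<Longrightarrow> L' n = {0}"
    and eq: "\<And>vs. vs \<in> homs L n \<Longrightarrow> fst ` set vs \<subseteq> {0, 1, 2} \<Longrightarrow> tdeg vs + k \<in> {0, 1, 2}
        \<Longrightarrow> app \<mu> vs = app \<nu> vs"
  shows "\<mu> \<doteq>\<^bsub>L\<^esub> \<nu>"
  unfolding eq_on_def
proof (intro conjI ballI)
  fix vs assume "vs \<in> homs L (arity \<mu>)"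
  then have vs: "vs \<in> homs L n" using mmap_on_arity[OF \<mu>] by simp
  show "app \<mu> vs = app \<nu> vs"
  proof (cases "fst ` set vs \<subseteq> {0, 1, 2}")
    case True
    show ?thesis
    proof (cases "tdeg vs + k \<in> {0, 1, 2}")
      case False
      then show ?thesis using mmap_on_app[OF \<mu> vs] mmap_on_app[OF \<nu> vs] L' by simp
    qed (use eq vs True in blast)
  next
    case False
    then obtain us a x ws where split: "vs = us @ (a, x) # ws" and a: "a \<notin> {0, 1, 2}"
      by (fastforce dest: split_list)
    then have "x = 0" using L vs by (auto simp: homs_def)
    then show ?thesis
      using app_zero[OF \<mu>, of us a ws] app_zero[OF \<nu>, of us a ws] vs by (simp add: split)
  qed
qed (use \<mu> \<nu> in \<open>simp_all add: mmap_on_def\<close>)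

end

section \<open>The boundary operator in arities 2, 3 and 4\<close>

lemma app_bd2:
  assumes "arity \<mu> = 2" "arity d = 1" "deg d = - 1"
  shows "app (bd d d' \<mu>) [(a, x), (b, y)] =
    app d' [(a + b + deg \<mu>, app \<mu> [(a, x), (b, y)])] - sg (deg \<mu>)
      (app \<mu> [(a - 1, app d [(a, x)]), (b, y)] +
       sg a (app \<mu> [(a, x), (b - 1, app d [(b, y)])]))"
  using assms by (simp add: app_bd val_def eval_nat_numeral sum.atLeast_Suc_atMost add_ac sg_def)

lemma bd_eqD2:
  assumes "bd d d' \<mu> \<doteq>\<^bsub>L\<^esub> \<rho>" "arity \<mu> = 2" "arity d = 1" "deg d = - 1"
    and "x \<in> L a" "y \<in> L b" "n = a + b + deg \<mu>"
  shows "app d' [(n, app \<mu> [(a, x), (b, y)])] = app \<rho> [(a, x), (b, y)] + sg (deg \<mu>)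
      (app \<mu> [(a - 1, app d [(a, x)]), (b, y)] +
       sg a (app \<mu> [(a, x), (b - 1, app d [(b, y)])]))"
proof -
  have "[(a, x), (b, y)] \<in> homs L (arity (bd d d' \<mu>))" using assms by simp
  with assms(1) have "app (bd d d' \<mu>) [(a, x), (b, y)] = app \<rho> [(a, x), (b, y)]"
    unfolding eq_on_def by blast
  then show ?thesis using app_bd2[OF assms(2-4), of d' a x b y] assms by (simp add: diff_eq_eq)
qed

lemma app_bd3:
  assumes "arity \<mu> = 3" "arity d = 1" "deg d = - 1"
  shows "app (bd d d' \<mu>) [(a, x), (b, y), (c, z)] =
    app d' [(a + b + c + deg \<mu>, app \<mu> [(a, x), (b, y), (c, z)])] - sg (deg \<mu>)
      (app \<mu> [(a - 1, app d [(a, x)]), (b, y), (c, z)] +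
       sg a (app \<mu> [(a, x), (b - 1, app d [(b, y)]), (c, z)]) +
       sg (a + b) (app \<mu> [(a, x), (b, y), (c - 1, app d [(c, z)])]))"
  using assms by (simp add: app_bd val_def eval_nat_numeral sum.atLeast_Suc_atMost add_ac sg_def)

lemma bd_eqD3:
  assumes "bd d d' \<mu> \<doteq>\<^bsub>L\<^esub> \<rho>" "arity \<mu> = 3" "arity d = 1" "deg d = - 1"
    and "x \<in> L a" "y \<in> L b" "z \<in> L c" "n = a + b + c + deg \<mu>"
  shows "app d' [(n, app \<mu> [(a, x), (b, y), (c, z)])] = app \<rho> [(a, x), (b, y), (c, z)] + sg (deg \<mu>)
      (app \<mu> [(a - 1, app d [(a, x)]), (b, y), (c, z)] +
       sg a (app \<mu> [(a, x), (b - 1, app d [(b, y)]), (c, z)]) +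
       sg (a + b) (app \<mu> [(a, x), (b, y), (c - 1, app d [(c, z)])]))"
proof -
  have "[(a, x), (b, y), (c, z)] \<in> homs L (arity (bd d d' \<mu>))" using assms by simp
  with assms(1) have "app (bd d d' \<mu>) [(a, x), (b, y), (c, z)] = app \<rho> [(a, x), (b, y), (c, z)]"
    unfolding eq_on_def by blast
  then show ?thesis using app_bd3[OF assms(2-4), of d' a x b y c z] assms by (simp add: diff_eq_eq)
qed

lemma app_bd4:
  assumes "arity \<mu> = 4" "arity d = 1" "deg d = - 1"
  shows "app (bd d d' \<mu>) [(a, x), (b, y), (c, z), (e, w)] =
    app d' [(a + b + c + e + deg \<mu>, app \<mu> [(a, x), (b, y), (c, z), (e, w)])] - sg (deg \<mu>)
      (app \<mu> [(a - 1, app d [(a, x)]), (b, y), (c, z), (e, w)] +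
       sg a (app \<mu> [(a, x), (b - 1, app d [(b, y)]), (c, z), (e, w)]) +
       sg (a + b) (app \<mu> [(a, x), (b, y), (c - 1, app d [(c, z)]), (e, w)]) +
       sg (a + b + c) (app \<mu> [(a, x), (b, y), (c, z), (e - 1, app d [(e, w)])]))"
  using assms by (simp add: app_bd val_def eval_nat_numeral sum.atLeast_Suc_atMost add_ac sg_def)

lemma bd_eqD4:
  assumes "bd d d' \<mu> \<doteq>\<^bsub>L\<^esub> \<rho>" "arity \<mu> = 4" "arity d = 1" "deg d = - 1"
    and "x \<in> L a" "y \<in> L b" "z \<in> L c" "w \<in> L e" "n = a + b + c + e + deg \<mu>"
  shows "app d' [(n, app \<mu> [(a, x), (b, y), (c, z), (e, w)])] =
      app \<rho> [(a, x), (b, y), (c, z), (e, w)] + sg (deg \<mu>)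
      (app \<mu> [(a - 1, app d [(a, x)]), (b, y), (c, z), (e, w)] +
       sg a (app \<mu> [(a, x), (b - 1, app d [(b, y)]), (c, z), (e, w)]) +
       sg (a + b) (app \<mu> [(a, x), (b, y), (c - 1, app d [(c, z)]), (e, w)]) +
       sg (a + b + c) (app \<mu> [(a, x), (b, y), (c, z), (e - 1, app d [(e, w)])]))"
proof -
  have "[(a, x), (b, y), (c, z), (e, w)] \<in> homs L (arity (bd d d' \<mu>))" using assms by simp
  with assms(1) have "app (bd d d' \<mu>) [(a, x), (b, y), (c, z), (e, w)] =
      app \<rho> [(a, x), (b, y), (c, z), (e, w)]"
    unfolding eq_on_def by blast
  then show ?thesis using app_bd4[OF assms(2-4), of d' a x b y c z e w] assms by (simp add: diff_eq_eq)
qed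

section \<open>Transfer along a deformation retract\<close>

lemma app_tcomp1:
  assumes "length vs = arity R"
  shows "app (f \<odot> [R]) vs = app f [(tdeg vs + deg R, app R vs)]"
  using assms by (simp add: val_def)

text \<open>The degrees are nonnegative and their sum is at most 0. So a map of degree 2 has to be
  examined on inputs of degree 0 only.\<close>

lemma tdeg_zeroD:
  assumes "fst ` set vs \<subseteq> {0, 1, 2}" "tdeg vs + 2 \<in> {0, 1, 2}"
  shows "tdeg vs = 0" "\<And>v. v \<in> set vs \<Longrightarrow> fst v = 0"
proof -
  have "\<forall>x \<in> set (map fst vs). 0 \<le> x" using assms(1) by auto
  then have "0 \<le> tdeg vs" "tdeg vs = 0 \<longleftrightarrow> (\<forall>x \<in> set (map fst vs). x = 0)"
    using sum_list_nonneg_eq_0_iff[of "map fst vs"] sum_list_nonneg[of "map fst vs"]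
    by (auto simp: tdeg_def)
  then show "tdeg vs = 0" "\<And>v. v \<in> set vs \<Longrightarrow> fst v = 0" using assms(2) by auto
qed

section \<open>Consequences of the retract data\<close>

context deformation_retract
begin

sublocale LL: graded_module_pair s L s L ..
sublocale LS: graded_module_pair s L s' L' ..
sublocale SL: graded_module_pair s' L' s L ..
sublocale SS: graded_module_pair s' L' s' L' ..

lemmas d_map = big.d_map and d'_map = small.d_map

lemmas [maps] = d_map d'_map p_map i_map h_map

lemma retract_simps [simp]:
  "arity d = 1" "arity d' = 1" "arity p = 1" "arity i = 1" "arity h = 1"
  "deg d = - 1" "deg d' = - 1" "deg p = 0" "deg i = 0" "deg h = 1"
  using d_map d'_map p_map i_map h_map by (simp_all add: mmap_on_def)

lemmas closure = LL.mmap_on_plus LL.mmap_on_minus LL.mmap_on_uminus LL.mmap_on_perm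
  SL.mmap_on_plus SL.mmap_on_minus SL.mmap_on_uminus SL.mmap_on_perm SL.mmap_on_zero
  SS.mmap_on_plus SS.mmap_on_minus SS.mmap_on_uminus SS.mmap_on_perm SS.mmap_on_zero
  LL.mmap_on_pcomp' SL.mmap_on_pcomp' SS.mmap_on_pcomp'
  mmap_on_tcomp'[OF big.graded_module_axioms, where s' = s and L' = L]
  mmap_on_tcomp'[OF big.graded_module_axioms, where s' = s' and L' = L']
  mmap_on_tcomp'[OF small.graded_module_axioms, where s' = s and L' = L]
  cyc_permutes cyc_comp_permutes

lemma transfer_maps:
  assumes "mmap_on s' L' s L n k R"
  shows "mmap_on s' L' s' L' n k (p \<odot> [R])" "mmap_on s' L' s L n (k + 1) (- (h \<odot> [R]))"
  using assms mmap_on_arity[OF assms] mmap_on_deg[OF assms]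
  by (intro closure; simp add: maps del: One_nat_def)+

lemma i_comp_map:
  assumes "mmap_on s' L' s' L' n k \<mu>"
  shows "mmap_on s' L' s L n k (i \<odot> [\<mu>])"
  using assms mmap_on_arity[OF assms] mmap_on_deg[OF assms]
  by (intro closure; simp add: maps del: One_nat_def)

lemma p_i: "x \<in> L' n \<Longrightarrow> app p [(n, app i [(n, x)])] = x"
  using retraction by (auto simp: eq_on_def idm_def val_def dest!: bspec[where x = "[(n, x)]"])

lemma homotopy_eq:
  assumes "x \<in> L n"
  shows "app i [(n, app p [(n, x)])] =
    x - app d [(n + 1, app h [(n, x)])] - app h [(n - 1, app d [(n, x)])]"
proof -
  have "app (idm - i \<odot> [p]) [(n, x)] = app (d \<odot> [h] + h \<odot> [d]) [(n, x)]"
    using homotopy assms unfolding eq_on_def by (auto simp: idm_def dest!: bspec[where x = "[(n, x)]"])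
  then show ?thesis by (simp add: idm_def val_def algebra_simps)
qed

lemma chain:
  shows "x \<in> L n \<Longrightarrow> app d' [(n, app p [(n, x)])] = app p [(n - 1, app d [(n, x)])]"
    and "y \<in> L' n \<Longrightarrow> app d [(n, app i [(n, y)])] = app i [(n - 1, app d' [(n, y)])]"
  using bd_eqD[OF p_chain, of "[(n, x)]" n] bd_eqD[OF i_chain, of "[(n, y)]" n] by simp_all

text \<open>Put \<open>e = i p\<close>, which is idempotent and commutes with \<open>d\<close>. Then
  \<open>d h' + h' d = (d h + h d) (1 - e) = (1 - e) (1 - e) = 1 - e\<close>, and
  \<open>h' i = h (i - i p i) = 0\<close>.\<close>

lemma normalized_homotopy:
  defines "h' \<equiv> h - h \<odot> [i] \<odot> [p]"
  shows "deformation_retract s L d s' L' d' p i h'" and "h' \<odot> [i] \<doteq>\<^bsub>L'\<^esub> zero_mmap 1 1"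
proof -
  have hi: "mmap_on s' L' s L 1 1 (h \<odot> [i])"
    by (intro closure) (simp_all add: maps del: One_nat_def)
  have h': "mmap_on s L s L 1 1 h'"
    unfolding h'_def using hi
    by (intro closure h_map mmap_on_tcomp[OF big.graded_module_axioms hi])
      (simp_all add: maps del: One_nat_def)
  have app_h': "app h' [(n, x)] = app h [(n, x)] - app h [(n, app i [(n, app p [(n, x)])])]" for n x
    by (simp add: h'_def val_def)
  have ah': "arity h' = 1" "deg h' = 1" using h' by (simp_all add: mmap_on_def)
  have mem_ip: "app i [(n, app p [(n, x)])] \<in> L n" if "x \<in> L n" for x n
    using that SL.app_mem[OF i_map, of "[(n, app p [(n, x)])]" n] LS.app_mem[OF p_map, of "[(n, x)]" n]
    by simp
  have mem_h: "app h [(n, x)] \<in> L (n + 1)" if "x \<in> L n" for x n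
    using that LL.app_mem[OF h_map, of "[(n, x)]" "n + 1"] by simp
  have hom: "x - app i [(n, app p [(n, x)])] =
      app d [(n + 1, app h' [(n, x)])] + app h' [(n - 1, app d [(n, x)])]" if x: "x \<in> L n" for x n
  proof -
    have px: "app p [(n, x)] \<in> L' n" using LS.app_mem[OF p_map, of "[(n, x)]" n] x by simp
    define y where "y = app i [(n, app p [(n, x)])]"
    have y: "y \<in> L n" using mem_ip[OF x] by (simp add: y_def)
    \<comment> \<open>\<open>1 - i p\<close> vanishes at \<open>y\<close>, so the given homotopy
      formula there reads \<open>d h y + h d y = 0\<close>. This exchanges the correction in
      \<open>h' d x\<close> for the one in \<open>d h' x\<close>.\<close>
    have "app i [(n, app p [(n, y)])] = y" using p_i[OF px] by (simp add: y_def)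
    then have "app d [(n + 1, app h [(n, y)])] + app h [(n - 1, app d [(n, y)])] = 0"
      using homotopy_eq[OF y] by (simp add: algebra_simps)
    moreover have "app d [(n, y)] = app i [(n - 1, app p [(n - 1, app d [(n, x)])])]"
      using chain(1)[OF x] chain(2)[OF px] by (simp add: y_def)
    ultimately have hdy: "app h [(n - 1, app i [(n - 1, app p [(n - 1, app d [(n, x)])])])] =
        - app d [(n + 1, app h [(n, y)])]"
      by (simp add: eq_neg_iff_add_eq_0 add.commute)
    have dh: "app d [(n + 1, app h [(n, x)] - app h [(n, y)])] =
        app d [(n + 1, app h [(n, x)])] - app d [(n + 1, app h [(n, y)])]"
      using LL.app_lin1(2)[OF d_map mem_h[OF x] mem_h[OF y]] .
    have "x - y = app d [(n + 1, app h [(n, x)])] + app h [(n - 1, app d [(n, x)])]"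
      using homotopy_eq[OF x] by (simp add: y_def)
    then show ?thesis by (simp only: app_h' y_def[symmetric] dh hdy) simp
  qed
  show "deformation_retract s L d s' L' d' p i h'"
  proof unfold_locales
    show "idm - i \<odot> [p] \<doteq>\<^bsub>L\<^esub> d \<odot> [h'] + h' \<odot> [d]"
      unfolding eq_on_def
    proof (intro conjI ballI)
      fix vs assume "vs \<in> homs L (arity (idm - i \<odot> [p]))"
      then obtain n x where "vs = [(n, x)]" "x \<in> L n"
        by (cases vs) (auto simp: idm_def homs_def)
      then show "app (idm - i \<odot> [p]) vs = app (d \<odot> [h'] + h' \<odot> [d]) vs"
        using hom[of x n] by (simp add: idm_def val_def ah')
    qed (simp_all add: idm_def ah')
  qed (fact h' p_map i_map p_chain i_chain retraction)+
  show "h' \<odot> [i] \<doteq>\<^bsub>L'\<^esub> zero_mmap 1 1"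
    unfolding eq_on_def
  proof (intro conjI ballI)
    fix vs assume "vs \<in> homs L' (arity (h' \<odot> [i]))"
    then obtain n x where "vs = [(n, x)]" "x \<in> L' n"
      by (cases vs) (auto simp: homs_def)
    then show "app (h' \<odot> [i]) vs = app (zero_mmap 1 1) vs"
      using p_i[of x n] app_h'[of n "app i [(n, x)]"] by (simp add: val_def ah')
  qed (simp_all add: ah')
qed

end

locale transfer = deformation_retract s L d s' L' d' p i h + weak_lie3 s L d l2 l3 l4 l21 l211 l31 l32
  for s :: "'k::{comm_ring,comm_monoid_mult} \<Rightarrow> 'v::ab_group_add \<Rightarrow> 'v"
    and L :: "int \<Rightarrow> 'v set" and d :: "('v, 'v) mmap"
    and s' :: "'k \<Rightarrow> 'w::ab_group_add \<Rightarrow> 'w"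
    and L' :: "int \<Rightarrow> 'w set" and d' :: "('w, 'w) mmap"
    and p :: "('v, 'w) mmap" and i :: "('w, 'v) mmap" and h :: "('v, 'v) mmap"
    and l2 l3 l4 l21 l211 l31 l32 :: "('v, 'v) mmap" +
  assumes h_i: "h \<odot> [i] \<doteq>\<^bsub>L'\<^esub> zero_mmap 1 1"
begin

lemmas [maps] = l2_map l3_map l4_map l21_map l211_map l31_map l32_map

lemma l_simps [simp]:
  "arity l2 = 2" "arity l3 = 3" "arity l4 = 4" "arity l21 = 2" "arity l211 = 2" "arity l31 = 3"
  "arity l32 = 3" "deg l2 = 0" "deg l3 = 1" "deg l4 = 2" "deg l21 = 1" "deg l211 = 2" "deg l31 = 2"
  "deg l32 = 2"
  using l2_map l3_map l4_map l21_map l211_map l31_map l32_map by (simp_all add: mmap_on_def)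

lemma h_i_eq: "x \<in> L' n \<Longrightarrow> app h [(n, app i [(n, x)])] = 0"
  using h_i by (auto simp: eq_on_def val_def dest!: bspec[where x = "[(n, x)]"])

text \<open>The sign comes from moving \<open>d'\<close> past the first inputs and is the same with
  and without \<open>f\<close>, so linearity carries it through \<open>f\<close>. The target is
  arbitrary because both \<open>p\<close> and \<open>h\<close> occur as \<open>f\<close>.\<close>

lemma pcomp_tcomp1:
  assumes f: "mmap_on s L t M 1 q f" and M: "graded_module t M" and R: "mmap_on s' L' s L n k R"
    and vs: "vs \<in> homs L' n" and j: "j \<in> {1..n}"
  shows "app ((f \<odot> [R]) \<circ>\<^bsub>j\<^esub> d') vs = app f [(tdeg vs + k - 1, app (R \<circ>\<^bsub>j\<^esub> d') vs)]"
proof -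
  interpret M: graded_module t M by fact
  interpret graded_module_pair s L t M ..
  define us v ws where "us = take (j - 1) vs" and "v = vs ! (j - 1)" and "ws = drop j vs"
  have len: "length vs = n" using vs by (rule length_homs)
  have split: "vs = us @ v # ws"
    using id_take_nth_drop[of "j - 1" vs] j len by (auto simp: us_def v_def ws_def)
  have tk: "take 1 (drop (j - 1) vs) = [v]" 
    using Cons_nth_drop_Suc[of "j - 1" vs, symmetric] j len by (auto simp: v_def)
  have n: "n = length us + Suc (length ws)" using len split by auto
  define W where "W = us @ (fst v - 1, app d' [v]) # ws"
  have mem: "us \<in> homs L' (length us)" "ws \<in> homs L' (length ws)" "snd v \<in> L' (fst v)"
    using vs split by (auto simp: homs_def)
  have "app d' [v] \<in> L' (fst v - 1)" using SS.app_mem[OF d'_map, of "[v]"] mem by simp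
  then have "W \<in> homs L' n" unfolding W_def n using mem by (intro homs_append) auto
  from mmap_on_app[OF R this] have r: "app R W \<in> L (tdeg vs + k - 1)"
    by (subst split) (simp add: W_def algebra_simps)
  have ar: "arity R = n" "deg R = k" using R by (auto simp: mmap_on_def)
  have tW: "tdeg W + k = tdeg vs + k - 1" by (subst split) (simp add: W_def)
  have lW: "length W = n" by (simp add: W_def n)
  \<comment> \<open>The exponent is really \<open>- tdeg us\<close>, as \<open>d'\<close> has degree
    -1, but only its parity counts.\<close>
  have eq: "app (\<nu> \<circ>\<^bsub>j\<^esub> d') vs = sg (tdeg us) (app \<nu> W)" for \<nu> :: "('w, 'b::ab_group_add) mmap"
    using j tk by (simp add: W_def us_def ws_def sg_def)
  have "app ((f \<odot> [R]) \<circ>\<^bsub>j\<^esub> d') vs = sg (tdeg us) (app f [(tdeg vs + k - 1, app R W)])"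
    unfolding eq using app_tcomp1[of W R f] tW lW by (simp add: ar)
  also have "\<dots> = app f [(tdeg vs + k - 1, sg (tdeg us) (app R W))]"
    using app_lin1[OF f] r by (simp add: sg_def)
  finally show ?thesis unfolding eq .
qed

section \<open>One transfer step\<close>

context
  fixes n k R O'
  assumes R: "mmap_on s' L' s L n k R" and O: "mmap_on s' L' s' L' n (k - 1) O'"
    and bd_R: "bd d' d R \<doteq>\<^bsub>L'\<^esub> i \<odot> [O']"
begin

text \<open>\<open>R\<close> composed with the differential of the n-fold tensor power of
  \<open>L'\<close>: up to sign, the part of \<open>\<partial> R\<close> in which the inputs are
  differentiated.\<close>

private definition "B vs = (\<Sum>j = 1..n. app (R \<circ>\<^bsub>j\<^esub> d') vs)"

private lemma ar: "arity R = n" "deg R = k" "arity O' = n" "deg O' = k - 1"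
  using R O by (auto simp: mmap_on_def)

private lemma mem:
  assumes "vs \<in> homs L' n"
  shows "app R vs \<in> L (tdeg vs + k)" "B vs \<in> L (tdeg vs + k - 1)" "app O' vs \<in> L' (tdeg vs + k - 1)"
    "app i [(tdeg vs + k - 1, app O' vs)] \<in> L (tdeg vs + k - 1)"
proof -
  have "app (R \<circ>\<^bsub>j\<^esub> d') vs \<in> L (tdeg vs + k - 1)" if "j \<in> {1..n}" for j
    using mmap_on_app[OF SL.mmap_on_pcomp[OF R d'_map _ _ refl refl, of j]] that assms
    by (simp add: add_diff_eq del: app_pcomp)
  then show "B vs \<in> L (tdeg vs + k - 1)" unfolding B_def by (rule big.sum_mem)
  show O': "app O' vs \<in> L' (tdeg vs + k - 1)" using mmap_on_app[OF O assms] by (simp add: add_diff_eq)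
  show "app i [(tdeg vs + k - 1, app O' vs)] \<in> L (tdeg vs + k - 1)"
    using SL.app_mem[OF i_map, of "[(tdeg vs + k - 1, app O' vs)]"] O' by simp
qed (use mmap_on_app[OF R assms] in simp)

private lemma d_R:
  assumes "vs \<in> homs L' n"
  shows "app d [(tdeg vs + k, app R vs)] = app i [(tdeg vs + k - 1, app O' vs)] + sg k (B vs)"
  using bd_eqD[OF bd_R, of vs] assms length_homs[OF assms] ar
  by (simp add: B_def val_def algebra_simps del: app_pcomp)

private lemma B_comp:
  assumes f: "mmap_on s L t M 1 q f" and M: "graded_module t M" and vs: "vs \<in> homs L' n"
  shows "(\<Sum>j = 1..n. app ((f \<odot> [R]) \<circ>\<^bsub>j\<^esub> d') vs) = app f [(tdeg vs + k - 1, B vs)]"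
proof -
  interpret M: graded_module t M by fact
  interpret graded_module_pair s L t M ..
  have mem: "app (R \<circ>\<^bsub>j\<^esub> d') vs \<in> L (tdeg vs + k - 1)" if "j \<in> {1..n}" for j
    using mmap_on_app[OF SL.mmap_on_pcomp[OF R d'_map _ _ refl refl, of j]] that vs
    by (simp add: add_diff_eq del: app_pcomp)
  have sum: "app f [(m, \<Sum>j\<in>J. g j)] = (\<Sum>j\<in>J. app f [(m, g j)])"
    if "finite J" "\<And>j. j \<in> J \<Longrightarrow> g j \<in> L m" for J :: "nat set" and g m
    using that by induction (auto simp: app_lin1[OF f] big.sum_mem)
  then show ?thesis
    using mem pcomp_tcomp1[OF f M R vs] sum[of "{1..n}" "\<lambda>j. app (R \<circ>\<^bsub>j\<^esub> d') vs" "tdeg vs + k - 1"]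
        by (simp add: B_def del: app_pcomp)
qed

lemma transfer_bd: "bd d' d' (p \<odot> [R]) \<doteq>\<^bsub>L'\<^esub> O'"
  unfolding eq_on_def
proof (intro conjI ballI)
  fix vs assume "vs \<in> homs L' (arity (bd d' d' (p \<odot> [R])))"
  then have vs: "vs \<in> homs L' n" by (simp add: ar)
  have "app (bd d' d' (p \<odot> [R])) vs =
      app p [(tdeg vs + k - 1, app d [(tdeg vs + k, app R vs)])] - sg k (app p [(tdeg vs + k - 1, B vs)])"
    using B_comp[OF p_map small.graded_module_axioms vs] chain(1)[OF mem(1)[OF vs]] length_homs[OF vs]
    by (simp add: app_bd ar val_def del: app_pcomp)
  also have "\<dots> = app p [(tdeg vs + k - 1, app i [(tdeg vs + k - 1, app O' vs)])]"
    using d_R[OF vs] mem[OF vs] LS.app_lin1[OF p_map] big.minus_mem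
    by (simp add: sg_def)
  finally show "app (bd d' d' (p \<odot> [R])) vs = app O' vs" using p_i mem(3)[OF vs] by simp
qed (simp_all add: ar)

lemma transfer_homotopy: "bd d' d (- (h \<odot> [R])) \<doteq>\<^bsub>L'\<^esub> i \<odot> [p \<odot> [R]] - R"
  unfolding eq_on_def
proof (intro conjI ballI)
  fix vs assume "vs \<in> homs L' (arity (bd d' d (- (h \<odot> [R]))))"
  then have vs: "vs \<in> homs L' n" by (simp add: ar)
  let ?t = "tdeg vs + k"
  have hR: "app h [(?t, app R vs)] \<in> L (?t + 1)" 
    using LL.app_mem[OF h_map, of "[(?t, app R vs)]"] mem(1)[OF vs] by simp
  have neg: "app ((- \<nu>) \<circ>\<^bsub>j\<^esub> d') vs = - app (\<nu> \<circ>\<^bsub>j\<^esub> d') vs" for \<nu> :: "('w, 'v) mmap" and j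
    by (simp add: sg_def)
  have "app (bd d' d (- (h \<odot> [R]))) vs = - app d [(?t + 1, app h [(?t, app R vs)])]
      - sg k (app h [(?t - 1, B vs)])"
    using B_comp[OF h_map big.graded_module_axioms vs] LL.app_lin1(3)[OF d_map hR] length_homs[OF vs]
    by (simp add: app_bd ar val_def neg sum_negf algebra_simps sg_def del: app_pcomp)
  \<comment> \<open>The homotopy formula replaces \<open>- d h R\<close> by
    \<open>i p R - R + h d R\<close>. The last term joins the sum over the inputs to form
    \<open>h (\<partial> R) = h i O'\<close>, which is zero.\<close>
  also have "\<dots> = app i [(?t, app p [(?t, app R vs)])] - app R vs
      + (app h [(?t - 1, app d [(?t, app R vs)])] - sg k (app h [(?t - 1, B vs)]))"
    using homotopy_eq[OF mem(1)[OF vs]] by (simp add: algebra_simps)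
  also have "app h [(?t - 1, app d [(?t, app R vs)])] - sg k (app h [(?t - 1, B vs)]) =
      app h [(?t - 1, app i [(?t - 1, app O' vs)])]"
    using d_R[OF vs] mem[OF vs] LL.app_lin1[OF h_map] big.minus_mem
    by (simp add: sg_def)
  finally show "app (bd d' d (- (h \<odot> [R]))) vs = app (i \<odot> [p \<odot> [R]] - R) vs"
    using h_i_eq[OF mem(3)[OF vs]] length_homs[OF vs] by (simp add: ar val_def)
qed (simp_all add: ar)

text \<open>Only inputs of degree 0 matter. There \<open>d h R\<close> is zero because
  \<open>h R\<close> has degree 3, and \<open>h d R = h i O' = 0\<close> because \<open>d'\<close>
  kills the inputs. The homotopy formula then reads \<open>i p R = R\<close>.\<close>

lemma transfer_top:
  assumes k: "k = 2"
  shows "i \<odot> [p \<odot> [R]] \<doteq>\<^bsub>L'\<^esub> R"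
proof (rule SL.eq_onI[OF _ R small.concentrated big.concentrated])
  show "mmap_on s' L' s L n k (i \<odot> [p \<odot> [R]])"
    by (rule i_comp_map[OF transfer_maps(1)[OF R]])
next
  fix vs assume vs: "vs \<in> homs L' n" and deg: "fst ` set vs \<subseteq> {0, 1, 2}" "tdeg vs + k \<in> {0, 1, 2}"
  note t = tdeg_zeroD[OF deg[unfolded k]]
  \<comment> \<open>\<open>d'\<close> sends the input of degree 0 to degree -1, where the complex is
    zero.\<close>
  have "app (R \<circ>\<^bsub>j\<^esub> d') vs = 0" if j: "j \<in> {1..n}" for j
  proof -
    define us v ws where "us = take (j - 1) vs" and "v = vs ! (j - 1)" and "ws = drop j vs"
    have split: "vs = us @ v # ws" and tk: "take 1 (drop (j - 1) vs) = [v]"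
      using id_take_nth_drop[of "j - 1" vs] j length_homs[OF vs]
      by (auto simp: us_def v_def ws_def Cons_nth_drop_Suc[symmetric])
    have "snd v \<in> L' 0" using vs t(2)[of v] split by (auto simp: homs_def)
    then have "app d' [v] \<in> L' (- 1)" using SS.app_mem[OF d'_map, of "[v]"] t(2) split by simp
    then have "app d' [v] = 0" using small.concentrated[of "- 1"] by simp
    moreover have "us @ (- 1, 0) # ws \<in> homs L' n"
      using vs split small.zero_mem by (auto simp: homs_def)
    moreover have "fst v = 0" using t(2)[of v] split by auto
    ultimately show ?thesis
      using SL.app_zero[OF R, of us "- 1" ws] tk j by (simp add: us_def ws_def sg_def)
  qed
  then have "B vs = 0" by (simp add: B_def del: app_pcomp)
  then have "app h [(1, app d [(2, app R vs)])] = 0"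
    using d_R[OF vs] k t(1) h_i_eq mem(3)[OF vs] by simp
  moreover have mem2: "app R vs \<in> L 2" using mem(1)[OF vs] k t(1) by simp
  then have "[(2, app R vs)] \<in> homs L 1" by simp
  from mmap_on_app[OF h_map this] have "app h [(2, app R vs)] \<in> L 3" by simp
  then have "app h [(2, app R vs)] = 0" using big.concentrated[of 3] by simp
  ultimately have "app i [(2, app p [(2, app R vs)])] = app R vs"
    using homotopy_eq[OF mem2] LL.app_lin1(4)[OF d_map] by simp
  then show "app (i \<odot> [p \<odot> [R]]) vs = app R vs"
    using length_homs[OF vs] ar k t(1) by (simp add: val_def)
qed

end

section \<open>The transferred operations\<close>

lemma d_0: "x \<in> L 0 \<Longrightarrow> app d [(0, x)] = 0" and d'_0: "y \<in> L' 0 \<Longrightarrow> app d' [(0, y)] = 0"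
  using LL.app_mem[OF d_map, of "[(0, x)]" "- 1"] SS.app_mem[OF d'_map, of "[(0, y)]" "- 1"]
    big.concentrated[of "- 1"] small.concentrated[of "- 1"] by simp_all

lemma d_d_eq: "x \<in> L n \<Longrightarrow> m = n - 1 \<Longrightarrow> app d [(m, app d [(n, x)])] = 0"
  and d'_d'_eq: "y \<in> L' n \<Longrightarrow> m = n - 1 \<Longrightarrow> app d' [(m, app d' [(n, y)])] = 0"
  using big.d_d small.d_d
  by (auto simp: eq_on_def val_def dest!: bspec[where x = "[(n, x)]"] bspec[where x = "[(n, y)]"])

text \<open>The linearity and boundary rules are conditional on membership in the right piece. The
  membership rules in the same collection discharge these conditions once all degrees are
  numerals.\<close>

lemmas [elementwise] = val_def app_perms app_bd2 app_bd3 app_bd4 d_0 d'_0 d_d_eq d'_d'_eq chain(2)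
  big.zero_mem big.add_mem big.diff_mem big.minus_mem
  small.zero_mem small.add_mem small.diff_mem small.minus_mem
  LL.app_mem[OF d_map] SS.app_mem[OF d'_map] SL.app_mem[OF i_map] LL.app_mem[OF l2_map]
  LL.app_mem[OF l3_map] LL.app_mem[OF l4_map] LL.app_mem[OF l21_map] LL.app_mem[OF l211_map]
  LL.app_mem[OF l31_map] LL.app_mem[OF l32_map]
  LL.app_lin1[OF d_map] SS.app_lin1[OF d'_map] SL.app_lin1[OF i_map] LL.app_lin2[OF l2_map]
  LL.app_lin3[OF l3_map] LL.app_lin4[OF l4_map] LL.app_lin2[OF l21_map] LL.app_lin2[OF l211_map]
  LL.app_lin3[OF l31_map] LL.app_lin3[OF l32_map]
  bd_eqD2[OF bd_l2] bd_eqD3[OF bd_l3] bd_eqD4[OF bd_l4] bd_eqD2[OF bd_l21] bd_eqD2[OF bd_l211]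
  bd_eqD3[OF bd_l31] bd_eqD3[OF bd_l32]

lemma (in -) homs_2D: "vs \<in> homs L 2 \<Longrightarrow> \<exists>a x b y. vs = [(a, x), (b, y)]"
  by (cases vs; cases "tl vs") (auto simp: homs_def)

lemma (in -) homs_3D: "vs \<in> homs L 3 \<Longrightarrow> \<exists>a x b y c z. vs = [(a, x), (b, y), (c, z)]"
  by (cases vs; cases "tl vs"; cases "tl (tl vs)") (auto simp: homs_def)

lemma (in -) homs_4D: "vs \<in> homs L 4 \<Longrightarrow> \<exists>a x b y c z e w. vs = [(a, x), (b, y), (c, z), (e, w)]"
  by (cases vs; cases "tl vs"; cases "tl (tl vs)"; cases "tl (tl (tl vs))") (auto simp: homs_def)

text \<open>This leaves finitely many degree tuples, so that the parities in all signs are decided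
  before the expansion starts.\<close>

lemma bd_eq2I:
  assumes R: "mmap_on s' L' s L 2 k R" and O: "mmap_on s' L' s' L' 2 (k - 1) O'"
    and eq: "\<And>a x b y. x \<in> L' a \<Longrightarrow> y \<in> L' b \<Longrightarrow>
      a \<in> {0, 1, 2} \<Longrightarrow> b \<in> {0, 1, 2} \<Longrightarrow>
      a + b + (k - 1) \<in> {0, 1, 2} \<Longrightarrow>
      app (bd d' d R) [(a, x), (b, y)] =
      app i [(a + b + (k - 1), app O' [(a, x), (b, y)])]"
  shows "bd d' d R \<doteq>\<^bsub>L'\<^esub> i \<odot> [O']"
proof (rule SL.eq_onI[OF SL.mmap_on_bd[OF R d'_map d_map refl] i_comp_map[OF O]
      small.concentrated big.concentrated])
  fix vs assume h: "vs \<in> homs L' 2" "fst ` set vs \<subseteq> {0, 1, 2}" "tdeg vs + (k - 1) \<in> {0, 1, 2}"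
  from homs_2D[OF h(1)] obtain a x b y where vs: "vs = [(a, x), (b, y)]" by (elim exE)
  have "app (bd d' d R) [(a, x), (b, y)] = app i [(a + b + (k - 1), app O' [(a, x), (b, y)])]"
  proof (rule eq)
    show "x \<in> L' a" "y \<in> L' b" using h(1) by (simp_all add: vs)
    show "a \<in> {0, 1, 2}" "b \<in> {0, 1, 2}"
      using h(2) unfolding vs by (simp_all only: list.set image_insert fst_conv insert_subset)
    show "a + b + (k - 1) \<in> {0, 1, 2}"
      using h(3) unfolding vs by (simp only: tdeg_simps fst_conv add_0_right add.assoc)
  qed
  then show "app (bd d' d R) vs = app (i \<odot> [O']) vs"
    using mmap_on_arity[OF O] mmap_on_deg[OF O] by (simp add: vs val_def add.assoc)
qed

lemma bd_eq3I:
  assumes R: "mmap_on s' L' s L 3 k R" and O: "mmap_on s' L' s' L' 3 (k - 1) O'"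
    and eq: "\<And>a x b y c z. x \<in> L' a \<Longrightarrow> y \<in> L' b \<Longrightarrow> z \<in> L' c \<Longrightarrow>
      a \<in> {0, 1, 2} \<Longrightarrow> b \<in> {0, 1, 2} \<Longrightarrow> c \<in> {0, 1, 2} \<Longrightarrow>
      a + b + c + (k - 1) \<in> {0, 1, 2} \<Longrightarrow>
      app (bd d' d R) [(a, x), (b, y), (c, z)] =
      app i [(a + b + c + (k - 1), app O' [(a, x), (b, y), (c, z)])]"
  shows "bd d' d R \<doteq>\<^bsub>L'\<^esub> i \<odot> [O']"
proof (rule SL.eq_onI[OF SL.mmap_on_bd[OF R d'_map d_map refl] i_comp_map[OF O]
      small.concentrated big.concentrated])
  fix vs assume h: "vs \<in> homs L' 3" "fst ` set vs \<subseteq> {0, 1, 2}" "tdeg vs + (k - 1) \<in> {0, 1, 2}"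
  from homs_3D[OF h(1)] obtain a x b y c z where vs: "vs = [(a, x), (b, y), (c, z)]" by (elim exE)
  have "app (bd d' d R) [(a, x), (b, y), (c, z)] =
      app i [(a + b + c + (k - 1), app O' [(a, x), (b, y), (c, z)])]"
  proof (rule eq)
    show "x \<in> L' a" "y \<in> L' b" "z \<in> L' c" using h(1) by (simp_all add: vs)
    show "a \<in> {0, 1, 2}" "b \<in> {0, 1, 2}" "c \<in> {0, 1, 2}"
      using h(2) unfolding vs by (simp_all only: list.set image_insert fst_conv insert_subset)
    show "a + b + c + (k - 1) \<in> {0, 1, 2}"
      using h(3) unfolding vs by (simp only: tdeg_simps fst_conv add_0_right add.assoc)
  qed
  then show "app (bd d' d R) vs = app (i \<odot> [O']) vs"
    using mmap_on_arity[OF O] mmap_on_deg[OF O] by (simp add: vs val_def add.assoc)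
qed

lemma bd_eq4I:
  assumes R: "mmap_on s' L' s L 4 k R" and O: "mmap_on s' L' s' L' 4 (k - 1) O'"
    and eq: "\<And>a x b y c z e w. x \<in> L' a \<Longrightarrow> y \<in> L' b \<Longrightarrow> z \<in> L' c \<Longrightarrow> w \<in> L' e \<Longrightarrow>
      a \<in> {0, 1, 2} \<Longrightarrow> b \<in> {0, 1, 2} \<Longrightarrow> c \<in> {0, 1, 2} \<Longrightarrow> e \<in> {0, 1, 2} \<Longrightarrow>
      a + b + c + e + (k - 1) \<in> {0, 1, 2} \<Longrightarrow>
      app (bd d' d R) [(a, x), (b, y), (c, z), (e, w)] =
      app i [(a + b + c + e + (k - 1), app O' [(a, x), (b, y), (c, z), (e, w)])]"
  shows "bd d' d R \<doteq>\<^bsub>L'\<^esub> i \<odot> [O']"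
proof (rule SL.eq_onI[OF SL.mmap_on_bd[OF R d'_map d_map refl] i_comp_map[OF O]
      small.concentrated big.concentrated])
  fix vs assume h: "vs \<in> homs L' 4" "fst ` set vs \<subseteq> {0, 1, 2}" "tdeg vs + (k - 1) \<in> {0, 1, 2}"
  from homs_4D[OF h(1)] obtain a x b y c z e w where vs: "vs = [(a, x), (b, y), (c, z), (e, w)]"
      by (elim exE)
  have "app (bd d' d R) [(a, x), (b, y), (c, z), (e, w)] =
      app i [(a + b + c + e + (k - 1), app O' [(a, x), (b, y), (c, z), (e, w)])]"
  proof (rule eq)
    show "x \<in> L' a" "y \<in> L' b" "z \<in> L' c" "w \<in> L' e" using h(1) by (simp_all add: vs)
    show "a \<in> {0, 1, 2}" "b \<in> {0, 1, 2}" "c \<in> {0, 1, 2}" "e \<in> {0, 1, 2}"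
      using h(2) unfolding vs by (simp_all only: list.set image_insert fst_conv insert_subset)
    show "a + b + c + e + (k - 1) \<in> {0, 1, 2}"
      using h(3) unfolding vs by (simp only: tdeg_simps fst_conv add_0_right add.assoc)
  qed
  then show "app (bd d' d R) vs = app (i \<odot> [O']) vs"
    using mmap_on_arity[OF O] mmap_on_deg[OF O] by (simp add: vs val_def add.assoc)
qed

text \<open>The morphism runs from the new structure to the given one. In its equations the source
  operations are therefore the primed ones here, and each \<open>r\<close> collects all terms except
  \<open>i\<close> applied to the new operation, with the sign that makes the equation
  \<open>\<partial> f = i \<lambda>' - r\<close>.\<close>

definition "r2 = l2 \<odot> [i, i]"
definition "l2' = p \<odot> [r2]"
definition "i2 = - (h \<odot> [r2])"

lemma r2_map: "mmap_on s' L' s L 2 0 r2"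
  unfolding r2_def by (intro closure) (simp_all add: maps del: One_nat_def)

lemma l2'_map [maps]: "mmap_on s' L' s' L' 2 0 l2'"
  and i2_map [maps]: "mmap_on s' L' s L 2 1 i2"
  using transfer_maps[OF r2_map] by (simp_all add: l2'_def i2_def)

lemma l2'_simps [simp]: "arity l2' = 2" "deg l2' = 0" "arity i2 = 2" "deg i2 = 1"
  using l2'_map i2_map by (simp_all add: mmap_on_def)

lemmas [elementwise] = r2_def SS.app_mem[OF l2'_map] SS.app_lin2[OF l2'_map]
  SL.app_mem[OF i2_map] SL.app_lin2[OF i2_map]

text \<open>The degree is left as \<open>0 - 1\<close> to match the form \<open>k - 1\<close> in the
  rules that use this fact; likewise for the later operations.\<close>

lemma bd_l2'_map: "mmap_on s' L' s' L' 2 (0 - 1)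
    (zero_mmap 2 (- 1))"
  by (simp add: SS.mmap_on_zero)

lemma bd_r2: "bd d' d r2 \<doteq>\<^bsub>L'\<^esub> i \<odot> [zero_mmap 2 (- 1)]"
proof (rule bd_eq2I[OF r2_map bd_l2'_map])
  fix a x b y
  assume xy: "x \<in> L' a" "y \<in> L' b"
    and "a \<in> {0, 1, 2}" "b \<in> {0, 1, 2}" "a + b + (0 - 1) \<in> {0, 1, 2}"
  \<comment> \<open>These are the input degrees for which the value can be nonzero.\<close>
  then have "(a, b) \<in>
     {(0, 1), (0, 2), (1, 0), (1, 1), (1, 2), (2, 0), (2, 1)}"
    by (elim insertE emptyE; simp)
  with xy show "app (bd d' d r2) [(a, x), (b, y)] =
      app i [(a + b + (0 - 1), app
       (zero_mmap 2 (- 1))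
       [(a, x), (b, y)])]"
    by (simp only: insert_iff empty_iff prod.inject; elim disjE conjE FalseE; hypsubst;
        simp add: elementwise algebra_simps)
qed

lemmas bd_l2' = transfer_bd[OF r2_map bd_l2'_map bd_r2, folded l2'_def]
lemmas bd_i2 = transfer_homotopy[OF r2_map bd_l2'_map bd_r2, folded l2'_def i2_def]
lemmas [elementwise] = bd_eqD2[OF bd_l2'] bd_eqD2[OF bd_i2]

definition "r3 = l3 \<odot> [i, i, i] + i2 \<circ>\<^bsub>2\<^esub> l2'
    - i2 \<circ>\<^bsub>1\<^esub> l2'
    - (i2 \<circ>\<^bsub>2\<^esub> l2')\<^bsup>cyc [1, 2]\<^esup> + l2 \<odot> [i, i2]
    - l2 \<odot> [i2, i] - (l2 \<odot> [i, i2])\<^bsup>cyc [1, 2]\<^esup>"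
definition "l3' = p \<odot> [r3]"
definition "i3 = - (h \<odot> [r3])"

lemma r3_map: "mmap_on s' L' s L 3 1 r3"
  unfolding r3_def by (intro closure) (simp_all add: maps del: One_nat_def)

lemma l3'_map [maps]: "mmap_on s' L' s' L' 3 1 l3'"
  and i3_map [maps]: "mmap_on s' L' s L 3 2 i3"
  using transfer_maps[OF r3_map] by (simp_all add: l3'_def i3_def)

lemma l3'_simps [simp]: "arity l3' = 3" "deg l3' = 1" "arity i3 = 3" "deg i3 = 2"
  using l3'_map i3_map by (simp_all add: mmap_on_def)

lemmas [elementwise] = r3_def SS.app_mem[OF l3'_map] SS.app_lin3[OF l3'_map]
  SL.app_mem[OF i3_map] SL.app_lin3[OF i3_map]

lemma bd_l3'_map: "mmap_on s' L' s' L' 3 (1 - 1)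
    (l2' \<circ>\<^bsub>2\<^esub> l2' - l2' \<circ>\<^bsub>1\<^esub> l2'
     - (l2' \<circ>\<^bsub>2\<^esub> l2')\<^bsup>cyc [1, 2]\<^esup>)"
  by (intro closure) (simp_all add: maps del: One_nat_def)

text \<open>Insert \<open>\<partial> i2 = i l2' - r2\<close>. Composing \<open>i2\<close> with
  \<open>l2'\<close> yields the right side and terms \<open>l2 (i, i l2')\<close>; the latter cancel
  against the boundaries of \<open>l2 \<odot> [i, i2]\<close> and its companions, whose
  \<open>l2 l2\<close> parts cancel the boundary of \<open>l3\<close>.\<close>

lemma bd_r3: "bd d' d r3 \<doteq>\<^bsub>L'\<^esub> i \<odot> [l2' \<circ>\<^bsub>2\<^esub> l2'
    - l2' \<circ>\<^bsub>1\<^esub> l2'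
    - (l2' \<circ>\<^bsub>2\<^esub> l2')\<^bsup>cyc [1, 2]\<^esup>]"
proof (rule bd_eq3I[OF r3_map bd_l3'_map])
  fix a x b y c z
  assume xy: "x \<in> L' a" "y \<in> L' b" "z \<in> L' c"
    and "a \<in> {0, 1, 2}" "b \<in> {0, 1, 2}" "c \<in> {0, 1, 2}" "a + b + c + (1 - 1) \<in> {0, 1, 2}"
  then have "(a, b, c) \<in>
     {(0, 0, 0), (0, 0, 1), (0, 0, 2), (0, 1, 0), (0, 1, 1), (0, 2, 0),
      (1, 0, 0), (1, 0, 1), (1, 1, 0), (2, 0, 0)}"
    by (elim insertE emptyE; simp)
  with xy show "app (bd d' d r3) [(a, x), (b, y), (c, z)] =
      app i [(a + b + c + (1 - 1), app
       (l2' \<circ>\<^bsub>2\<^esub> l2' - l2' \<circ>\<^bsub>1\<^esub> l2'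
        - (l2' \<circ>\<^bsub>2\<^esub> l2')\<^bsup>cyc [1, 2]\<^esup>)
       [(a, x), (b, y), (c, z)])]"
    by (simp only: insert_iff empty_iff prod.inject; elim disjE conjE FalseE; hypsubst;
        simp add: elementwise algebra_simps)
qed

lemmas bd_l3' = transfer_bd[OF r3_map bd_l3'_map bd_r3, folded l3'_def]
lemmas bd_i3 = transfer_homotopy[OF r3_map bd_l3'_map bd_r3, folded l3'_def i3_def]
lemmas [elementwise] = bd_eqD3[OF bd_l3'] bd_eqD3[OF bd_i3]

definition "r21 = l21 \<odot> [i, i] + i2 + i2\<^bsup>cyc [1, 2]\<^esup>"
definition "l21' = p \<odot> [r21]"
definition "i21 = - (h \<odot> [r21])"

lemma r21_map: "mmap_on s' L' s L 2 1 r21"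
  unfolding r21_def by (intro closure) (simp_all add: maps del: One_nat_def)

lemma l21'_map [maps]: "mmap_on s' L' s' L' 2 1 l21'"
  and i21_map [maps]: "mmap_on s' L' s L 2 2 i21"
  using transfer_maps[OF r21_map] by (simp_all add: l21'_def i21_def)

lemma l21'_simps [simp]: "arity l21' = 2" "deg l21' = 1" "arity i21 = 2" "deg i21 = 2"
  using l21'_map i21_map by (simp_all add: mmap_on_def)

lemmas [elementwise] = r21_def SS.app_mem[OF l21'_map] SS.app_lin2[OF l21'_map]
  SL.app_mem[OF i21_map] SL.app_lin2[OF i21_map]

lemma bd_l21'_map: "mmap_on s' L' s' L' 2 (1 - 1)
    (l2' + l2'\<^bsup>cyc [1, 2]\<^esup>)"
  by (intro closure) (simp_all add: maps del: One_nat_def)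

text \<open>The boundary of \<open>l21\<close> on \<open>(i, i)\<close> is \<open>r2\<close>
  symmetrized, which is what \<open>\<partial> i2 = i l2' - r2\<close> subtracts.\<close>

lemma bd_r21: "bd d' d r21 \<doteq>\<^bsub>L'\<^esub> i \<odot> [l2' + l2'\<^bsup>cyc [1, 2]\<^esup>]"
proof (rule bd_eq2I[OF r21_map bd_l21'_map])
  fix a x b y
  assume xy: "x \<in> L' a" "y \<in> L' b"
    and "a \<in> {0, 1, 2}" "b \<in> {0, 1, 2}" "a + b + (1 - 1) \<in> {0, 1, 2}"
  then have "(a, b) \<in>
     {(0, 0), (0, 1), (0, 2), (1, 0), (1, 1), (2, 0)}"
    by (elim insertE emptyE; simp)
  with xy show "app (bd d' d r21) [(a, x), (b, y)] =
      app i [(a + b + (1 - 1), app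
       (l2' + l2'\<^bsup>cyc [1, 2]\<^esup>)
       [(a, x), (b, y)])]"
    by (simp only: insert_iff empty_iff prod.inject; elim disjE conjE FalseE; hypsubst;
        simp add: elementwise algebra_simps)
qed

lemmas bd_l21' = transfer_bd[OF r21_map bd_l21'_map bd_r21, folded l21'_def]
lemmas bd_i21 = transfer_homotopy[OF r21_map bd_l21'_map bd_r21, folded l21'_def i21_def]
lemmas [elementwise] = bd_eqD2[OF bd_l21'] bd_eqD2[OF bd_i21]

text \<open>A morphism component of arity 4 would raise degree by 3 and is zero. So the arity 4
  equation contains no \<open>\<partial>\<close> and simply says \<open>i l4' = r4\<close>. The maps
  \<open>r211\<close>, \<open>r31\<close> and \<open>r32\<close> arise in the same way.\<close>

definition "r4 = l4 \<odot> [i, i, i, i] + i2 \<circ>\<^bsub>1\<^esub> l3'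
    + i2 \<circ>\<^bsub>2\<^esub> l3'
    - (i2 \<circ>\<^bsub>2\<^esub> l3')\<^bsup>cyc [1, 2]\<^esup>
    + (i2 \<circ>\<^bsub>2\<^esub> l3')\<^bsup>cyc [1, 2, 3]\<^esup>
    - i3 \<circ>\<^bsub>1\<^esub> l2' + i3 \<circ>\<^bsub>2\<^esub> l2'
    - (i3 \<circ>\<^bsub>2\<^esub> l2')\<^bsup>cyc [1, 2]\<^esup>
    - i3 \<circ>\<^bsub>3\<^esub> l2'
    + (i3 \<circ>\<^bsub>3\<^esub> l2')\<^bsup>cyc [2, 3]\<^esup>
    - (i3 \<circ>\<^bsub>3\<^esub> l2')\<^bsup>cyc [1, 3, 2]\<^esup> + l2 \<odot> [i3, i]
    + l2 \<odot> [i, i3] - (l2 \<odot> [i, i3])\<^bsup>cyc [1, 2]\<^esup>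
    + (l2 \<odot> [i, i3])\<^bsup>cyc [1, 2, 3]\<^esup> - l2 \<odot> [i2, i2]
    + (l2 \<odot> [i2, i2])\<^bsup>cyc [2, 3]\<^esup>
    - (l2 \<odot> [i2, i2])\<^bsup>cyc [1, 3, 2]\<^esup> + l3 \<odot> [i2, i, i]
    - l3 \<odot> [i, i2, i] + (l3 \<odot> [i, i2, i])\<^bsup>cyc [1, 2]\<^esup>
    + l3 \<odot> [i, i, i2] - (l3 \<odot> [i, i, i2])\<^bsup>cyc [2, 3]\<^esup>
    + (l3 \<odot> [i, i, i2])\<^bsup>cyc [1, 3, 2]\<^esup>"
definition "l4' = p \<odot> [r4]"

lemma r4_map: "mmap_on s' L' s L 4 2 r4"
  unfolding r4_def by (intro closure) (simp_all add: maps del: One_nat_def)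

lemma l4'_map [maps]: "mmap_on s' L' s' L' 4 2 l4'"
  using transfer_maps[OF r4_map] by (simp_all add: l4'_def)

lemma l4'_simps [simp]: "arity l4' = 4" "deg l4' = 2"
  using l4'_map by (simp_all add: mmap_on_def)

lemmas [elementwise] = r4_def SS.app_mem[OF l4'_map] SS.app_lin4[OF l4'_map]

lemma bd_l4'_map: "mmap_on s' L' s' L' 4 (2 - 1)
    (l2' \<circ>\<^bsub>1\<^esub> l3' + l2' \<circ>\<^bsub>2\<^esub> l3'
     - (l2' \<circ>\<^bsub>2\<^esub> l3')\<^bsup>cyc [1, 2]\<^esup>
     + (l2' \<circ>\<^bsub>2\<^esub> l3')\<^bsup>cyc [1, 2, 3]\<^esup>
     - l3' \<circ>\<^bsub>1\<^esub> l2' + l3' \<circ>\<^bsub>2\<^esub> l2'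
     - (l3' \<circ>\<^bsub>2\<^esub> l2')\<^bsup>cyc [1, 2]\<^esup>
     - l3' \<circ>\<^bsub>3\<^esub> l2'
     + (l3' \<circ>\<^bsub>3\<^esub> l2')\<^bsup>cyc [2, 3]\<^esup>
     - (l3' \<circ>\<^bsub>3\<^esub> l2')\<^bsup>cyc [1, 3, 2]\<^esup>)"
  by (intro closure) (simp_all add: maps del: One_nat_def)

text \<open>New compared with \<open>r3\<close> are the terms quadratic in \<open>i2\<close>. In the
  boundary of \<open>l2 \<odot> [i2, i2]\<close> the parts with \<open>i l2'\<close> cancel against
  \<open>r3\<close> composed with \<open>l2'\<close>, and those with \<open>l2 (i, i)\<close>
  against the boundary of \<open>l3\<close> with \<open>i2\<close> in one slot.\<close>

lemma bd_r4: "bd d' d r4 \<doteq>\<^bsub>L'\<^esub> i \<odot> [l2' \<circ>\<^bsub>1\<^esub> l3'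
    + l2' \<circ>\<^bsub>2\<^esub> l3'
    - (l2' \<circ>\<^bsub>2\<^esub> l3')\<^bsup>cyc [1, 2]\<^esup>
    + (l2' \<circ>\<^bsub>2\<^esub> l3')\<^bsup>cyc [1, 2, 3]\<^esup>
    - l3' \<circ>\<^bsub>1\<^esub> l2' + l3' \<circ>\<^bsub>2\<^esub> l2'
    - (l3' \<circ>\<^bsub>2\<^esub> l2')\<^bsup>cyc [1, 2]\<^esup>
    - l3' \<circ>\<^bsub>3\<^esub> l2'
    + (l3' \<circ>\<^bsub>3\<^esub> l2')\<^bsup>cyc [2, 3]\<^esup>
    - (l3' \<circ>\<^bsub>3\<^esub> l2')\<^bsup>cyc [1, 3, 2]\<^esup>]"
proof (rule bd_eq4I[OF r4_map bd_l4'_map])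
  fix a x b y c z e w
  assume xy: "x \<in> L' a" "y \<in> L' b" "z \<in> L' c" "w \<in> L' e"
    and "a \<in> {0, 1, 2}" "b \<in> {0, 1, 2}" "c \<in> {0, 1, 2}" "e \<in> {0, 1, 2}"
        "a + b + c + e + (2 - 1) \<in> {0, 1, 2}"
  then have "(a, b, c, e) \<in>
     {(0, 0, 0, 0), (0, 0, 0, 1), (0, 0, 1, 0), (0, 1, 0, 0), (1, 0, 0, 0)}"
    by (elim insertE emptyE; simp)
  with xy show "app (bd d' d r4) [(a, x), (b, y), (c, z), (e, w)] =
      app i [(a + b + c + e + (2 - 1), app
       (l2' \<circ>\<^bsub>1\<^esub> l3' + l2' \<circ>\<^bsub>2\<^esub> l3'
        - (l2' \<circ>\<^bsub>2\<^esub> l3')\<^bsup>cyc [1, 2]\<^esup>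
        + (l2' \<circ>\<^bsub>2\<^esub> l3')\<^bsup>cyc [1, 2, 3]\<^esup>
        - l3' \<circ>\<^bsub>1\<^esub> l2' + l3' \<circ>\<^bsub>2\<^esub> l2'
        - (l3' \<circ>\<^bsub>2\<^esub> l2')\<^bsup>cyc [1, 2]\<^esup>
        - l3' \<circ>\<^bsub>3\<^esub> l2'
        + (l3' \<circ>\<^bsub>3\<^esub> l2')\<^bsup>cyc [2, 3]\<^esup>
        - (l3' \<circ>\<^bsub>3\<^esub> l2')\<^bsup>cyc [1, 3, 2]\<^esup>)
       [(a, x), (b, y), (c, z), (e, w)])]"
    by (simp only: insert_iff empty_iff prod.inject; elim disjE conjE FalseE; hypsubst;
        simp add: elementwise algebra_simps)
qed

lemmas bd_l4' = transfer_bd[OF r4_map bd_l4'_map bd_r4, folded l4'_def]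
lemmas i_l4' = transfer_top[OF r4_map bd_l4'_map bd_r4 refl, folded l4'_def]
lemmas [elementwise] = bd_eqD4[OF bd_l4']

definition "r211 = l211 \<odot> [i, i] + i21 - i21\<^bsup>cyc [1, 2]\<^esup>"
definition "l211' = p \<odot> [r211]"

lemma r211_map: "mmap_on s' L' s L 2 2 r211"
  unfolding r211_def by (intro closure) (simp_all add: maps del: One_nat_def)

lemma l211'_map [maps]: "mmap_on s' L' s' L' 2 2 l211'"
  using transfer_maps[OF r211_map] by (simp_all add: l211'_def)

lemma l211'_simps [simp]: "arity l211' = 2" "deg l211' = 2"
  using l211'_map by (simp_all add: mmap_on_def)

lemmas [elementwise] = r211_def SS.app_mem[OF l211'_map] SS.app_lin2[OF l211'_map]

lemma bd_l211'_map: "mmap_on s' L' s' L' 2 (2 - 1)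
    (l21' - l21'\<^bsup>cyc [1, 2]\<^esup>)"
  by (intro closure) (simp_all add: maps del: One_nat_def)

text \<open>In \<open>\<partial> i21 = i l21' - r21\<close> the summand \<open>i2 + i2^(12)\<close>
  of \<open>r21\<close> is symmetric and drops out of the difference.\<close>

lemma bd_r211: "bd d' d r211 \<doteq>\<^bsub>L'\<^esub> i \<odot> [l21' - l21'\<^bsup>cyc [1, 2]\<^esup>]"
proof (rule bd_eq2I[OF r211_map bd_l211'_map])
  fix a x b y
  assume xy: "x \<in> L' a" "y \<in> L' b"
    and "a \<in> {0, 1, 2}" "b \<in> {0, 1, 2}" "a + b + (2 - 1) \<in> {0, 1, 2}"
  then have "(a, b) \<in>
     {(0, 0), (0, 1), (1, 0)}"
    by (elim insertE emptyE; simp)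
  with xy show "app (bd d' d r211) [(a, x), (b, y)] =
      app i [(a + b + (2 - 1), app
       (l21' - l21'\<^bsup>cyc [1, 2]\<^esup>)
       [(a, x), (b, y)])]"
    by (simp only: insert_iff empty_iff prod.inject; elim disjE conjE FalseE; hypsubst;
        simp add: elementwise algebra_simps)
qed

lemmas bd_l211' = transfer_bd[OF r211_map bd_l211'_map bd_r211, folded l211'_def]
lemmas i_l211' = transfer_top[OF r211_map bd_l211'_map bd_r211 refl, folded l211'_def]
lemmas [elementwise] = bd_eqD2[OF bd_l211']

definition "r31 = l31 \<odot> [i, i, i] + i3 + i3\<^bsup>cyc [1, 2]\<^esup>
    + i2 \<circ>\<^bsub>1\<^esub> l21' + l2 \<odot> [i21, i]"
definition "l31' = p \<odot> [r31]"

lemma r31_map: "mmap_on s' L' s L 3 2 r31"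
  unfolding r31_def by (intro closure) (simp_all add: maps del: One_nat_def)

lemma l31'_map [maps]: "mmap_on s' L' s' L' 3 2 l31'"
  using transfer_maps[OF r31_map] by (simp_all add: l31'_def)

lemma l31'_simps [simp]: "arity l31' = 3" "deg l31' = 2"
  using l31'_map by (simp_all add: mmap_on_def)

lemmas [elementwise] = r31_def SS.app_mem[OF l31'_map] SS.app_lin3[OF l31'_map]

lemma bd_l31'_map: "mmap_on s' L' s' L' 3 (2 - 1)
    (l3' + l3'\<^bsup>cyc [1, 2]\<^esup> + l2' \<circ>\<^bsub>1\<^esub> l21')"
  by (intro closure) (simp_all add: maps del: One_nat_def)

text \<open>Symmetrizing \<open>r3\<close> in its first two inputs leaves, besides
  \<open>l3\<close>, the map \<open>i2\<close> on \<open>l2' + l2'^(12)\<close>, which is matched by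
  the boundary of \<open>l21'\<close>, and \<open>l2\<close> on \<open>i2 + i2^(12)\<close>, which
  is matched by the same summand of \<open>r21\<close>.\<close>

lemma bd_r31: "bd d' d r31 \<doteq>\<^bsub>L'\<^esub> i \<odot> [l3' + l3'\<^bsup>cyc [1, 2]\<^esup>
    + l2' \<circ>\<^bsub>1\<^esub> l21']"
proof (rule bd_eq3I[OF r31_map bd_l31'_map])
  fix a x b y c z
  assume xy: "x \<in> L' a" "y \<in> L' b" "z \<in> L' c"
    and "a \<in> {0, 1, 2}" "b \<in> {0, 1, 2}" "c \<in> {0, 1, 2}" "a + b + c + (2 - 1) \<in> {0, 1, 2}"
  then have "(a, b, c) \<in>
     {(0, 0, 0), (0, 0, 1), (0, 1, 0), (1, 0, 0)}"
    by (elim insertE emptyE; simp)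
  with xy show "app (bd d' d r31) [(a, x), (b, y), (c, z)] =
      app i [(a + b + c + (2 - 1), app
       (l3' + l3'\<^bsup>cyc [1, 2]\<^esup> + l2' \<circ>\<^bsub>1\<^esub> l21')
       [(a, x), (b, y), (c, z)])]"
    by (simp only: insert_iff empty_iff prod.inject; elim disjE conjE FalseE; hypsubst;
        simp add: elementwise algebra_simps)
qed

lemmas bd_l31' = transfer_bd[OF r31_map bd_l31'_map bd_r31, folded l31'_def]
lemmas i_l31' = transfer_top[OF r31_map bd_l31'_map bd_r31 refl, folded l31'_def]
lemmas [elementwise] = bd_eqD3[OF bd_l31']

definition "r32 = l32 \<odot> [i, i, i] + i3 + i3\<^bsup>cyc [2, 3]\<^esup>
    - i2 \<circ>\<^bsub>2\<^esub> l21' + i21 \<circ>\<^bsub>1\<^esub> l2'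
    + (i21 \<circ>\<^bsub>2\<^esub> l2')\<^bsup>cyc [1, 2]\<^esup> - l2 \<odot> [i, i21]
    - l21 \<odot> [i2, i] - (l21 \<odot> [i, i2])\<^bsup>cyc [1, 2]\<^esup>"
definition "l32' = p \<odot> [r32]"

lemma r32_map: "mmap_on s' L' s L 3 2 r32"
  unfolding r32_def by (intro closure) (simp_all add: maps del: One_nat_def)

lemma l32'_map [maps]: "mmap_on s' L' s' L' 3 2 l32'"
  using transfer_maps[OF r32_map] by (simp_all add: l32'_def)

lemma l32'_simps [simp]: "arity l32' = 3" "deg l32' = 2"
  using l32'_map by (simp_all add: mmap_on_def)

lemmas [elementwise] = r32_def SS.app_mem[OF l32'_map] SS.app_lin3[OF l32'_map]

lemma bd_l32'_map: "mmap_on s' L' s' L' 3 (2 - 1)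
    (l3' + l3'\<^bsup>cyc [2, 3]\<^esup> - l2' \<circ>\<^bsub>2\<^esub> l21'
     + l21' \<circ>\<^bsub>1\<^esub> l2'
     + (l21' \<circ>\<^bsub>2\<^esub> l2')\<^bsup>cyc [1, 2]\<^esup>)"
  by (intro closure) (simp_all add: maps del: One_nat_def)

text \<open>Composing \<open>r21\<close> with \<open>l2'\<close> produces \<open>l21\<close> on
  \<open>i l2'\<close>. The terms with \<open>l21\<close> on \<open>i2\<close> trade this for
  \<open>l21\<close> on \<open>l2 (i, i)\<close>, which cancels against the boundary of
  \<open>l32\<close>.\<close>

lemma bd_r32: "bd d' d r32 \<doteq>\<^bsub>L'\<^esub> i \<odot> [l3' + l3'\<^bsup>cyc [2, 3]\<^esup>
    - l2' \<circ>\<^bsub>2\<^esub> l21' + l21' \<circ>\<^bsub>1\<^esub> l2'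
    + (l21' \<circ>\<^bsub>2\<^esub> l2')\<^bsup>cyc [1, 2]\<^esup>]"
proof (rule bd_eq3I[OF r32_map bd_l32'_map])
  fix a x b y c z
  assume xy: "x \<in> L' a" "y \<in> L' b" "z \<in> L' c"
    and "a \<in> {0, 1, 2}" "b \<in> {0, 1, 2}" "c \<in> {0, 1, 2}" "a + b + c + (2 - 1) \<in> {0, 1, 2}"
  then have "(a, b, c) \<in>
     {(0, 0, 0), (0, 0, 1), (0, 1, 0), (1, 0, 0)}"
    by (elim insertE emptyE; simp)
  with xy show "app (bd d' d r32) [(a, x), (b, y), (c, z)] =
      app i [(a + b + c + (2 - 1), app
       (l3' + l3'\<^bsup>cyc [2, 3]\<^esup> - l2' \<circ>\<^bsub>2\<^esub> l21'
        + l21' \<circ>\<^bsub>1\<^esub> l2'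
        + (l21' \<circ>\<^bsub>2\<^esub> l2')\<^bsup>cyc [1, 2]\<^esup>)
       [(a, x), (b, y), (c, z)])]"
    by (simp only: insert_iff empty_iff prod.inject; elim disjE conjE FalseE; hypsubst;
        simp add: elementwise algebra_simps)
qed

lemmas bd_l32' = transfer_bd[OF r32_map bd_l32'_map bd_r32, folded l32'_def]
lemmas i_l32' = transfer_top[OF r32_map bd_l32'_map bd_r32 refl, folded l32'_def]
lemmas [elementwise] = bd_eqD3[OF bd_l32']

section \<open>Identities in degree 2\<close>

lemma top_eval:
  assumes "i \<odot> [\<mu>] \<doteq>\<^bsub>L'\<^esub> R" "vs \<in> homs L' (arity \<mu>)" "n = tdeg vs + deg \<mu>"
  shows "app i [(n, app \<mu> vs)] = app R vs"
  using assms by (auto simp: eq_on_def val_def length_homs dest!: bspec[where x = vs])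

lemmas top_evals = top_eval[OF i_l4'] top_eval[OF i_l211'] top_eval[OF i_l31'] top_eval[OF i_l32']

text \<open>\<open>T\<close> equals zero, yet naming it matters: the expansion of \<open>d T\<close>
  by the boundary equations is a relation among elements of degree 2 that the axiom for
  \<open>L\<close> alone does not provide.\<close>

lemma eq_on_top:
  assumes A: "mmap_on s' L' s' L' n 2 A" and B: "mmap_on s' L' s' L' n 2 B"
    and ax: "\<alpha> \<doteq>\<^bsub>L\<^esub> \<beta>" "arity \<alpha> = n"
    and key: "\<And>xs. length xs = n \<Longrightarrow> set xs \<subseteq> L' 0 \<Longrightarrow> \<exists>T \<in> L 3.
      app i [(2, app A (map (Pair 0) xs))] - app i [(2, app B (map (Pair 0) xs))] =
      app \<alpha> (map (\<lambda>x. (0, app i [(0, x)])) xs) - app \<beta> (map (\<lambda>x. (0, app i [(0, x)])) xs)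
      + app d [(3, T)]"
  shows "A \<doteq>\<^bsub>L'\<^esub> B"
proof (rule SS.eq_onI[OF A B small.concentrated small.concentrated])
  fix vs assume vs: "vs \<in> homs L' n"
    and deg: "fst ` set vs \<subseteq> {0, 1, 2}" "tdeg vs + 2 \<in> {0, 1, 2}"
  note t = tdeg_zeroD[OF deg]
  define xs where "xs = map snd vs"
  define ys where "ys = map (\<lambda>x. (0 :: int, app i [(0, x)])) xs"
  have vs_eq: "vs = map (Pair 0) xs"
    unfolding xs_def map_map by (rule map_idI[symmetric]) (use t(2) in \<open>auto simp: prod_eq_iff\<close>)
  have xs: "length xs = n" "set xs \<subseteq> L' 0"
    using vs t(2) by (fastforce simp: xs_def homs_def)+
  obtain T where T: "T \<in> L 3" and eq: "app i [(2, app A vs)] - app i [(2, app B vs)] =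
      app \<alpha> ys - app \<beta> ys + app d [(3, T)]"
    using key[OF xs] unfolding vs_eq ys_def by blast
  have "app i [(0, x)] \<in> L 0" if "x \<in> L' 0" for x
    using SL.app_mem[OF i_map, of "[(0, x)]" 0] that by simp
  then have "ys \<in> homs L n"
    using xs by (auto simp: ys_def homs_def subset_iff)
  then have "app \<alpha> ys = app \<beta> ys"
    using ax unfolding eq_on_def by blast
  moreover have "app d [(3, T)] = 0"
    using T big.concentrated[of 3] LL.app_lin1(4)[OF d_map] by simp
  ultimately have eq': "app i [(2, app A vs)] = app i [(2, app B vs)]" using eq by simp
  have "app A vs \<in> L' 2" "app B vs \<in> L' 2"
    using mmap_on_app[OF A vs] mmap_on_app[OF B vs] by (simp_all add: t(1))
  then show "app A vs = app B vs"
    using arg_cong[OF eq', of "\<lambda>u. app p [(2, u)]"] by (simp only: p_i)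
qed

text \<open>
  The elements \<open>?T\<close> below come from the terms that the morphism equations would have in the next degree;
  for \<open>l_5'\<close> they are those of the arity 5 equation of a morphism of Leibniz infinity-algebras.
\<close>

lemma l211_skew': "l211' + l211'\<^bsup>cyc [1, 2]\<^esup> \<doteq>\<^bsub>L'\<^esub>
    zero_mmap 2 2" (is "?A \<doteq>\<^bsub>L'\<^esub> ?B")
proof (rule eq_on_top[OF _ _ l211_skew])
  show "mmap_on s' L' s' L' 2 2 (?A)" "mmap_on s' L' s' L' 2 2 (?B)"
    by ((intro closure)?; simp add: maps SS.mmap_on_zero del: One_nat_def)+
next
  fix xs assume xs: "length xs = 2" "set xs \<subseteq> L' 0"
  then obtain x y where eq: "xs = [x, y]"
    by (auto simp: length_Suc_conv numeral_eq_Suc)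
  have mem: "x \<in> L' 0" "y \<in> L' 0" using xs by (auto simp: eq)
  \<comment> \<open>\<open>i21 - i21^(12)\<close> is already antisymmetric, so no correction
    arises.\<close>
  let ?T = "0"
  have "?T \<in> L 3"
    by ((intro big.add_mem big.diff_mem big.minus_mem)?; use mem in \<open>simp add: elementwise\<close>)
  then show "\<exists>T \<in> L 3. app i [(2, app ?A (map (Pair 0) xs))] - app i [(2, app ?B (map (Pair 0) xs))] =
      app (l211 + l211\<^bsup>cyc [1, 2]\<^esup>)
        (map (\<lambda>x. (0, app i [(0, x)])) xs) -
      app (zero_mmap 2 2)
        (map (\<lambda>x. (0, app i [(0, x)])) xs) + app d [(3, T)]"
    by (rule bexI[rotated]) (use mem in \<open>simp add: eq elementwise top_evals algebra_simps\<close>)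
qed simp

lemma l31_skew': "l31' - l31'\<^bsup>cyc [1, 2]\<^esup> \<doteq>\<^bsub>L'\<^esub>
    l2' \<circ>\<^bsub>1\<^esub> l211'" (is "?A \<doteq>\<^bsub>L'\<^esub> ?B")
proof (rule eq_on_top[OF _ _ l31_skew])
  show "mmap_on s' L' s' L' 3 2 (?A)" "mmap_on s' L' s' L' 3 2 (?B)"
    by ((intro closure)?; simp add: maps SS.mmap_on_zero del: One_nat_def)+
next
  fix xs assume xs: "length xs = 3" "set xs \<subseteq> L' 0"
  then obtain x y z where eq: "xs = [x, y, z]"
    by (auto simp: length_Suc_conv numeral_eq_Suc)
  have mem: "x \<in> L' 0" "y \<in> L' 0" "z \<in> L' 0" using xs by (auto simp: eq)
  \<comment> \<open>By \<open>\<partial> i2 = i l2' - r2\<close> this trades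
    \<open>i l2' (l211', z)\<close> for \<open>l2 (i l211', i z)\<close>; the term with
    \<open>d' l211'\<close> is the antisymmetrized \<open>i2\<close> term of
    \<open>r31\<close>.\<close>
  let ?T = "- app i2 [val l211' [(0, x), (0, y)], (0, z)]"
  have "?T \<in> L 3"
    by ((intro big.add_mem big.diff_mem big.minus_mem)?; use mem in \<open>simp add: elementwise\<close>)
  then show "\<exists>T \<in> L 3. app i [(2, app ?A (map (Pair 0) xs))] - app i [(2, app ?B (map (Pair 0) xs))] =
      app (l31 - l31\<^bsup>cyc [1, 2]\<^esup>)
        (map (\<lambda>x. (0, app i [(0, x)])) xs) -
      app (l2 \<circ>\<^bsub>1\<^esub> l211)
        (map (\<lambda>x. (0, app i [(0, x)])) xs) + app d [(3, T)]"
    by (rule bexI[rotated]) (use mem in \<open>simp add: eq elementwise top_evals algebra_simps\<close>)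
qed simp

lemma l31_l32': "l31' - l32'\<^bsup>cyc [1, 2]\<^esup> + l31'\<^bsup>cyc [1, 3, 2]\<^esup> - l32'
    + l31'\<^bsup>cyc [2, 3]\<^esup> - l32'\<^bsup>cyc [1, 2, 3]\<^esup> \<doteq>\<^bsub>L'\<^esub>
    l21' \<circ>\<^bsub>2\<^esub> l21' + l21' \<circ>\<^bsub>1\<^esub> l21'
    + (l21' \<circ>\<^bsub>2\<^esub> l21')\<^bsup>cyc [1, 2]\<^esup>
    + (l211' \<circ>\<^bsub>2\<^esub> l2')\<^bsup>cyc [1, 3, 2]\<^esup>" (is "?A \<doteq>\<^bsub>L'\<^esub> ?B")
proof (rule eq_on_top[OF _ _ l31_l32])
  show "mmap_on s' L' s' L' 3 2 (?A)" "mmap_on s' L' s' L' 3 2 (?B)"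
    by ((intro closure)?; simp add: maps SS.mmap_on_zero del: One_nat_def)+
next
  fix xs assume xs: "length xs = 3" "set xs \<subseteq> L' 0"
  then obtain x y z where eq: "xs = [x, y, z]"
    by (auto simp: length_Suc_conv numeral_eq_Suc)
  have mem: "x \<in> L' 0" "y \<in> L' 0" "z \<in> L' 0" using xs by (auto simp: eq)
  \<comment> \<open>The \<open>i21\<close> terms trade each outer \<open>l21'\<close> for
    \<open>r21\<close>, the \<open>l21\<close> terms do the same for the inner \<open>l21'\<close>,
    and the \<open>l211\<close> term replaces \<open>i l2'\<close> by \<open>l2 (i, i)\<close>
    inside \<open>l211\<close>.\<close>
  let ?T = "app l21 [val i21 [(0, x), (0, y)], val i [(0, z)]]
      + app l21 [val i [(0, y)], val i21 [(0, x), (0, z)]]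
      + app l21 [val i [(0, x)], val i21 [(0, y), (0, z)]]
      - app l211 [val i [(0, y)], val i2 [(0, z), (0, x)]]
      - app i21 [(0, y), val l21' [(0, x), (0, z)]] - app i21 [(0, x), val l21' [(0, y), (0, z)]]
      - app i21 [val l21' [(0, x), (0, y)], (0, z)]"
  have "?T \<in> L 3"
    by ((intro big.add_mem big.diff_mem big.minus_mem)?; use mem in \<open>simp add: elementwise\<close>)
  then show "\<exists>T \<in> L 3. app i [(2, app ?A (map (Pair 0) xs))] - app i [(2, app ?B (map (Pair 0) xs))] =
      app (l31 - l32\<^bsup>cyc [1, 2]\<^esup> + l31\<^bsup>cyc [1, 3, 2]\<^esup> - l32
        + l31\<^bsup>cyc [2, 3]\<^esup> - l32\<^bsup>cyc [1, 2, 3]\<^esup>)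
        (map (\<lambda>x. (0, app i [(0, x)])) xs) -
      app (l21 \<circ>\<^bsub>2\<^esub> l21 + l21 \<circ>\<^bsub>1\<^esub> l21
        + (l21 \<circ>\<^bsub>2\<^esub> l21)\<^bsup>cyc [1, 2]\<^esup>
        + (l211 \<circ>\<^bsub>2\<^esub> l2)\<^bsup>cyc [1, 3, 2]\<^esup>)
        (map (\<lambda>x. (0, app i [(0, x)])) xs) + app d [(3, T)]"
    by (rule bexI[rotated]) (use mem in \<open>simp add: eq elementwise top_evals algebra_simps\<close>)
qed simp

lemma l32_skew': "l32' - l32'\<^bsup>cyc [2, 3]\<^esup> \<doteq>\<^bsub>L'\<^esub>
    - (l2' \<circ>\<^bsub>2\<^esub> l211') + l211' \<circ>\<^bsub>1\<^esub> l2'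
    + (l211' \<circ>\<^bsub>2\<^esub> l2')\<^bsup>cyc [1, 2]\<^esup>" (is "?A \<doteq>\<^bsub>L'\<^esub> ?B")
proof (rule eq_on_top[OF _ _ l32_skew])
  show "mmap_on s' L' s' L' 3 2 (?A)" "mmap_on s' L' s' L' 3 2 (?B)"
    by ((intro closure)?; simp add: maps SS.mmap_on_zero del: One_nat_def)+
next
  fix xs assume xs: "length xs = 3" "set xs \<subseteq> L' 0"
  then obtain x y z where eq: "xs = [x, y, z]"
    by (auto simp: length_Suc_conv numeral_eq_Suc)
  have mem: "x \<in> L' 0" "y \<in> L' 0" "z \<in> L' 0" using xs by (auto simp: eq)
  \<comment> \<open>The \<open>i2\<close> term handles the outer \<open>l2'\<close> over
    \<open>l211'\<close>, the \<open>l211\<close> terms the inner \<open>l2'\<close>.\<close>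
  let ?T = "app i2 [(0, x), val l211' [(0, y), (0, z)]]
      - app l211 [val i2 [(0, x), (0, y)], val i [(0, z)]]
      - app l211 [val i [(0, y)], val i2 [(0, x), (0, z)]]"
  have "?T \<in> L 3"
    by ((intro big.add_mem big.diff_mem big.minus_mem)?; use mem in \<open>simp add: elementwise\<close>)
  then show "\<exists>T \<in> L 3. app i [(2, app ?A (map (Pair 0) xs))] - app i [(2, app ?B (map (Pair 0) xs))] =
      app (l32 - l32\<^bsup>cyc [2, 3]\<^esup>)
        (map (\<lambda>x. (0, app i [(0, x)])) xs) -
      app (- (l2 \<circ>\<^bsub>2\<^esub> l211) + l211 \<circ>\<^bsub>1\<^esub> l2
        + (l211 \<circ>\<^bsub>2\<^esub> l2)\<^bsup>cyc [1, 2]\<^esup>)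
        (map (\<lambda>x. (0, app i [(0, x)])) xs) + app d [(3, T)]"
    by (rule bexI[rotated]) (use mem in \<open>simp add: eq elementwise top_evals algebra_simps\<close>)
qed simp

lemma l4_12': "l4' + l4'\<^bsup>cyc [1, 2]\<^esup> \<doteq>\<^bsub>L'\<^esub>
    l2' \<circ>\<^bsub>1\<^esub> l31' - l31' \<circ>\<^bsub>3\<^esub> l2'
    + (l2' \<circ>\<^bsub>2\<^esub> l31')\<^bsup>cyc [1, 2, 3]\<^esup>
    + l3' \<circ>\<^bsub>1\<^esub> l21'" (is "?A \<doteq>\<^bsub>L'\<^esub> ?B")
proof (rule eq_on_top[OF _ _ l4_12])
  show "mmap_on s' L' s' L' 4 2 (?A)" "mmap_on s' L' s' L' 4 2 (?B)"
    by ((intro closure)?; simp add: maps SS.mmap_on_zero del: One_nat_def)+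
next
  fix xs assume xs: "length xs = 4" "set xs \<subseteq> L' 0"
  then obtain x y z w where eq: "xs = [x, y, z, w]"
    by (auto simp: length_Suc_conv numeral_eq_Suc)
  have mem: "x \<in> L' 0" "y \<in> L' 0" "z \<in> L' 0" "w \<in> L' 0" using xs by (auto simp: eq)
  \<comment> \<open>The last three terms trade the outer \<open>l3'\<close> and \<open>l2'\<close>
    on the right side. The first three handle what is then left inside: \<open>i l2'\<close> under
    \<open>l31\<close>, and \<open>i l21'\<close> in the terms of \<open>r3\<close>.\<close>
  let ?T = "app l31 [val i [(0, x)], val i [(0, y)], val i2 [(0, z), (0, w)]]
      + app l3 [val i21 [(0, x), (0, y)], val i [(0, z)], val i [(0, w)]]
      + app l2 [val i21 [(0, x), (0, y)], val i2 [(0, z), (0, w)]]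
      - app i3 [val l21' [(0, x), (0, y)], (0, z), (0, w)]
      - app i2 [val l31' [(0, x), (0, y), (0, z)], (0, w)]
      - app i2 [(0, z), val l31' [(0, x), (0, y), (0, w)]]"
  have "?T \<in> L 3"
    by ((intro big.add_mem big.diff_mem big.minus_mem)?; use mem in \<open>simp add: elementwise\<close>)
  then show "\<exists>T \<in> L 3. app i [(2, app ?A (map (Pair 0) xs))] - app i [(2, app ?B (map (Pair 0) xs))] =
      app (l4 + l4\<^bsup>cyc [1, 2]\<^esup>)
        (map (\<lambda>x. (0, app i [(0, x)])) xs) -
      app (l2 \<circ>\<^bsub>1\<^esub> l31 - l31 \<circ>\<^bsub>3\<^esub> l2
        + (l2 \<circ>\<^bsub>2\<^esub> l31)\<^bsup>cyc [1, 2, 3]\<^esup>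
        + l3 \<circ>\<^bsub>1\<^esub> l21)
        (map (\<lambda>x. (0, app i [(0, x)])) xs) + app d [(3, T)]"
    by (rule bexI[rotated]) (use mem in \<open>simp add: eq elementwise top_evals algebra_simps\<close>)
qed simp

lemma l4_23': "l4' + l4'\<^bsup>cyc [2, 3]\<^esup> \<doteq>\<^bsub>L'\<^esub>
    l2' \<circ>\<^bsub>1\<^esub> l32' - l3' \<circ>\<^bsub>2\<^esub> l21'
    + l2' \<circ>\<^bsub>2\<^esub> l31' - l31' \<circ>\<^bsub>1\<^esub> l2'
    - (l31' \<circ>\<^bsub>2\<^esub> l2')\<^bsup>cyc [1, 2]\<^esup>
    - (l31' \<circ>\<^bsub>3\<^esub> l2')\<^bsup>cyc [1, 3, 2]\<^esup>" (is "?A \<doteq>\<^bsub>L'\<^esub> ?B")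
proof (rule eq_on_top[OF _ _ l4_23])
  show "mmap_on s' L' s' L' 4 2 (?A)" "mmap_on s' L' s' L' 4 2 (?B)"
    by ((intro closure)?; simp add: maps SS.mmap_on_zero del: One_nat_def)+
next
  fix xs assume xs: "length xs = 4" "set xs \<subseteq> L' 0"
  then obtain x y z w where eq: "xs = [x, y, z, w]"
    by (auto simp: length_Suc_conv numeral_eq_Suc)
  have mem: "x \<in> L' 0" "y \<in> L' 0" "z \<in> L' 0" "w \<in> L' 0" using xs by (auto simp: eq)
  \<comment> \<open>The \<open>l31\<close> terms trade \<open>i l2'\<close> inside
    \<open>l31\<close>. The terms with outer \<open>i3\<close> and \<open>i2\<close> trade the outer
    \<open>l3'\<close> and \<open>l2'\<close>, and those with \<open>i21\<close> the
    \<open>i l21'\<close> remaining inside \<open>r3\<close>.\<close>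
  let ?T = "app l31 [val i2 [(0, x), (0, y)], val i [(0, z)], val i [(0, w)]]
      + app l31 [val i [(0, y)], val i2 [(0, x), (0, z)], val i [(0, w)]]
      + app l31 [val i [(0, y)], val i [(0, z)], val i2 [(0, x), (0, w)]]
      + app i3 [(0, x), val l21' [(0, y), (0, z)], (0, w)]
      + app l2 [val i21 [(0, y), (0, z)], val i2 [(0, x), (0, w)]]
      - app l3 [val i [(0, x)], val i21 [(0, y), (0, z)], val i [(0, w)]]
      - app i2 [val l32' [(0, x), (0, y), (0, z)], (0, w)]
      - app i2 [(0, x), val l31' [(0, y), (0, z), (0, w)]]"
  have "?T \<in> L 3"
    by ((intro big.add_mem big.diff_mem big.minus_mem)?; use mem in \<open>simp add: elementwise\<close>)
  then show "\<exists>T \<in> L 3. app i [(2, app ?A (map (Pair 0) xs))] - app i [(2, app ?B (map (Pair 0) xs))] =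
      app (l4 + l4\<^bsup>cyc [2, 3]\<^esup>)
        (map (\<lambda>x. (0, app i [(0, x)])) xs) -
      app (l2 \<circ>\<^bsub>1\<^esub> l32 - l3 \<circ>\<^bsub>2\<^esub> l21
        + l2 \<circ>\<^bsub>2\<^esub> l31 - l31 \<circ>\<^bsub>1\<^esub> l2
        - (l31 \<circ>\<^bsub>2\<^esub> l2)\<^bsup>cyc [1, 2]\<^esup>
        - (l31 \<circ>\<^bsub>3\<^esub> l2)\<^bsup>cyc [1, 3, 2]\<^esup>)
        (map (\<lambda>x. (0, app i [(0, x)])) xs) + app d [(3, T)]"
    by (rule bexI[rotated]) (use mem in \<open>simp add: eq elementwise top_evals algebra_simps\<close>)
qed simp

lemma l4_34': "l4' + l4'\<^bsup>cyc [3, 4]\<^esup> \<doteq>\<^bsub>L'\<^esub>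
    l21' \<circ>\<^bsub>1\<^esub> l3' - l32' \<circ>\<^bsub>1\<^esub> l2'
    + l32' \<circ>\<^bsub>2\<^esub> l2'
    - (l32' \<circ>\<^bsub>2\<^esub> l2')\<^bsup>cyc [1, 2]\<^esup>
    + l3' \<circ>\<^bsub>3\<^esub> l21'
    + (l32' \<circ>\<^bsub>3\<^esub> l2')\<^bsup>cyc [2, 3]\<^esup>
    - (l32' \<circ>\<^bsub>3\<^esub> l2')\<^bsup>cyc [1, 3, 2]\<^esup>
    + l2' \<circ>\<^bsub>2\<^esub> l32'
    - (l2' \<circ>\<^bsub>2\<^esub> l32')\<^bsup>cyc [1, 2]\<^esup>
    + (l21' \<circ>\<^bsub>2\<^esub> l3')\<^bsup>cyc [1, 2, 3]\<^esup>" (is "?A \<doteq>\<^bsub>L'\<^esub> ?B")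
proof (rule eq_on_top[OF _ _ l4_34])
  show "mmap_on s' L' s' L' 4 2 (?A)" "mmap_on s' L' s' L' 4 2 (?B)"
    by ((intro closure)?; simp add: maps SS.mmap_on_zero del: One_nat_def)+
next
  fix xs assume xs: "length xs = 4" "set xs \<subseteq> L' 0"
  then obtain x y z w where eq: "xs = [x, y, z, w]"
    by (auto simp: length_Suc_conv numeral_eq_Suc)
  have mem: "x \<in> L' 0" "y \<in> L' 0" "z \<in> L' 0" "w \<in> L' 0" using xs by (auto simp: eq)
  \<comment> \<open>The terms with outer \<open>i2\<close>, \<open>i3\<close> and \<open>i21\<close>
    trade outer primed operations. The \<open>l32\<close> terms trade \<open>i l2'\<close>, and
    \<open>l21\<close> on \<open>i3\<close> trades the \<open>i l3'\<close> left by
    \<open>r21\<close>; \<open>l21\<close> on two copies of \<open>i2\<close> belongs to the part of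
    \<open>r3\<close> quadratic in \<open>l2\<close> and \<open>i2\<close>.\<close>
  let ?T = "app l32 [val i2 [(0, x), (0, y)], val i [(0, z)], val i [(0, w)]]
      + app l32 [val i [(0, y)], val i2 [(0, x), (0, z)], val i [(0, w)]]
      + app l32 [val i [(0, y)], val i [(0, z)], val i2 [(0, x), (0, w)]]
      + app l3 [val i [(0, x)], val i [(0, y)], val i21 [(0, z), (0, w)]]
      + app l21 [val i3 [(0, x), (0, y), (0, z)], val i [(0, w)]]
      + app l21 [val i2 [(0, x), (0, z)], val i2 [(0, y), (0, w)]]
      + app l21 [val i [(0, z)], val i3 [(0, x), (0, y), (0, w)]]
      + app i2 [(0, y), val l32' [(0, x), (0, z), (0, w)]]
      - app l32 [val i [(0, x)], val i2 [(0, y), (0, z)], val i [(0, w)]]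
      - app l32 [val i [(0, x)], val i [(0, z)], val i2 [(0, y), (0, w)]]
      - app i3 [(0, x), (0, y), val l21' [(0, z), (0, w)]]
      - app l21 [val i2 [(0, y), (0, z)], val i2 [(0, x), (0, w)]]
      - app i21 [(0, z), val l3' [(0, x), (0, y), (0, w)]]
      - app i21 [val l3' [(0, x), (0, y), (0, z)], (0, w)]
      - app l2 [val i2 [(0, x), (0, y)], val i21 [(0, z), (0, w)]]
      - app i2 [(0, x), val l32' [(0, y), (0, z), (0, w)]]"
  have "?T \<in> L 3"
    by ((intro big.add_mem big.diff_mem big.minus_mem)?; use mem in \<open>simp add: elementwise\<close>)
  then show "\<exists>T \<in> L 3. app i [(2, app ?A (map (Pair 0) xs))] - app i [(2, app ?B (map (Pair 0) xs))] =
      app (l4 + l4\<^bsup>cyc [3, 4]\<^esup>)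
        (map (\<lambda>x. (0, app i [(0, x)])) xs) -
      app (l21 \<circ>\<^bsub>1\<^esub> l3 - l32 \<circ>\<^bsub>1\<^esub> l2
        + l32 \<circ>\<^bsub>2\<^esub> l2
        - (l32 \<circ>\<^bsub>2\<^esub> l2)\<^bsup>cyc [1, 2]\<^esup>
        + l3 \<circ>\<^bsub>3\<^esub> l21
        + (l32 \<circ>\<^bsub>3\<^esub> l2)\<^bsup>cyc [2, 3]\<^esup>
        - (l32 \<circ>\<^bsub>3\<^esub> l2)\<^bsup>cyc [1, 3, 2]\<^esup>
        + l2 \<circ>\<^bsub>2\<^esub> l32
        - (l2 \<circ>\<^bsub>2\<^esub> l32)\<^bsup>cyc [1, 2]\<^esup>
        + (l21 \<circ>\<^bsub>2\<^esub> l3)\<^bsup>cyc [1, 2, 3]\<^esup>)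
        (map (\<lambda>x. (0, app i [(0, x)])) xs) + app d [(3, T)]"
    by (rule bexI[rotated]) (use mem in \<open>simp add: eq elementwise top_evals algebra_simps\<close>)
qed simp

lemma l_5': "zero_mmap 5 2 \<doteq>\<^bsub>L'\<^esub>
    l2' \<circ>\<^bsub>1\<^esub> l4' - l2' \<circ>\<^bsub>2\<^esub> l4'
    + (l2' \<circ>\<^bsub>2\<^esub> l4')\<^bsup>cyc [1, 2]\<^esup>
    - (l2' \<circ>\<^bsub>2\<^esub> l4')\<^bsup>cyc [1, 2, 3]\<^esup>
    + (l2' \<circ>\<^bsub>2\<^esub> l4')\<^bsup>cyc [1, 2, 3, 4]\<^esup>
    + l3' \<circ>\<^bsub>1\<^esub> l3' + l3' \<circ>\<^bsub>2\<^esub> l3'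
    - (l3' \<circ>\<^bsub>2\<^esub> l3')\<^bsup>cyc [1, 2]\<^esup>
    + (l3' \<circ>\<^bsub>2\<^esub> l3')\<^bsup>cyc [1, 2, 3]\<^esup>
    + l3' \<circ>\<^bsub>3\<^esub> l3'
    - (l3' \<circ>\<^bsub>3\<^esub> l3')\<^bsup>cyc [2, 3]\<^esup>
    + (l3' \<circ>\<^bsub>3\<^esub> l3')\<^bsup>cyc [1, 3, 2]\<^esup>
    + (l3' \<circ>\<^bsub>3\<^esub> l3')\<^bsup>cyc [2, 3, 4]\<^esup>
    - (l3' \<circ>\<^bsub>3\<^esub> l3')\<^bsup>cyc [1, 3, 4, 2]\<^esup>
    + (l3' \<circ>\<^bsub>3\<^esub> l3')\<^bsup>cyc [1, 3] \<circ> cyc [2, 4]\<^esup>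
    + l4' \<circ>\<^bsub>1\<^esub> l2' - l4' \<circ>\<^bsub>2\<^esub> l2'
    + (l4' \<circ>\<^bsub>2\<^esub> l2')\<^bsup>cyc [1, 2]\<^esup>
    + l4' \<circ>\<^bsub>3\<^esub> l2'
    - (l4' \<circ>\<^bsub>3\<^esub> l2')\<^bsup>cyc [2, 3]\<^esup>
    + (l4' \<circ>\<^bsub>3\<^esub> l2')\<^bsup>cyc [1, 3, 2]\<^esup>
    - l4' \<circ>\<^bsub>4\<^esub> l2'
    + (l4' \<circ>\<^bsub>4\<^esub> l2')\<^bsup>cyc [3, 4]\<^esup>
    - (l4' \<circ>\<^bsub>4\<^esub> l2')\<^bsup>cyc [2, 4, 3]\<^esup>
    + (l4' \<circ>\<^bsub>4\<^esub> l2')\<^bsup>cyc [1, 4, 3, 2]\<^esup>" (is "?A \<doteq>\<^bsub>L'\<^esub> ?B")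
proof (rule eq_on_top[OF _ _ l_5])
  show "mmap_on s' L' s' L' 5 2 (?A)" "mmap_on s' L' s' L' 5 2 (?B)"
    by ((intro closure)?; simp add: maps SS.mmap_on_zero del: One_nat_def)+
next
  fix xs assume xs: "length xs = 5" "set xs \<subseteq> L' 0"
  then obtain x y z w v where eq: "xs = [x, y, z, w, v]"
    by (auto simp: length_Suc_conv numeral_eq_Suc)
  have mem: "x \<in> L' 0" "y \<in> L' 0" "z \<in> L' 0" "w \<in> L' 0" "v \<in> L' 0" using xs by (auto simp: eq)
  \<comment> \<open>The shapes are \<open>l4\<close> with one \<open>i2\<close>, \<open>l3\<close>
    with one \<open>i3\<close> or two \<open>i2\<close>, \<open>l2\<close> with \<open>i2\<close>
    and \<open>i3\<close>, and \<open>i2\<close>, \<open>i3\<close> on \<open>l4'\<close>,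
    \<open>l3'\<close>. Components of arity 4 and 5 raise degree by at least 3 and contribute
    nothing.\<close>
  let ?T = "app l4 [val i [(0, x)], val i2 [(0, y), (0, z)], val i [(0, w)], val i [(0, v)]]
      + app l4 [val i [(0, x)], val i [(0, z)], val i2 [(0, y), (0, w)], val i [(0, v)]]
      + app l4 [val i [(0, x)], val i [(0, z)], val i [(0, w)], val i2 [(0, y), (0, v)]]
      + app l4 [val i [(0, x)], val i [(0, y)], val i [(0, z)], val i2 [(0, w), (0, v)]]
      + app l3 [val i3 [(0, x), (0, y), (0, z)], val i [(0, w)], val i [(0, v)]]
      + app l3 [val i2 [(0, x), (0, z)], val i [(0, w)], val i2 [(0, y), (0, v)]]
      + app l3 [val i2 [(0, x), (0, z)], val i2 [(0, y), (0, w)], val i [(0, v)]]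
      + app l3 [val i2 [(0, x), (0, y)], val i [(0, z)], val i2 [(0, w), (0, v)]]
      + app l3 [val i [(0, z)], val i3 [(0, x), (0, y), (0, w)], val i [(0, v)]]
      + app l3 [val i [(0, z)], val i2 [(0, x), (0, w)], val i2 [(0, y), (0, v)]]
      + app l3 [val i [(0, z)], val i [(0, w)], val i3 [(0, x), (0, y), (0, v)]]
      + app l3 [val i [(0, y)], val i2 [(0, z), (0, w)], val i2 [(0, x), (0, v)]]
      + app l3 [val i [(0, y)], val i2 [(0, x), (0, z)], val i2 [(0, w), (0, v)]]
      + app i3 [(0, y), (0, w), val l3' [(0, x), (0, z), (0, v)]]
      + app l3 [val i [(0, y)], val i [(0, z)], val i3 [(0, x), (0, w), (0, v)]]
      + app i3 [(0, y), val l3' [(0, x), (0, z), (0, w)], (0, v)]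
      + app l3 [val i [(0, x)], val i3 [(0, y), (0, z), (0, w)], val i [(0, v)]]
      + app l3 [val i [(0, x)], val i2 [(0, y), (0, w)], val i2 [(0, z), (0, v)]]
      + app l3 [val i [(0, x)], val i [(0, w)], val i3 [(0, y), (0, z), (0, v)]]
      + app i3 [(0, x), (0, z), val l3' [(0, y), (0, w), (0, v)]]
      + app l3 [val i [(0, x)], val i [(0, y)], val i3 [(0, z), (0, w), (0, v)]]
      + app l2 [val i3 [(0, x), (0, z), (0, w)], val i2 [(0, y), (0, v)]]
      + app l2 [val i3 [(0, x), (0, y), (0, z)], val i2 [(0, w), (0, v)]]
      + app l2 [val i2 [(0, y), (0, w)], val i3 [(0, x), (0, z), (0, v)]]
      + app l2 [val i2 [(0, x), (0, z)], val i3 [(0, y), (0, w), (0, v)]]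
      + app i2 [(0, z), val l4' [(0, x), (0, y), (0, w), (0, v)]]
      + app i2 [(0, x), val l4' [(0, y), (0, z), (0, w), (0, v)]]
      - app l4 [val i2 [(0, x), (0, y)], val i [(0, z)], val i [(0, w)], val i [(0, v)]]
      - app l4 [val i [(0, y)], val i2 [(0, x), (0, z)], val i [(0, w)], val i [(0, v)]]
      - app l4 [val i [(0, y)], val i [(0, z)], val i2 [(0, x), (0, w)], val i [(0, v)]]
      - app l4 [val i [(0, y)], val i [(0, z)], val i [(0, w)], val i2 [(0, x), (0, v)]]
      - app l4 [val i [(0, x)], val i [(0, y)], val i2 [(0, z), (0, w)], val i [(0, v)]]
      - app l4 [val i [(0, x)], val i [(0, y)], val i [(0, w)], val i2 [(0, z), (0, v)]]
      - app l3 [val i2 [(0, y), (0, z)], val i [(0, w)], val i2 [(0, x), (0, v)]]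
      - app l3 [val i2 [(0, y), (0, z)], val i2 [(0, x), (0, w)], val i [(0, v)]]
      - app l3 [val i2 [(0, x), (0, y)], val i [(0, w)], val i2 [(0, z), (0, v)]]
      - app l3 [val i2 [(0, x), (0, y)], val i2 [(0, z), (0, w)], val i [(0, v)]]
      - app l3 [val i [(0, z)], val i2 [(0, y), (0, w)], val i2 [(0, x), (0, v)]]
      - app i3 [(0, z), (0, w), val l3' [(0, x), (0, y), (0, v)]]
      - app i3 [(0, z), val l3' [(0, x), (0, y), (0, w)], (0, v)]
      - app l3 [val i [(0, y)], val i3 [(0, x), (0, z), (0, w)], val i [(0, v)]]
      - app l3 [val i [(0, y)], val i2 [(0, x), (0, w)], val i2 [(0, z), (0, v)]]
      - app l3 [val i [(0, y)], val i [(0, w)], val i3 [(0, x), (0, z), (0, v)]]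
      - app i3 [(0, y), (0, z), val l3' [(0, x), (0, w), (0, v)]]
      - app l3 [val i [(0, x)], val i2 [(0, z), (0, w)], val i2 [(0, y), (0, v)]]
      - app l3 [val i [(0, x)], val i2 [(0, y), (0, z)], val i2 [(0, w), (0, v)]]
      - app i3 [(0, x), (0, w), val l3' [(0, y), (0, z), (0, v)]]
      - app l3 [val i [(0, x)], val i [(0, z)], val i3 [(0, y), (0, w), (0, v)]]
      - app i3 [(0, x), (0, y), val l3' [(0, z), (0, w), (0, v)]]
      - app i3 [(0, x), val l3' [(0, y), (0, z), (0, w)], (0, v)]
      - app i3 [val l3' [(0, x), (0, y), (0, z)], (0, w), (0, v)]
      - app i2 [val l4' [(0, x), (0, y), (0, z), (0, w)], (0, v)]
      - app l2 [val i3 [(0, y), (0, z), (0, w)], val i2 [(0, x), (0, v)]]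
      - app l2 [val i3 [(0, x), (0, y), (0, w)], val i2 [(0, z), (0, v)]]
      - app l2 [val i2 [(0, z), (0, w)], val i3 [(0, x), (0, y), (0, v)]]
      - app l2 [val i2 [(0, y), (0, z)], val i3 [(0, x), (0, w), (0, v)]]
      - app l2 [val i2 [(0, x), (0, w)], val i3 [(0, y), (0, z), (0, v)]]
      - app l2 [val i2 [(0, x), (0, y)], val i3 [(0, z), (0, w), (0, v)]]
      - app i2 [(0, w), val l4' [(0, x), (0, y), (0, z), (0, v)]]
      - app i2 [(0, y), val l4' [(0, x), (0, z), (0, w), (0, v)]]"
  have "?T \<in> L 3"
    by ((intro big.add_mem big.diff_mem big.minus_mem)?; use mem in \<open>simp add: elementwise\<close>)
  then show "\<exists>T \<in> L 3. app i [(2, app ?A (map (Pair 0) xs))] - app i [(2, app ?B (map (Pair 0) xs))] =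
      app (zero_mmap 5 2)
        (map (\<lambda>x. (0, app i [(0, x)])) xs) -
      app (l2 \<circ>\<^bsub>1\<^esub> l4 - l2 \<circ>\<^bsub>2\<^esub> l4
        + (l2 \<circ>\<^bsub>2\<^esub> l4)\<^bsup>cyc [1, 2]\<^esup>
        - (l2 \<circ>\<^bsub>2\<^esub> l4)\<^bsup>cyc [1, 2, 3]\<^esup>
        + (l2 \<circ>\<^bsub>2\<^esub> l4)\<^bsup>cyc [1, 2, 3, 4]\<^esup>
        + l3 \<circ>\<^bsub>1\<^esub> l3 + l3 \<circ>\<^bsub>2\<^esub> l3
        - (l3 \<circ>\<^bsub>2\<^esub> l3)\<^bsup>cyc [1, 2]\<^esup>
        + (l3 \<circ>\<^bsub>2\<^esub> l3)\<^bsup>cyc [1, 2, 3]\<^esup>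
        + l3 \<circ>\<^bsub>3\<^esub> l3
        - (l3 \<circ>\<^bsub>3\<^esub> l3)\<^bsup>cyc [2, 3]\<^esup>
        + (l3 \<circ>\<^bsub>3\<^esub> l3)\<^bsup>cyc [1, 3, 2]\<^esup>
        + (l3 \<circ>\<^bsub>3\<^esub> l3)\<^bsup>cyc [2, 3, 4]\<^esup>
        - (l3 \<circ>\<^bsub>3\<^esub> l3)\<^bsup>cyc [1, 3, 4, 2]\<^esup>
        + (l3 \<circ>\<^bsub>3\<^esub> l3)\<^bsup>cyc [1, 3] \<circ> cyc [2, 4]\<^esup>
        + l4 \<circ>\<^bsub>1\<^esub> l2 - l4 \<circ>\<^bsub>2\<^esub> l2
        + (l4 \<circ>\<^bsub>2\<^esub> l2)\<^bsup>cyc [1, 2]\<^esup>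
        + l4 \<circ>\<^bsub>3\<^esub> l2
        - (l4 \<circ>\<^bsub>3\<^esub> l2)\<^bsup>cyc [2, 3]\<^esup>
        + (l4 \<circ>\<^bsub>3\<^esub> l2)\<^bsup>cyc [1, 3, 2]\<^esup>
        - l4 \<circ>\<^bsub>4\<^esub> l2
        + (l4 \<circ>\<^bsub>4\<^esub> l2)\<^bsup>cyc [3, 4]\<^esup>
        - (l4 \<circ>\<^bsub>4\<^esub> l2)\<^bsup>cyc [2, 4, 3]\<^esup>
        + (l4 \<circ>\<^bsub>4\<^esub> l2)\<^bsup>cyc [1, 4, 3, 2]\<^esup>)
        (map (\<lambda>x. (0, app i [(0, x)])) xs) + app d [(3, T)]"
    by (rule bexI[rotated]) (use mem in \<open>simp add: eq elementwise top_evals algebra_simps\<close>)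
qed simp

section \<open>Assembling the structure and the morphism\<close>

lemma transferred_weak_lie3: "weak_lie3 s' L' d' l2' l3' l4' l21' l211' l31' l32'"
  by unfold_locales
    (fact maps bd_l2' bd_l3' bd_l4' bd_l21' bd_l211' bd_l31' bd_l32' l_5' l211_skew' l31_skew'
      l31_l32' l32_skew' l4_12' l4_23' l4_34')+

text \<open>The equations \<open>\<partial> f = i \<lambda>' - r\<close> and
  \<open>i \<lambda>' = r\<close> differ from the axioms only by regrouping sums, so compositions
  can stay folded.\<close>

lemma transferred_morphism:
  "weak_lie3_morphism s' L' d' l2' l3' l4' l21' l211' l31' l32'
      s L d l2 l3 l4 l21 l211 l31 l32 i i2 i21 i3"
proof -
  interpret new: weak_lie3 s' L' d' l2' l3' l4' l21' l211' l31' l32' by (rule transferred_weak_lie3)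
  show ?thesis
    by unfold_locales
      (use i_chain bd_i2 bd_i3 bd_i21 i_l4' i_l211' i_l31' i_l32' in
        \<open>simp_all add: maps eq_on_def r2_def r3_def r21_def r4_def r211_def r31_def r32_def algebra_simps
          del: app_pcomp app_tcomp One_nat_def\<close>)
qed

end

theorem proposition3p6:
  fixes s :: "'k::{comm_ring,comm_monoid_mult} \<Rightarrow> 'v::ab_group_add \<Rightarrow> 'v"
    and L :: "int \<Rightarrow> 'v set"
    and d l2 l3 l4 l21 l211 l31 l32 :: "('v, 'v) mmap"
    and s' :: "'k \<Rightarrow> 'w::ab_group_add \<Rightarrow> 'w"
    and L' :: "int \<Rightarrow> 'w set"
    and d' :: "('w, 'w) mmap"
    and p :: "('v, 'w) mmap" and i :: "('w, 'v) mmap" and h :: "('v, 'v) mmap"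
  assumes "weak_lie3 s L d l2 l3 l4 l21 l211 l31 l32"
    and "deformation_retract s L d s' L' d' p i h"
  shows "\<exists>l2' l3' l4' l21' l211' l31' l32'.
           weak_lie3 s' L' d' l2' l3' l4' l21' l211' l31' l32' \<and>
           (\<exists>i2 i21 i3.
              weak_lie3_morphism
                s' L' d' l2' l3' l4' l21' l211' l31' l32'
                s L d l2 l3 l4 l21 l211 l31 l32
                i i2 i21 i3)"
proof -
  interpret deformation_retract s L d s' L' d' p i h by fact
  \<comment> \<open>The conclusion speaks of \<open>i\<close> but of no homotopy, so
    \<open>h (1 - i p)\<close> may take the place of \<open>h\<close>.\<close>
  interpret transfer s L d s' L' d' p i "h - h \<odot> [i] \<odot> [p]" l2 l3 l4 l21 l211 l31 l32
    using assms(1) normalized_homotopy by (simp add: transfer_def transfer_axioms_def)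
  show ?thesis using transferred_weak_lie3 transferred_morphism by blast
qed

end
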